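(* Let $K\subseteq\mathbb{R}^n$ be compact and let $\mathbb{I}=\{\mathbb{I}_1,\dots,\mathbb{I}_N\}$ be a random iterated function system on $K$ in which every map $S_{i,j}$ is a similarity contraction with ratio $\mathrm{Lip}(S_{i,j})\in(0,1)$. For each $i$ let $s_i$ solve $\sum_{j\in\mathcal{I}_i}\mathrm{Lip}(S_{i,j})^{s_i}=1$, and write $s_{\min}=\min_is_i$, $s_{\max}=\max_is_i$, $\mathcal{H}_{\min}=\inf_{\omega\in\Omega}\mathcal{H}^{s_{\min}}(F_\omega)$, $\mathcal{P}_{\max}=\sup_{\omega\in\Omega}\mathcal{P}^{s_{\max}}(F_\omega)$. Assume $\mathbb{I}$ satisfies the uniform open set condition and the $\mathcal{P}^{s_{\min}}$-measure separated condition. Then: (1) if $s_{\min}=s_{\max}=s$, then for a typical $\omega\in\Omega$, $\dim_{\mathrm H}F_\omega=\dim_{\mathrm P}F_\omega=s$ and $0<\mathcal{H}^s(F_\omega)=\mathcal{H}_{\min}\le\mathcal{P}_{\max}=\mathcal{P}^s(F_\omega)<\infty$; (2) if $s_{\min}<s_{\max}$, then for a typical $\omega\in\Omega$, $\dim_{\mathrm H}F_\omega=s_{\min}<s_{\max}=\dim_{\mathrm P}F_\omega$, $\mathcal{H}^{s_{\min}}(F_\omega)=\infty$ and $\mathcal{P}^{s_{\max}}(F_\omega)=0$.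
   Context: Here $\mathbb{I}_i=\{S_{i,j}\}_{j\in\mathcal{I}_i}$ with $\mathcal{I}_i$ finite nonempty and each $S_{i,j}:K\to K$ a similarity with ratio $\mathrm{Lip}(S_{i,j})$. $\Omega=\{1,\dots,N\}^{\mathbb{N}}$ with metric $d_\Omega(u,v)=2^{-\min\{n:u_n\ne v_n\}}$, and $F_\omega=\bigcap_k\bigcup_{i_1\in\mathcal{I}_{\omega_1},\dots,i_k\in\mathcal{I}_{\omega_k}}S_{\omega_1,i_1}\circ\cdots\circ S_{\omega_k,i_k}(K)$. "Typical $\omega$" means the set of such $\omega$ is residual in $(\Omega,d_\Omega)$. Uniform open set condition: there is a nonempty open $\mathcal{O}\subseteq K$ with $\bigcup_{j\in\mathcal{I}_i}S_{i,j}(\mathcal{O})\subseteq\mathcal{O}$, union disjoint, for every $i$. For a Borel measure $\mu$, the $\mu$-measure separated condition means: for all $\omega\in\Omega$, all $l$ and all $i\ne j$ in $\mathcal{I}_l$, $\mu(S_{l,i}(F_\omega)\cap S_{l,j}(F_\omega))=0$. $\mathcal{H}^s,\mathcal{P}^s$ are $s$-dimensional Hausdorff and packing measures; $\dim_{\mathrm H},\dim_{\mathrm P}$ Hausdorff and packing dimension. *)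

theory Defs
  imports "HOL-Analysis.Analysis"
begin

definition Omega :: "nat \<Rightarrow> (nat \<Rightarrow> nat) set" where
  "Omega N = {\<omega>. \<forall>n. \<omega> n \<in> {1..N}}"

text \<open>d(u,v) = 2^(-min{n : u_n \<noteq> v_n}), sequences indexed from 1 (here stored from 0).\<close>
definition dOmega :: "(nat \<Rightarrow> nat) \<Rightarrow> (nat \<Rightarrow> nat) \<Rightarrow> real" where
  "dOmega u v = (if u = v then 0 else (1/2) ^ Suc (LEAST n. u n \<noteq> v n))"

definition Omega_top :: "nat \<Rightarrow> (nat \<Rightarrow> nat) topology" where
  "Omega_top N = Metric_space.mtopology (Omega N) dOmega"

definition nowhere_dense_in :: "'a topology \<Rightarrow> 'a set \<Rightarrow> bool" where
  "nowhere_dense_in X A \<longleftrightarrow> A \<subseteq> topspace X \<and> X interior_of (X closure_of A) = {}"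

definition meagre_in :: "'a topology \<Rightarrow> 'a set \<Rightarrow> bool" where
  "meagre_in X A \<longleftrightarrow> (\<exists>C :: nat \<Rightarrow> 'a set. (\<forall>i. nowhere_dense_in X (C i)) \<and> A = (\<Union>i. C i))"

definition residual_in :: "'a topology \<Rightarrow> 'a set \<Rightarrow> bool" where
  "residual_in X A \<longleftrightarrow> A \<subseteq> topspace X \<and> meagre_in X (topspace X - A)"

fun comps :: "(nat \<Rightarrow> nat \<Rightarrow> 'a \<Rightarrow> 'a) \<Rightarrow> (nat \<Rightarrow> nat set) \<Rightarrow> (nat \<Rightarrow> nat) \<Rightarrow> nat \<Rightarrow> ('a \<Rightarrow> 'a) set" where
  "comps S J \<omega> 0 = {id}"
| "comps S J \<omega> (Suc k) = {f \<circ> S (\<omega> k) j | f j. f \<in> comps S J \<omega> k \<and> j \<in> J (\<omega> k)}"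

definition attractor :: "'a set \<Rightarrow> (nat \<Rightarrow> nat \<Rightarrow> 'a \<Rightarrow> 'a) \<Rightarrow> (nat \<Rightarrow> nat set) \<Rightarrow> (nat \<Rightarrow> nat) \<Rightarrow> 'a set" where
  "attractor K S J \<omega> = (\<Inter>k. \<Union>f\<in>comps S J \<omega> k. f ` K)"

definition diam_pow :: "'a::metric_space set \<Rightarrow> real \<Rightarrow> ennreal" where
  "diam_pow U s = (if U = {} then 0 else if s = 0 then 1 else ennreal (diameter U powr s))"

definition hausdorff_delta :: "real \<Rightarrow> real \<Rightarrow> 'a::metric_space set \<Rightarrow> ennreal" where
  "hausdorff_delta s \<delta> A = (INF C \<in> {C :: nat \<Rightarrow> 'a set. A \<subseteq> (\<Union>i. C i) \<and>
        (\<forall>i. bounded (C i) \<and> diameter (C i) \<le> \<delta>)}. (\<Sum>i. diam_pow (C i) s))"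

definition hausdorff_measure :: "real \<Rightarrow> 'a::metric_space set \<Rightarrow> ennreal" where
  "hausdorff_measure s A = (SUP \<delta> \<in> {0<..}. hausdorff_delta s \<delta> A)"

definition hausdorff_dim :: "'a::metric_space set \<Rightarrow> real" where
  "hausdorff_dim A = Inf {s. 0 \<le> s \<and> hausdorff_measure s A = 0}"

definition packing_delta :: "real \<Rightarrow> real \<Rightarrow> 'a::metric_space set \<Rightarrow> ennreal" where
  "packing_delta s \<delta> A = (SUP (I, x, r) \<in> {(I :: nat set, x :: nat \<Rightarrow> 'a, r :: nat \<Rightarrow> real).
        (\<forall>i\<in>I. x i \<in> A \<and> 0 < r i \<and> r i \<le> \<delta>) \<and>
        (\<forall>i\<in>I. \<forall>j\<in>I. i \<noteq> j \<longrightarrow> cball (x i) (r i) \<inter> cball (x j) (r j) = {})}.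
      (\<Sum>i. if i \<in> I then ennreal ((2 * r i) powr s) else 0))"

definition packing_premeasure :: "real \<Rightarrow> 'a::metric_space set \<Rightarrow> ennreal" where
  "packing_premeasure s A = (INF \<delta> \<in> {0<..}. packing_delta s \<delta> A)"

definition packing_measure :: "real \<Rightarrow> 'a::metric_space set \<Rightarrow> ennreal" where
  "packing_measure s A = (INF C \<in> {C :: nat \<Rightarrow> 'a set. A \<subseteq> (\<Union>i. C i)}.
        (\<Sum>i. packing_premeasure s (C i)))"

definition packing_dim :: "'a::metric_space set \<Rightarrow> real" where
  "packing_dim A = Inf {s. 0 \<le> s \<and> packing_measure s A = 0}"

end

theory Submission
  imports Defs
begin

text \<open>Semicontinuity of \<open>\<omega> \<mapsto> F\<^sub>\<omega>\<close> makes upper bounds for Hausdorff contents and lower bounds for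
  packing sums stable under perturbation of late entries of \<open>\<omega>\<close>, while prepending a finite word to
  \<open>\<omega>\<close> does not destroy the extremal behaviour of \<open>F\<^sub>\<omega>\<close>; so extremal behaviour is typical. The open set
  condition gives, by a volume count, \<open>\<H>\<^sup>s(F\<^sub>\<omega>) \<ge> c \<Prod>\<^sub>i\<^sub><\<^sub>l \<Sum>\<^sub>j Lip(S\<^sub>\<omega>\<^sub>i\<^sub>j)\<^sup>s\<close> for all \<open>l\<close>, and the packing premeasure of
  exponent \<open>s\<^sub>m\<^sub>a\<^sub>x\<close> is bounded independently of \<open>\<omega>\<close>. On compact sets of finite premeasure the packing
  measure and its premeasure agree (a theorem of Feng, Hua and Wen), so the lower semicontinuity
  of the premeasure passes to the packing measure.\<close>

section \<open>Hausdorff measures\<close>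

text \<open>\<open>packing_measure\<close> is an infimum over covers, so its dependence on \<omega>
  is not visibly semicontinuous; the premeasure is better behaved, because a finite packing survives
  small motions of its centres. Hence the weight of \<open>packing_premeasure_outer_regular\<close>:
  it identifies the two on compact sets, and it makes both measures additive over copies that
  overlap in null sets. If all \<open>s i\<close> agree, this additivity and Moran sums equal to 1
  make the measures invariant under \<open>shift\<close>, so a near-extremal sequence stays so
  behind any finite word. If they differ, a typical sequence contains an index of least and one of
  largest \<open>s i\<close> infinitely often: the products of Moran sums are unbounded at exponent
  \<open>smin\<close>, which forces an infinite Hausdorff measure, and have infimum 0 at
  \<open>smax\<close>, which forces packing measure 0. The dimensions come from prefixed constant
  sequences; there Baire's theorem turns infinite premeasure of all small pieces into infinite
  packing measure.\<close>

lemma ennreal_less_add_pos: "x < top \<Longrightarrow> 0 < e \<Longrightarrow> x < x + ennreal e"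
  by (cases x rule: ennreal_cases) (auto simp: ennreal_less_iff simp flip: ennreal_plus)

lemma diameter_leI:
  assumes "0 \<le> d" "\<And>x y. x \<in> S \<Longrightarrow> y \<in> S \<Longrightarrow> dist x y \<le> d"
  shows "diameter S \<le> d"
  unfolding diameter_def using assms by (auto intro!: cSUP_least)

lemma ennreal_le_cmult_INF:
  assumes "0 < c" "\<And>i. i \<in> I \<Longrightarrow> x \<le> ennreal c * f i"
  shows "x \<le> ennreal c * (INF i\<in>I. f i)"
proof -
  have "ennreal (1/c) * x \<le> (INF i\<in>I. f i)"
  proof (rule INF_greatest)
    fix i assume "i \<in> I"
    then have "ennreal (1/c) * x \<le> ennreal (1/c) * (ennreal c * f i)"
      by (intro mult_left_mono assms) auto
    also have "\<dots> = f i" using assms(1) by (simp add: mult.assoc[symmetric] ennreal_mult'[symmetric])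
    finally show "ennreal (1/c) * x \<le> f i" .
  qed
  then have "ennreal c * (ennreal (1/c) * x) \<le> ennreal c * (INF i\<in>I. f i)"
    by (rule mult_left_mono) auto
  then show ?thesis using assms(1) by (simp add: mult.assoc[symmetric] ennreal_mult'[symmetric])
qed

text \<open>Shared by \<open>hausdorff_delta\<close>, where \<open>Q\<close> bounds the diameters,
  and \<open>packing_measure\<close>, where \<open>Q\<close> is trivial. Near-optimal covers of the
  \<open>B n\<close>, with errors \<open>e / 2^(n+1)\<close>, are merged through
  \<open>prod_decode\<close>.\<close>

lemma cover_INF_countably_subadditive:
  fixes g :: "'a set \<Rightarrow> ennreal" and \<mu> :: "'a set \<Rightarrow> ennreal"
  assumes \<mu>: "\<And>A. \<mu> A = (INF C\<in>{C :: nat \<Rightarrow> 'a set. A \<subseteq> (\<Union>i. C i) \<and> (\<forall>i. Q (C i))}. \<Sum>i. g (C i))"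
    and cover: "A \<subseteq> (\<Union>n. B n)"
  shows "\<mu> A \<le> (\<Sum>n. \<mu> (B n))"
proof (rule ennreal_le_epsilon)
  fix e :: real
  assume fin: "(\<Sum>n. \<mu> (B n)) < top" and e: "0 < e"
  have "\<exists>C. B n \<subseteq> (\<Union>i. C i) \<and> (\<forall>i. Q (C i)) \<and> (\<Sum>i. g (C i)) \<le> \<mu> (B n) + ennreal (e * (1/2) ^ Suc n)" for n
  proof -
    have "\<mu> (B n) < top"
      using fin ennreal_suminf_lessD by blast
    then have "\<mu> (B n) < \<mu> (B n) + ennreal (e * (1/2) ^ Suc n)"
      using e by (intro ennreal_less_add_pos) auto
    then show ?thesis
      by (subst (asm) \<mu>) (auto simp: INF_less_iff less_imp_le)
  qed
  then obtain C where C: "\<And>n. B n \<subseteq> (\<Union>i. C n i)" "\<And>n i. Q (C n i)"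
    "\<And>n. (\<Sum>i. g (C n i)) \<le> \<mu> (B n) + ennreal (e * (1/2) ^ Suc n)"
    by metis
  define D where "D = (\<lambda>k. case prod_decode k of (n, i) \<Rightarrow> C n i)"
  have "A \<subseteq> (\<Union>k. D k)"
  proof
    fix x assume "x \<in> A"
    then obtain n i where "x \<in> C n i" using cover C(1) by blast
    then have "x \<in> D (prod_encode (n, i))" by (simp add: D_def)
    then show "x \<in> (\<Union>k. D k)" by blast
  qed
  moreover have "Q (D k)" for k
    by (simp add: D_def C(2) split: prod.split)
  ultimately have "\<mu> A \<le> (\<Sum>k. g (D k))"
    by (subst \<mu>) (auto intro!: INF_lower)
  also have "\<dots> = (\<Sum>k. (\<lambda>(n, i). g (C n i)) (prod_decode k))"
    by (simp add: D_def split_def)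
  also have "\<dots> = (\<Sum>n. \<Sum>i. g (C n i))"
    by (rule suminf_ennreal_2dimen) simp
  also have "\<dots> \<le> (\<Sum>n. \<mu> (B n) + ennreal (e * (1/2) ^ Suc n))"
    by (intro suminf_le summableI C(3))
  also have "\<dots> = (\<Sum>n. \<mu> (B n)) + (\<Sum>n. ennreal (e * (1/2) ^ Suc n))"
    by (simp add: suminf_add[symmetric])
  also have "(\<Sum>n. ennreal (e * (1/2) ^ Suc n)) = ennreal e"
    by (rule suminf_ennreal_eq) (use e sums_mult[OF power_half_series, of e] in auto)
  finally show "\<mu> A \<le> (\<Sum>n. \<mu> (B n)) + ennreal e" .
qed

lemma suminf_two:
  fixes f :: "nat \<Rightarrow> ennreal"
  assumes "\<And>n. n \<ge> 2 \<Longrightarrow> f n = 0"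
  shows "(\<Sum>n. f n) = f 0 + f 1"
proof -
  have "(\<Sum>n. f n) = (\<Sum>n\<in>{0,1}. f n)"
    by (rule suminf_finite) (use assms in auto)
  then show ?thesis by simp
qed

text \<open>Covers are sequences throughout, so a union of two sets is padded with empty sets, on
  which the measures vanish.\<close>

lemma Un_conv_UN_nat: "A \<union> B = (\<Union>n::nat. if n = 0 then A else if n = 1 then B else {})"
  by (auto split: if_splits)

lemma hausdorff_delta_le_suminf:
  assumes "A \<subseteq> (\<Union>i. C i)" "\<And>i. bounded (C i)" "\<And>i. diameter (C i) \<le> \<delta>"
  shows "hausdorff_delta s \<delta> A \<le> (\<Sum>i. diam_pow (C i) s)"
  unfolding hausdorff_delta_def by (rule INF_lower) (use assms in auto)

lemma hausdorff_delta_mono: "A \<subseteq> B \<Longrightarrow> hausdorff_delta s \<delta> A \<le> hausdorff_delta s \<delta> B"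
  unfolding hausdorff_delta_def by (rule INF_superset_mono) auto

lemma hausdorff_delta_antimono: "\<delta> \<le> \<delta>' \<Longrightarrow> hausdorff_delta s \<delta>' A \<le> hausdorff_delta s \<delta> A"
  unfolding hausdorff_delta_def by (rule INF_superset_mono) (auto intro: order_trans)

lemma hausdorff_measure_upper: "0 < \<delta> \<Longrightarrow> hausdorff_delta s \<delta> A \<le> hausdorff_measure s A"
  unfolding hausdorff_measure_def by (rule SUP_upper) simp

lemma hausdorff_measure_le:
  assumes "\<And>\<delta>. 0 < \<delta> \<Longrightarrow> hausdorff_delta s \<delta> A \<le> c"
  shows "hausdorff_measure s A \<le> c"
  unfolding hausdorff_measure_def by (rule SUP_least) (use assms in auto)

lemma hausdorff_measure_mono: "A \<subseteq> B \<Longrightarrow> hausdorff_measure s A \<le> hausdorff_measure s B"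
  by (rule hausdorff_measure_le) (metis hausdorff_delta_mono hausdorff_measure_upper order_trans)

lemma hausdorff_delta_countably_subadditive:
  assumes "A \<subseteq> (\<Union>n. B n)"
  shows "hausdorff_delta s \<delta> A \<le> (\<Sum>n. hausdorff_delta s \<delta> (B n))"
  by (rule cover_INF_countably_subadditive[where Q = "\<lambda>C. bounded C \<and> diameter C \<le> \<delta>", OF _ assms])
    (rule hausdorff_delta_def)

lemma hausdorff_measure_countably_subadditive:
  assumes "A \<subseteq> (\<Union>n. B n)"
  shows "hausdorff_measure s A \<le> (\<Sum>n. hausdorff_measure s (B n))"
proof (rule hausdorff_measure_le)
  fix \<delta> :: real assume "0 < \<delta>"
  have "hausdorff_delta s \<delta> A \<le> (\<Sum>n. hausdorff_delta s \<delta> (B n))"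
    by (rule hausdorff_delta_countably_subadditive[OF assms])
  also have "\<dots> \<le> (\<Sum>n. hausdorff_measure s (B n))"
    by (intro suminf_le summableI hausdorff_measure_upper \<open>0 < \<delta>\<close>)
  finally show "hausdorff_delta s \<delta> A \<le> (\<Sum>n. hausdorff_measure s (B n))" .
qed

lemma hausdorff_measure_empty [simp]: "hausdorff_measure s {} = 0"
proof -
  have "hausdorff_measure s {} \<le> 0"
  proof (rule hausdorff_measure_le)
    fix \<delta> :: real assume "0 < \<delta>"
    then show "hausdorff_delta s \<delta> {} \<le> 0"
      using hausdorff_delta_le_suminf[of "{}" "\<lambda>_. {}" \<delta> s] by (simp add: diam_pow_def)
  qed
  then show ?thesis by simp
qed

lemma hausdorff_measure_Un_le: "hausdorff_measure s (A \<union> B) \<le> hausdorff_measure s A + hausdorff_measure s B"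
proof -
  let ?D = "\<lambda>n::nat. if n = 0 then A else if n = 1 then B else {}"
  have "hausdorff_measure s (A \<union> B) \<le> (\<Sum>n. hausdorff_measure s (?D n))"
    by (rule hausdorff_measure_countably_subadditive[OF equalityD1[OF Un_conv_UN_nat]])
  also have "\<dots> = hausdorff_measure s A + hausdorff_measure s B"
    by (subst suminf_two) auto
  finally show ?thesis .
qed

text \<open>By monotonicity in the gauge, the gauges \<open>1 / Suc n\<close> suffice. Inequalities
  between measures then follow as limits, and typicality involves only countably many
  gauges.\<close>

lemma LIMSEQ_hausdorff_delta:
  "(\<lambda>n. hausdorff_delta s (1 / Suc n) A) \<longlonglongrightarrow> hausdorff_measure s A"
proof -
  have "hausdorff_measure s A = (SUP n. hausdorff_delta s (1 / Suc n) A)"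
  proof (rule antisym[OF hausdorff_measure_le])
    fix \<delta> :: real assume "0 < \<delta>"
    then obtain n where "1 / Suc n < \<delta>" using nat_approx_posE by auto
    then have "hausdorff_delta s \<delta> A \<le> hausdorff_delta s (1 / Suc n) A"
      by (intro hausdorff_delta_antimono) simp
    then show "hausdorff_delta s \<delta> A \<le> (SUP n. hausdorff_delta s (1 / Suc n) A)"
      by (meson SUP_upper2 UNIV_I)
  qed (auto intro!: SUP_least hausdorff_measure_upper)
  moreover have "incseq (\<lambda>n. hausdorff_delta s (1 / Suc n) A)"
    by (intro monoI hausdorff_delta_antimono) (simp add: frac_le)
  ultimately show ?thesis using LIMSEQ_SUP by simp
qed

text \<open>A set of diameter below \<gamma> cannot meet both \<open>A\<close> and \<open>B\<close>,
  so a fine cover of the union splits into a cover of each.\<close>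

lemma hausdorff_measure_Un_separated:
  assumes \<gamma>: "0 < \<gamma>" and sep: "\<And>x y. x \<in> A \<Longrightarrow> y \<in> B \<Longrightarrow> \<gamma> \<le> dist x y"
  shows "hausdorff_measure s A + hausdorff_measure s B \<le> hausdorff_measure s (A \<union> B)"
proof (rule LIMSEQ_le[OF tendsto_add[OF LIMSEQ_hausdorff_delta LIMSEQ_hausdorff_delta] LIMSEQ_hausdorff_delta])
  obtain n0 where n0: "1 / Suc n0 < \<gamma>" using nat_approx_posE[OF \<gamma>] by auto
  have "hausdorff_delta s \<delta> A + hausdorff_delta s \<delta> B \<le> hausdorff_delta s \<delta> (A \<union> B)"
    if "\<delta> < \<gamma>" "0 < \<delta>" for \<delta>
    unfolding hausdorff_delta_def[of s \<delta> "A \<union> B"]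
  proof (rule INF_greatest, clarify)
    fix C :: "nat \<Rightarrow> 'a set"
    assume C: "A \<union> B \<subseteq> (\<Union>i. C i)" "\<forall>i. bounded (C i) \<and> diameter (C i) \<le> \<delta>"
    let ?C1 = "\<lambda>i. if C i \<inter> A = {} then {} else C i" and ?C2 = "\<lambda>i. if C i \<inter> A = {} then C i else {}"
    have "hausdorff_delta s \<delta> A \<le> (\<Sum>i. diam_pow (?C1 i) s)"
      using C that by (intro hausdorff_delta_le_suminf) fastforce+
    moreover have "hausdorff_delta s \<delta> B \<le> (\<Sum>i. diam_pow (?C2 i) s)"
    proof (intro hausdorff_delta_le_suminf)
      have "C i \<inter> A = {}" if "y \<in> B" "y \<in> C i" for y i
      proof (rule ccontr)
        assume "C i \<inter> A \<noteq> {}"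
        then obtain x where x: "x \<in> C i" "x \<in> A" by blast
        then have "dist x y \<le> \<delta>"
          using C(2) that diameter_bounded_bound by (metis order_trans)
        then show False using sep[OF x(2) that(1)] \<open>\<delta> < \<gamma>\<close> by simp
      qed
      then show "B \<subseteq> (\<Union>i. ?C2 i)" using C(1) by fastforce
    qed (use C that in auto)
    ultimately have "hausdorff_delta s \<delta> A + hausdorff_delta s \<delta> B
        \<le> (\<Sum>i. diam_pow (?C1 i) s) + (\<Sum>i. diam_pow (?C2 i) s)"
      by (rule add_mono)
    also have "\<dots> = (\<Sum>i. diam_pow (?C1 i) s + diam_pow (?C2 i) s)"
      by (simp add: suminf_add)
    also have "\<dots> = (\<Sum>i. diam_pow (C i) s)"
      by (intro suminf_cong) (simp add: diam_pow_def)
    finally show "hausdorff_delta s \<delta> A + hausdorff_delta s \<delta> B \<le> (\<Sum>i. diam_pow (C i) s)" .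
  qed
  moreover have "1 / Suc n < \<gamma>" if "n \<ge> n0" for n
    using n0 that frac_le[of 1 1 "real (Suc n0)" "real (Suc n)"] by simp
  ultimately show "\<exists>N. \<forall>n\<ge>N. hausdorff_delta s (1 / Suc n) A + hausdorff_delta s (1 / Suc n) B
      \<le> hausdorff_delta s (1 / Suc n) (A \<union> B)"
    by (intro exI[of _ n0]) auto
qed

section \<open>Finite open covers of compact sets\<close>

lemma diam_pow_le:
  assumes "0 \<le> s" "0 < d" "bounded V" "diameter V \<le> d"
  shows "diam_pow V s \<le> ennreal (d powr s)"
  using assms diameter_ge_0[of V] by (auto simp: diam_pow_def powr_mono2)

lemma hausdorff_delta_le_finite:
  assumes s: "0 \<le> s" and fin: "finite I" and cover: "A \<subseteq> (\<Union>i\<in>I. V i)"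
    and V: "\<And>i. i \<in> I \<Longrightarrow> bounded (V i) \<and> diameter (V i) \<le> d i \<and> 0 < d i \<and> d i \<le> \<delta>" and \<delta>: "0 \<le> \<delta>"
  shows "hausdorff_delta s \<delta> A \<le> ennreal (\<Sum>i\<in>I. d i powr s)"
proof -
  obtain h where h: "bij_betw h {..<card I} I"
    using ex_bij_betw_nat_finite[OF fin] by (auto simp: atLeast0LessThan)
  let ?C = "\<lambda>n. if n < card I then V (h n) else {}"
  have hI: "h n \<in> I" if "n < card I" for n using h that by (auto simp: bij_betw_def)
  have "A \<subseteq> (\<Union>n. ?C n)"
  proof
    fix x assume "x \<in> A"
    then obtain i where "i \<in> I" "x \<in> V i" using cover by blast
    moreover then obtain n where "n < card I" "h n = i"
      using h by (metis bij_betw_imp_surj_on imageE lessThan_iff)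
    ultimately have "x \<in> ?C n" by simp
    then show "x \<in> (\<Union>n. ?C n)" by blast
  qed
  then have "hausdorff_delta s \<delta> A \<le> (\<Sum>n. diam_pow (?C n) s)"
    by (rule hausdorff_delta_le_suminf) (use hI V \<delta> in \<open>auto intro: order_trans\<close>)
  also have "\<dots> = (\<Sum>n\<in>{..<card I}. diam_pow (?C n) s)"
    by (rule suminf_finite) (auto simp: diam_pow_def)
  also have "\<dots> \<le> (\<Sum>n\<in>{..<card I}. ennreal (d (h n) powr s))"
    by (intro sum_mono) (use hI V s in \<open>auto intro!: diam_pow_le\<close>)
  also have "\<dots> = (\<Sum>i\<in>I. ennreal (d i powr s))"
    by (rule sum.reindex_bij_betw[OF h])
  finally show ?thesis by simp
qed

text \<open>The positive number \<open>d\<close> stands in for the diameter, which may be 0.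
  Enlarging raises the diameter, so the gauge is relaxed from \<open>\<delta>\<close> to
  \<open>\<delta>'\<close>.\<close>

lemma open_enlargement:
  fixes C :: "'a::metric_space set"
  assumes s: "0 \<le> s" and C: "bounded C" "C \<noteq> {}" "diameter C \<le> \<delta>" "\<delta> < \<delta>'" and e: "0 < e"
  obtains V d where "open V" "C \<subseteq> V" "bounded V" "diameter V \<le> d" "0 < d" "d \<le> \<delta>'"
    "ennreal (d powr s) \<le> diam_pow C s + ennreal e"
proof -
  define D where "D = diameter C"
  have D0: "0 \<le> D" by (simp add: D_def diameter_ge_0 C)
  have "\<exists>\<eta>>0. (D + \<eta>) powr s \<le> enn2real (diam_pow C s) + e \<and> D + \<eta> \<le> \<delta>'"
  proof (cases "s = 0")
    case True
    \<comment> \<open>For \<open>s = 0\<close> the cost does not depend on the size, so any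
      enlargement that respects \<open>\<delta>'\<close> will do.\<close>
    then show ?thesis using C D0 e
      by (intro exI[of _ "\<delta>' - D"]) (auto simp: diam_pow_def D_def)
  next
    case False
    have "((\<lambda>\<eta>. (D + \<eta>) powr s) \<longlongrightarrow> (D + 0) powr s) (at_right 0)"
      using False s D0 by (intro tendsto_powr2 tendsto_intros) (auto simp: eventually_at_filter)
    then have "\<forall>\<^sub>F \<eta> in at_right 0. (D + \<eta>) powr s < D powr s + e"
      using e by (intro order_tendstoD) auto
    moreover have "\<forall>\<^sub>F \<eta> in at_right (0::real). \<eta> < \<delta>' - D"
      using C by (intro order_tendstoD(2)[OF tendsto_ident_at]) (auto simp: D_def)
    ultimately have "\<forall>\<^sub>F \<eta> in at_right 0. (D + \<eta>) powr s < D powr s + e \<and> \<eta> < \<delta>' - D \<and> 0 < \<eta>"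
      by (auto intro!: eventually_conj simp: eventually_at_right_less)
    then obtain \<eta> where "(D + \<eta>) powr s < D powr s + e" "\<eta> < \<delta>' - D" "0 < \<eta>"
      using eventually_happens trivial_limit_at_right_real by blast
    then show ?thesis using False C by (intro exI[of _ \<eta>]) (auto simp: diam_pow_def D_def)
  qed
  then obtain \<eta> where \<eta>: "0 < \<eta>" "(D + \<eta>) powr s \<le> enn2real (diam_pow C s) + e" "D + \<eta> \<le> \<delta>'"
    by blast
  let ?V = "\<Union>x\<in>C. ball x (\<eta>/2)"
  have dV: "dist x y \<le> D + \<eta>" if xy: "x \<in> ?V" "y \<in> ?V" for x y
  proof -
    obtain x' y' where x': "x' \<in> C" "y' \<in> C" "dist x' x < \<eta>/2" "dist y' y < \<eta>/2" using xy by auto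
    moreover have "dist x' y' \<le> D" unfolding D_def using x' C diameter_bounded_bound by blast
    moreover have "dist x y \<le> dist x' x + dist x' y' + dist y' y"
      by (metis add.commute add_right_mono dist_commute dist_triangle dist_triangle2 order_trans)
    ultimately show ?thesis by simp
  qed
  show thesis
  proof
    show "open ?V" by auto
    show "C \<subseteq> ?V" using \<eta> by force
    show "bounded ?V"
      unfolding bounded_two_points using dV by blast
    show "diameter ?V \<le> D + \<eta>"
      by (rule diameter_leI) (use dV \<eta> D0 in simp_all)
    show "0 < D + \<eta>" using \<eta> D0 by simp
    show "D + \<eta> \<le> \<delta>'" by (rule \<eta>)
    have "diam_pow C s = ennreal (enn2real (diam_pow C s))" by (simp add: diam_pow_def)
    then show "ennreal ((D + \<eta>) powr s) \<le> diam_pow C s + ennreal e"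
      using \<eta>(2) e by (metis enn2real_nonneg ennreal_leI ennreal_plus less_imp_le)
  qed
qed

text \<open>Open enlargements followed by compactness. A finite open cover of \<open>A\<close> also
  covers all compact sets close to \<open>A\<close>, which makes \<open>hausdorff_delta\<close>
  stable from above.\<close>

lemma hausdorff_delta_finite_open_cover:
  fixes A :: "'a::metric_space set"
  assumes s: "0 \<le> s" and A: "compact A" and lt: "hausdorff_delta s \<delta> A < t" and \<delta>: "\<delta> < \<delta>'"
  obtains I :: "nat set" and V d where "finite I" "A \<subseteq> (\<Union>i\<in>I. V i)"
    "\<And>i. i \<in> I \<Longrightarrow> open (V i) \<and> bounded (V i) \<and> diameter (V i) \<le> d i \<and> 0 < d i \<and> d i \<le> \<delta>'"
    "ennreal (\<Sum>i\<in>I. d i powr s) < t"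
proof -
  obtain C where C: "A \<subseteq> (\<Union>i. C i)" "\<And>i. bounded (C i) \<and> diameter (C i) \<le> \<delta>"
    "(\<Sum>i. diam_pow (C i) s) < t"
    using lt unfolding hausdorff_delta_def INF_less_iff by auto
  \<comment> \<open>The gap up to \<open>t'\<close> pays for all enlargements together, and
    \<open>t' < t\<close> keeps the final inequality strict.\<close>
  obtain t' where t': "(\<Sum>i. diam_pow (C i) s) < t'" "t' < t" using dense C(3) by blast
  obtain e where e: "0 < e" "(\<Sum>i. diam_pow (C i) s) + ennreal e \<le> t'"
  proof -
    obtain a where a: "(\<Sum>i. diam_pow (C i) s) = ennreal a" "0 \<le> a"
      using t' by (metis ennreal_cases less_top order.strict_trans2 top_greatest)
    obtain b where b: "t' = ennreal b" "0 \<le> b"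
      using t' by (metis ennreal_cases less_top order.strict_trans2 top_greatest)
    have "a < b" using t' a b by (simp add: ennreal_less_iff)
    then show thesis using a b by (intro that[of "b - a"]) (simp_all flip: ennreal_plus)
  qed
  have "\<exists>V d. open V \<and> C i \<subseteq> V \<and> bounded V \<and> diameter V \<le> d \<and> 0 < d \<and> d \<le> \<delta>' \<and>
      ennreal (d powr s) \<le> diam_pow (C i) s + ennreal (e * (1/2) ^ Suc i)" if "C i \<noteq> {}" for i
  proof -
    have "0 < e * (1/2) ^ Suc i" using e by simp
    then show ?thesis
      using open_enlargement[OF s conjunct1[OF C(2)] that conjunct2[OF C(2)] \<delta>] by metis
  qed
  then obtain V d where V: "\<And>i. C i \<noteq> {} \<Longrightarrow> open (V i) \<and> C i \<subseteq> V i \<and> bounded (V i) \<and> diameter (V i) \<le> d i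
      \<and> 0 < d i \<and> d i \<le> \<delta>' \<and> ennreal (d i powr s) \<le> diam_pow (C i) s + ennreal (e * (1/2) ^ Suc i)"
    by (metis (no_types, lifting))
  have "A \<subseteq> (\<Union>i\<in>{i. C i \<noteq> {}}. V i)" using C(1) V by fastforce
  then obtain I where I: "I \<subseteq> {i. C i \<noteq> {}}" "finite I" "A \<subseteq> (\<Union>i\<in>I. V i)"
    by (rule compactE_image[OF A, rotated]) (use V in auto)
  have "ennreal (\<Sum>i\<in>I. d i powr s) = (\<Sum>i\<in>I. ennreal (d i powr s))" by simp
  also have "\<dots> \<le> (\<Sum>i\<in>I. diam_pow (C i) s + ennreal (e * (1/2) ^ Suc i))"
    by (intro sum_mono) (use V I(1) in blast)
  also have "\<dots> \<le> (\<Sum>i. diam_pow (C i) s + ennreal (e * (1/2) ^ Suc i))"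
    by (rule sum_le_suminf) (use I in auto)
  also have "\<dots> = (\<Sum>i. diam_pow (C i) s) + (\<Sum>i. ennreal (e * (1/2) ^ Suc i))"
    by (simp add: suminf_add[symmetric])
  also have "(\<Sum>n. ennreal (e * (1/2) ^ Suc n)) = ennreal e"
    by (rule suminf_ennreal_eq) (use e sums_mult[OF power_half_series, of e] in auto)
  also have "(\<Sum>i. diam_pow (C i) s) + ennreal e < t"
    using e t' by simp
  finally show thesis
    using I V by (intro that[of I V d]) auto
qed

section \<open>Scaling of Hausdorff measures and dependence on the exponent\<close>

lemma hausdorff_measure_Lipschitz_image:
  fixes f :: "'a::metric_space \<Rightarrow> 'b::metric_space"
  assumes s: "0 \<le> s" and c: "0 < c" and f: "\<And>x y. x \<in> A \<Longrightarrow> y \<in> A \<Longrightarrow> dist (f x) (f y) \<le> c * dist x y"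
  shows "hausdorff_measure s (f ` A) \<le> ennreal (c powr s) * hausdorff_measure s A"
proof (rule hausdorff_measure_le)
  fix \<delta> :: real assume \<delta>: "0 < \<delta>"
  have "hausdorff_delta s \<delta> (f ` A) \<le> ennreal (c powr s) * (\<Sum>i. diam_pow (C i) s)"
    if C: "A \<subseteq> (\<Union>i. C i)" "\<forall>i. bounded (C i) \<and> diameter (C i) \<le> \<delta> / c" for C :: "nat \<Rightarrow> 'a set"
  proof -
    have d: "dist (f x) (f y) \<le> c * diameter (C i)" if "x \<in> C i \<inter> A" "y \<in> C i \<inter> A" for x y i
    proof -
      have "dist x y \<le> diameter (C i)" using C that diameter_bounded_bound by blast
      then show ?thesis using f[of x y] that c by (smt (verit) IntD2 mult_left_mono)
    qed
    \<comment> \<open>Only the part of \<open>C i\<close> inside \<open>A\<close> is mapped, since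
      \<open>f\<close> is controlled on \<open>A\<close> alone.\<close>
    have D: "diameter (f ` (C i \<inter> A)) \<le> c * diameter (C i)" for i
      by (rule diameter_leI) (use d[of _ i] c C diameter_ge_0[of "C i"] in auto)
    have "hausdorff_delta s \<delta> (f ` A) \<le> (\<Sum>i. diam_pow (f ` (C i \<inter> A)) s)"
    proof (rule hausdorff_delta_le_suminf)
      show "f ` A \<subseteq> (\<Union>i. f ` (C i \<inter> A))" using C by blast
      show "bounded (f ` (C i \<inter> A))" for i
        unfolding bounded_two_points using d by blast
      show "diameter (f ` (C i \<inter> A)) \<le> \<delta>" for i
        using order_trans[OF D[of i], of \<delta>] C(2) c by (simp add: pos_le_divide_eq mult.commute)
    qed
    also have "\<dots> \<le> (\<Sum>i. ennreal (c powr s) * diam_pow (C i) s)"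
    proof (intro suminf_le summableI)
      fix i
      have "bounded (f ` (C i \<inter> A))"
        unfolding bounded_two_points using d by blast
      then have "diameter (f ` (C i \<inter> A)) powr s \<le> (c * diameter (C i)) powr s"
        by (intro powr_mono2 D s diameter_ge_0)
      also have "\<dots> = c powr s * diameter (C i) powr s"
        using c C diameter_ge_0[of "C i"] by (intro powr_mult)
      finally have 1: "ennreal (diameter (f ` (C i \<inter> A)) powr s) \<le> ennreal (c powr s) * ennreal (diameter (C i) powr s)"
        by (simp add: ennreal_mult'[symmetric] ennreal_leI)
      show "diam_pow (f ` (C i \<inter> A)) s \<le> ennreal (c powr s) * diam_pow (C i) s"
      proof (cases "C i \<inter> A = {}")
        case True
        then show ?thesis by (simp add: diam_pow_def)
      next
        case False
        then have "C i \<noteq> {}" by blast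
        then show ?thesis using 1 False c by (simp add: diam_pow_def)
      qed
    qed
    finally show ?thesis by simp
  qed
  then have "hausdorff_delta s \<delta> (f ` A) \<le> ennreal (c powr s) * hausdorff_delta s (\<delta> / c) A"
    unfolding hausdorff_delta_def[of s "\<delta> / c"] using c by (intro ennreal_le_cmult_INF) auto
  also have "\<dots> \<le> ennreal (c powr s) * hausdorff_measure s A"
    using \<delta> c by (intro mult_left_mono hausdorff_measure_upper) auto
  finally show "hausdorff_delta s \<delta> (f ` A) \<le> ennreal (c powr s) * hausdorff_measure s A" .
qed

lemma similarity_inverse_on:
  fixes f :: "'a::metric_space \<Rightarrow> 'b::metric_space"
  assumes c: "0 < c" and f: "\<And>x y. x \<in> A \<Longrightarrow> y \<in> A \<Longrightarrow> dist (f x) (f y) = c * dist x y"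
  obtains g where "\<And>x. x \<in> A \<Longrightarrow> g (f x) = x" "\<And>x y. x \<in> f ` A \<Longrightarrow> y \<in> f ` A \<Longrightarrow> dist (g x) (g y) = (1/c) * dist x y"
    "g ` f ` A = A"
proof -
  have "inj_on f A" using f c by (metis dist_eq_0_iff inj_onI less_irrefl mult_eq_0_iff)
  then have "inv_into A f (f x) = x" if "x \<in> A" for x using that by simp
  then show thesis using f c by (intro that[of "inv_into A f"]) (auto simp: image_image)
qed

text \<open>The one-sided estimate, applied to the inverse of \<open>f\<close> on its image with
  ratio \<open>1 / c\<close>, yields the reverse inequality.\<close>

lemma similarity_eqI:
  fixes \<mu> :: "'a::metric_space set \<Rightarrow> ennreal"
  assumes le: "\<And>c f A. 0 < c \<Longrightarrow> (\<And>x y. x \<in> A \<Longrightarrow> y \<in> A \<Longrightarrow> dist (f x) (f y) = c * dist x y) \<Longrightarrow>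
      \<mu> (f ` A) \<le> ennreal (c powr s) * \<mu> A"
    and c: "0 < c" and f: "\<And>x y. x \<in> A \<Longrightarrow> y \<in> A \<Longrightarrow> dist (f x) (f y) = c * dist x y"
  shows "\<mu> (f ` A) = ennreal (c powr s) * \<mu> A"
proof (rule antisym)
  show "\<mu> (f ` A) \<le> ennreal (c powr s) * \<mu> A" by (rule le[OF c f])
  obtain g where g: "\<And>x. x \<in> A \<Longrightarrow> g (f x) = x"
    "\<And>x y. x \<in> f ` A \<Longrightarrow> y \<in> f ` A \<Longrightarrow> dist (g x) (g y) = (1/c) * dist x y" "g ` f ` A = A"
    using similarity_inverse_on[OF c f] by metis
  have "\<mu> (g ` f ` A) \<le> ennreal ((1/c) powr s) * \<mu> (f ` A)"
    by (rule le) (use g(2) c in auto)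
  then have "ennreal (c powr s) * \<mu> A \<le> ennreal (c powr s) * (ennreal ((1/c) powr s) * \<mu> (f ` A))"
    unfolding g(3) by (rule mult_left_mono) simp
  also have "\<dots> = ennreal (c powr s * (1/c) powr s) * \<mu> (f ` A)"
    using c by (simp add: ennreal_mult' mult.assoc)
  also have "c powr s * (1/c) powr s = 1" using c by (simp add: powr_mult[symmetric])
  finally show "ennreal (c powr s) * \<mu> A \<le> \<mu> (f ` A)" by simp
qed

lemma hausdorff_measure_similarity:
  fixes f :: "'a::metric_space \<Rightarrow> 'a"
  assumes s: "0 \<le> s" and c: "0 < c" and f: "\<And>x y. x \<in> A \<Longrightarrow> y \<in> A \<Longrightarrow> dist (f x) (f y) = c * dist x y"
  shows "hausdorff_measure s (f ` A) = ennreal (c powr s) * hausdorff_measure s A"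
  by (rule similarity_eqI[OF hausdorff_measure_Lipschitz_image[OF s] c f]) simp_all

lemma tendsto_powr_gauge_mult:
  assumes "c < (top::ennreal)" "0 < a"
  shows "(\<lambda>n. ennreal ((1 / Suc n) powr a) * c) \<longlonglongrightarrow> 0"
proof -
  have "(\<lambda>n. (1 / real (Suc n)) powr a) \<longlonglongrightarrow> 0 powr a"
    using assms LIMSEQ_Suc[OF lim_1_over_n] by (intro tendsto_powr2 tendsto_const) auto
  then have "(\<lambda>n. ennreal ((1 / real (Suc n)) powr a)) \<longlonglongrightarrow> ennreal (0 powr a)"
    by (rule tendsto_ennrealI)
  from ennreal_tendsto_cmult[OF assms(1) this] show ?thesis
    using assms by (simp add: mult.commute)
qed

lemma hausdorff_delta_exponent_le:
  assumes "0 \<le> t" "t < s" "0 < \<delta>"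
  shows "hausdorff_delta s \<delta> A \<le> ennreal (\<delta> powr (s - t)) * hausdorff_delta t \<delta> A"
proof -
  have "hausdorff_delta s \<delta> A \<le> ennreal (\<delta> powr (s - t)) * (\<Sum>i. diam_pow (C i) t)"
    if C: "A \<subseteq> (\<Union>i. C i)" "\<forall>i. bounded (C i) \<and> diameter (C i) \<le> \<delta>" for C :: "nat \<Rightarrow> 'a set"
  proof -
    have "hausdorff_delta s \<delta> A \<le> (\<Sum>i. diam_pow (C i) s)"
      by (rule hausdorff_delta_le_suminf) (use C in auto)
    also have "\<dots> \<le> (\<Sum>i. ennreal (\<delta> powr (s - t)) * diam_pow (C i) t)"
    proof (intro suminf_le summableI)
      fix i
      have d: "0 \<le> diameter (C i)" "diameter (C i) \<le> \<delta>" using C diameter_ge_0 by auto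
      have "diameter (C i) powr s = diameter (C i) powr (s - t) * diameter (C i) powr t"
        by (simp add: powr_add[symmetric])
      also have "\<dots> \<le> \<delta> powr (s - t) * diameter (C i) powr t"
        using d assms by (intro mult_right_mono powr_mono2) auto
      finally have 1: "diameter (C i) powr s \<le> \<delta> powr (s - t) * diameter (C i) powr t" .
      \<comment> \<open>Serves \<open>t = 0\<close>: there \<open>diam_pow\<close> is 1 for every
        nonempty set, singletons included, although \<open>0 powr 0 = 0\<close>.\<close>
      have 2: "diameter (C i) powr s \<le> \<delta> powr s"
        using d assms by (intro powr_mono2) auto
      show "diam_pow (C i) s \<le> ennreal (\<delta> powr (s - t)) * diam_pow (C i) t"
        using 1 2 assms by (auto simp: diam_pow_def ennreal_mult'[symmetric] intro!: ennreal_leI)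
    qed
    finally show ?thesis by simp
  qed
  then show ?thesis
    unfolding hausdorff_delta_def[of t] using assms by (intro ennreal_le_cmult_INF) auto
qed

text \<open>Raising the exponent costs the factor \<open>\<delta> powr (s - t)\<close>, which tends
  to 0 with the gauge.\<close>

lemma hausdorff_measure_zero_above:
  assumes fin: "hausdorff_measure t A < top" and t: "0 \<le> t" "t < s"
  shows "hausdorff_measure s A = 0"
proof -
  have "hausdorff_measure s A \<le> 0"
  proof (rule LIMSEQ_le[OF LIMSEQ_hausdorff_delta])
    show "(\<lambda>n. ennreal ((1 / Suc n) powr (s - t)) * hausdorff_measure t A) \<longlonglongrightarrow> 0"
      by (rule tendsto_powr_gauge_mult) (use fin t in auto)
    have "hausdorff_delta s (1 / Suc n) A \<le> ennreal ((1 / Suc n) powr (s - t)) * hausdorff_measure t A" for n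
      by (rule order_trans[OF hausdorff_delta_exponent_le[OF t]])
        (auto intro!: mult_left_mono hausdorff_measure_upper)
    then show "\<exists>N. \<forall>n\<ge>N. hausdorff_delta s (1 / Suc n) A \<le> ennreal ((1 / Suc n) powr (s - t)) * hausdorff_measure t A"
      by blast
  qed
  then show ?thesis by simp
qed

section \<open>Packing measures\<close>

text \<open>The finite admissible families of \<open>packing_delta\<close>, indexed by their
  centres. The inequality for distances expresses disjointness of closed balls in a normed space; it
  scales under similarities and leaves a measurable slack for perturbations.\<close>

definition packing :: "real \<Rightarrow> 'a::metric_space set \<Rightarrow> 'a set \<Rightarrow> ('a \<Rightarrow> real) \<Rightarrow> bool" where
  "packing \<delta> A X \<rho> \<longleftrightarrow> finite X \<and> X \<subseteq> A \<and> (\<forall>x\<in>X. 0 < \<rho> x \<and> \<rho> x \<le> \<delta>) \<and>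
     (\<forall>x\<in>X. \<forall>y\<in>X. x \<noteq> y \<longrightarrow> \<rho> x + \<rho> y < dist x y)"

text \<open>Otherwise the point at distance \<open>r\<close> from \<open>x\<close> on the segment to
  \<open>y\<close> (or \<open>y\<close> itself, if it is closer) lies in both balls.\<close>

lemma cballs_disjoint_imp_less_dist:
  fixes x y :: "'a::real_normed_vector"
  assumes "cball x r \<inter> cball y t = {}" "0 \<le> r" "0 \<le> t"
  shows "r + t < dist x y"
proof (rule ccontr)
  assume "\<not> r + t < dist x y"
  then have le: "norm (y - x) \<le> r + t" by (simp add: dist_norm norm_minus_commute)
  show False
  proof (cases "norm (y - x) \<le> r")
    case True
    then have "y \<in> cball x r" "y \<in> cball y t" using assms by (auto simp: dist_norm norm_minus_commute)
    then show False using assms by blast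
  next
    case False
    define n where "n = norm (y - x)"
    have n: "0 < n" "r < n" using False assms by (auto simp: n_def)
    let ?z = "x + (r / n) *\<^sub>R (y - x)"
    have "dist x ?z = r" using n assms by (simp add: dist_norm n_def[symmetric])
    moreover have "y - ?z = (1 - r / n) *\<^sub>R (y - x)" by (simp add: algebra_simps)
    then have "dist y ?z = \<bar>1 - r / n\<bar> * n"
      by (simp only: dist_norm norm_scaleR n_def)
    moreover have "\<bar>1 - r / n\<bar> * n = n - r"
      using n by (simp add: field_simps)
    ultimately have "?z \<in> cball x r \<inter> cball y t" using le n_def by simp
    then show False using assms by blast
  qed
qed

text \<open>A centre map \<open>p\<close> on an arbitrary finite index set lets moved or pulled-back
  centres be used without reindexing.\<close>

lemma packing_sum_le:
  fixes p :: "'i \<Rightarrow> 'a::metric_space"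
  assumes fin: "finite I" and p: "\<And>i. i \<in> I \<Longrightarrow> p i \<in> A \<and> 0 < \<rho> i \<and> \<rho> i \<le> \<delta>"
    and dist: "\<And>i j. i \<in> I \<Longrightarrow> j \<in> I \<Longrightarrow> i \<noteq> j \<Longrightarrow> \<rho> i + \<rho> j < dist (p i) (p j)"
  shows "ennreal (\<Sum>i\<in>I. (2 * \<rho> i) powr s) \<le> packing_delta s \<delta> A"
proof -
  obtain h where h: "bij_betw h {..<card I} I"
    using ex_bij_betw_nat_finite[OF fin] by (auto simp: atLeast0LessThan)
  have hI: "h n \<in> I" if "n < card I" for n using h that by (auto simp: bij_betw_def)
  have inj: "h m = h n \<longleftrightarrow> m = n" if "m < card I" "n < card I" for m n
    using h that by (auto simp: bij_betw_def inj_on_def)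
  have "ennreal (\<Sum>i\<in>I. (2 * \<rho> i) powr s) = (\<Sum>i\<in>I. ennreal ((2 * \<rho> i) powr s))" by simp
  also have "\<dots> = (\<Sum>n<card I. ennreal ((2 * \<rho> (h n)) powr s))"
    by (rule sum.reindex_bij_betw[OF h, symmetric])
  also have "\<dots> = (\<Sum>n. if n \<in> {..<card I} then ennreal ((2 * \<rho> (h n)) powr s) else 0)"
    by (subst suminf_finite[of "{..<card I}"]) auto
  also have "\<dots> \<le> packing_delta s \<delta> A"
    unfolding packing_delta_def
    by (rule SUP_upper2[of "({..<card I}, p \<circ> h, \<rho> \<circ> h)"])
      (use hI p inj dist in \<open>auto simp: comp_def intro!: disjoint_cballI\<close>)
  finally show ?thesis .
qed

text \<open>Partial sums involve finitely many balls, whose centres are distinct because the balls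
  are disjoint. Together with \<open>packing_sum_le\<close> this makes \<open>packing_delta\<close>
  a supremum over finite packings.\<close>

lemma packing_delta_le:
  fixes A :: "'a::euclidean_space set"
  assumes "\<And>X \<rho>. packing \<delta> A X \<rho> \<Longrightarrow> ennreal (\<Sum>x\<in>X. (2 * \<rho> x) powr s) \<le> c"
  shows "packing_delta s \<delta> A \<le> c"
  unfolding packing_delta_def
proof (rule SUP_least, clarify)
  fix I :: "nat set" and x :: "nat \<Rightarrow> 'a" and r :: "nat \<Rightarrow> real"
  assume x: "\<forall>i\<in>I. x i \<in> A \<and> 0 < r i \<and> r i \<le> \<delta>"
    and disj: "\<forall>i\<in>I. \<forall>j\<in>I. i \<noteq> j \<longrightarrow> cball (x i) (r i) \<inter> cball (x j) (r j) = {}"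
  have less: "r i + r j < dist (x i) (x j)" if "i \<in> I" "j \<in> I" "i \<noteq> j" for i j
    using that x disj by (intro cballs_disjoint_imp_less_dist) (auto intro: less_imp_le)
  show "(\<Sum>i. if i \<in> I then ennreal ((2 * r i) powr s) else 0) \<le> c"
  proof (rule suminf_le_const[OF summableI])
    fix n
    define F where "F = I \<inter> {..<n}"
    have inj: "inj_on x F"
    proof (rule inj_onI, rule ccontr)
      fix i j assume ij: "i \<in> F" "j \<in> F" "x i = x j" "i \<noteq> j"
      then have "r i + r j < 0" using less[of i j] by (simp add: F_def)
      moreover have "0 < r i" "0 < r j" using x ij by (auto simp: F_def)
      ultimately show False by linarith
    qed
    define g where "g = inv_into F x"
    have g: "g (x i) = i" if "i \<in> F" for i using inj that by (simp add: g_def)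
    have "packing \<delta> A (x ` F) (r \<circ> g)"
      unfolding packing_def using x less g by (auto simp: F_def)
    then have "ennreal (\<Sum>z\<in>x ` F. (2 * (r \<circ> g) z) powr s) \<le> c" by (rule assms)
    also have "(\<Sum>z\<in>x ` F. (2 * (r \<circ> g) z) powr s) = (\<Sum>i\<in>F. (2 * r i) powr s)"
      using g by (simp add: sum.reindex[OF inj])
    also have "ennreal \<dots> = (\<Sum>i<n. if i \<in> I then ennreal ((2 * r i) powr s) else 0)"
      unfolding F_def by (subst sum.inter_restrict[symmetric]) (auto simp: Int_commute)
    finally show "(\<Sum>i<n. if i \<in> I then ennreal ((2 * r i) powr s) else 0) \<le> c" .
  qed
qed

lemma less_packing_deltaE:
  fixes A :: "'a::euclidean_space set"
  assumes "t < packing_delta s \<delta> A"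
  obtains X \<rho> where "packing \<delta> A X \<rho>" "t < ennreal (\<Sum>x\<in>X. (2 * \<rho> x) powr s)"
  using assms packing_delta_le[of \<delta> A s t] by (meson not_le)

lemma packing_delta_mono: "A \<subseteq> B \<Longrightarrow> packing_delta s \<delta> A \<le> packing_delta s \<delta> B"
  unfolding packing_delta_def by (rule SUP_subset_mono) auto

lemma packing_delta_mono_gauge: "\<delta> \<le> \<delta>' \<Longrightarrow> packing_delta s \<delta> A \<le> packing_delta s \<delta>' A"
  unfolding packing_delta_def by (rule SUP_subset_mono) (auto intro: order_trans)

lemma packing_premeasure_lower: "0 < \<delta> \<Longrightarrow> packing_premeasure s A \<le> packing_delta s \<delta> A"
  unfolding packing_premeasure_def by (rule INF_lower) simp

lemma packing_premeasure_greatest: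
  "(\<And>\<delta>. 0 < \<delta> \<Longrightarrow> c \<le> packing_delta s \<delta> A) \<Longrightarrow> c \<le> packing_premeasure s A"
  unfolding packing_premeasure_def by (rule INF_greatest) simp

lemma packing_premeasure_mono: "A \<subseteq> B \<Longrightarrow> packing_premeasure s A \<le> packing_premeasure s B"
  by (rule packing_premeasure_greatest) (metis packing_delta_mono packing_premeasure_lower order_trans)

lemma LIMSEQ_packing_delta:
  "(\<lambda>n. packing_delta s (1 / Suc n) A) \<longlonglongrightarrow> packing_premeasure s A"
proof -
  have "packing_premeasure s A = (INF n. packing_delta s (1 / Suc n) A)"
  proof (rule antisym[OF _ packing_premeasure_greatest])
    fix \<delta> :: real assume "0 < \<delta>"
    then obtain n where "1 / Suc n < \<delta>" using nat_approx_posE by auto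
    then have "packing_delta s (1 / Suc n) A \<le> packing_delta s \<delta> A"
      by (intro packing_delta_mono_gauge) simp
    then show "(INF n. packing_delta s (1 / Suc n) A) \<le> packing_delta s \<delta> A"
      by (meson INF_lower2 UNIV_I)
  qed (auto intro!: INF_greatest packing_premeasure_lower)
  moreover have "decseq (\<lambda>n. packing_delta s (1 / Suc n) A)"
    by (intro antimonoI packing_delta_mono_gauge) (simp add: frac_le)
  ultimately show ?thesis using LIMSEQ_INF by simp
qed

lemma packing_delta_Un_le:
  fixes A :: "'a::euclidean_space set"
  shows "packing_delta s \<delta> (A \<union> B) \<le> packing_delta s \<delta> A + packing_delta s \<delta> B"
proof (rule packing_delta_le)
  fix X \<rho> assume X: "packing \<delta> (A \<union> B) X \<rho>"
  then have fin: "finite X" by (simp add: packing_def)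
  have "(\<Sum>x\<in>X. (2 * \<rho> x) powr s) = (\<Sum>x\<in>X \<inter> A. (2 * \<rho> x) powr s) + (\<Sum>x\<in>X - A. (2 * \<rho> x) powr s)"
    by (rule sum.Int_Diff[OF fin])
  also have "ennreal \<dots> = ennreal (\<Sum>x\<in>X \<inter> A. (2 * \<rho> x) powr s) + ennreal (\<Sum>x\<in>X - A. (2 * \<rho> x) powr s)"
    by (simp add: sum_nonneg)
  also have "\<dots> \<le> packing_delta s \<delta> A + packing_delta s \<delta> B"
    by (intro add_mono packing_sum_le) (use X in \<open>auto simp: packing_def\<close>)
  finally show "ennreal (\<Sum>x\<in>X. (2 * \<rho> x) powr s) \<le> packing_delta s \<delta> A + packing_delta s \<delta> B" .
qed

lemma packing_premeasure_Un_le: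
  fixes A :: "'a::euclidean_space set"
  shows "packing_premeasure s (A \<union> B) \<le> packing_premeasure s A + packing_premeasure s B"
  by (rule LIMSEQ_le[OF LIMSEQ_packing_delta tendsto_add[OF LIMSEQ_packing_delta LIMSEQ_packing_delta]])
    (simp add: packing_delta_Un_le)

text \<open>With gauge below \<open>\<gamma> / 2\<close>, balls centred in \<open>A\<close> never
  meet balls centred in \<open>B\<close>, so packings of the two sets can be merged.\<close>

lemma packing_premeasure_Un_separated:
  fixes A :: "'a::euclidean_space set"
  assumes \<gamma>: "0 < \<gamma>" and sep: "\<And>x y. x \<in> A \<Longrightarrow> y \<in> B \<Longrightarrow> \<gamma> \<le> dist x y"
  shows "packing_premeasure s A + packing_premeasure s B \<le> packing_premeasure s (A \<union> B)"
proof (rule LIMSEQ_le[OF tendsto_add[OF LIMSEQ_packing_delta LIMSEQ_packing_delta] LIMSEQ_packing_delta])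
  obtain n0 where n0: "1 / Suc n0 < \<gamma> / 2" using nat_approx_posE[of "\<gamma> / 2"] \<gamma> by auto
  have "packing_delta s \<delta> A + packing_delta s \<delta> B \<le> packing_delta s \<delta> (A \<union> B)" if "\<delta> < \<gamma> / 2" for \<delta>
  proof (rule ccontr)
    assume "\<not> ?thesis"
    then have lt: "packing_delta s \<delta> (A \<union> B) < packing_delta s \<delta> A + packing_delta s \<delta> B" by simp
    \<comment> \<open>The value sets are nonempty, thanks to the empty packing; this is what lets a
      sum of suprema become a supremum of sums.\<close>
    define F where "F = (\<lambda>A :: 'a set. {ennreal (\<Sum>x\<in>X. (2 * \<rho> x) powr s) | X \<rho>. packing \<delta> A X \<rho>})"
    have pd: "packing_delta s \<delta> A = Sup (F A)" for A :: "'a set"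
      by (rule antisym[OF packing_delta_le Sup_least])
        (auto simp: F_def intro!: Sup_upper packing_sum_le, auto simp: packing_def)
    have ne: "F A \<noteq> {}" for A :: "'a set"
    proof -
      have "packing \<delta> A {} (\<lambda>_. 0)" by (simp add: packing_def)
      then show ?thesis unfolding F_def by blast
    qed
    have "Sup (F A) + Sup (F B) = (SUP a\<in>F A. a + Sup (F B))"
      using ennreal_SUP_add_left[of "F A" "\<lambda>a. a" "Sup (F B)"] ne by simp
    also have "\<dots> = (SUP a\<in>F A. SUP b\<in>F B. a + b)"
      using ennreal_SUP_add_right[of "F B" _ "\<lambda>b. b"] ne by simp
    also have "\<dots> \<le> packing_delta s \<delta> (A \<union> B)"
    proof (intro SUP_least)
      fix a b assume "a \<in> F A" "b \<in> F B"
      then obtain X \<rho> Y \<sigma> where X: "packing \<delta> A X \<rho>" "a = ennreal (\<Sum>x\<in>X. (2 * \<rho> x) powr s)"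
        and Y: "packing \<delta> B Y \<sigma>" "b = ennreal (\<Sum>x\<in>Y. (2 * \<sigma> x) powr s)"
        unfolding F_def by blast
      have disj: "X \<inter> Y = {}" using X Y sep \<gamma> unfolding packing_def by fastforce
      define \<tau> where "\<tau> = (\<lambda>x. if x \<in> X then \<rho> x else \<sigma> x)"
      have XY: "\<rho> x + \<sigma> y < dist x y" if "x \<in> X" "y \<in> Y" for x y
      proof -
        have "\<gamma> \<le> dist x y" using that X Y by (intro sep) (auto simp: packing_def)
        moreover have "\<rho> x \<le> \<delta>" "\<sigma> y \<le> \<delta>" using that X Y by (auto simp: packing_def)
        ultimately show ?thesis using \<open>\<delta> < \<gamma> / 2\<close> by linarith
      qed
      have fin: "finite X" "finite Y" using X Y by (auto simp: packing_def)
      have "a + b = ennreal (\<Sum>x\<in>X. (2 * \<tau> x) powr s) + ennreal (\<Sum>x\<in>Y. (2 * \<tau> x) powr s)"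
        using disj unfolding X Y by (intro arg_cong2[where f="(+)"] arg_cong[where f=ennreal] sum.cong) (auto simp: \<tau>_def)
      also have "\<dots> = ennreal (\<Sum>x\<in>X \<union> Y. (2 * \<tau> x) powr s)"
        using fin disj by (simp add: sum.union_disjoint sum_nonneg)
      also have "\<dots> \<le> packing_delta s \<delta> (A \<union> B)"
      proof (rule packing_sum_le)
        show "finite (X \<union> Y)" using fin by simp
        show "x \<in> A \<union> B \<and> 0 < \<tau> x \<and> \<tau> x \<le> \<delta>" if "x \<in> X \<union> Y" for x
          using that X Y by (auto simp: \<tau>_def packing_def)
        show "\<tau> x + \<tau> y < dist x y" if "x \<in> X \<union> Y" "y \<in> X \<union> Y" "x \<noteq> y" for x y
          using that X(1) Y(1) XY[of x y] XY[of y x] disj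
          by (auto simp: \<tau>_def packing_def dist_commute add.commute)
      qed
      finally show "a + b \<le> packing_delta s \<delta> (A \<union> B)" .
    qed
    finally show False using lt by (simp add: pd)
  qed
  moreover have "1 / Suc n < \<gamma> / 2" if "n \<ge> n0" for n
    using n0 that frac_le[of 1 1 "real (Suc n0)" "real (Suc n)"] by simp
  ultimately show "\<exists>N. \<forall>n\<ge>N. packing_delta s (1 / Suc n) A + packing_delta s (1 / Suc n) B
      \<le> packing_delta s (1 / Suc n) (A \<union> B)"
    by (intro exI[of _ n0]) auto
qed

text \<open>Centres travel back along the inverse similarity and radii are divided by
  \<open>c\<close>; the separation inequalities scale alike.\<close>

lemma packing_delta_similarity_le:
  fixes f :: "'a::euclidean_space \<Rightarrow> 'b::euclidean_space"
  assumes c: "0 < c" and f: "\<And>x y. x \<in> A \<Longrightarrow> y \<in> A \<Longrightarrow> dist (f x) (f y) = c * dist x y"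
  shows "packing_delta s \<delta> (f ` A) \<le> ennreal (c powr s) * packing_delta s (\<delta> / c) A"
proof (rule packing_delta_le)
  obtain g where g: "\<And>x. x \<in> A \<Longrightarrow> g (f x) = x"
    "\<And>x y. x \<in> f ` A \<Longrightarrow> y \<in> f ` A \<Longrightarrow> dist (g x) (g y) = (1/c) * dist x y" "g ` f ` A = A"
    using similarity_inverse_on[OF c f] by metis
  fix X \<rho> assume X: "packing \<delta> (f ` A) X \<rho>"
  then have 0: "0 \<le> 2 * \<rho> x" if "x \<in> X" for x
    using that by (auto simp: packing_def intro: less_imp_le)
  have "(2 * \<rho> x) powr s = c powr s * (2 * (\<rho> x / c)) powr s" if "x \<in> X" for x
    using c 0[OF that] by (simp add: powr_mult[symmetric])
  then have "ennreal (\<Sum>x\<in>X. (2 * \<rho> x) powr s) = ennreal (c powr s * (\<Sum>x\<in>X. (2 * (\<rho> x / c)) powr s))"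
    by (simp add: sum_distrib_left)
  also have "\<dots> = ennreal (c powr s) * ennreal (\<Sum>x\<in>X. (2 * (\<rho> x / c)) powr s)"
    by (rule ennreal_mult') simp
  also have "\<dots> \<le> ennreal (c powr s) * packing_delta s (\<delta> / c) A"
  proof (intro mult_left_mono packing_sum_le[of _ g])
    show "finite X" using X by (simp add: packing_def)
    show "g x \<in> A \<and> 0 < \<rho> x / c \<and> \<rho> x / c \<le> \<delta> / c" if "x \<in> X" for x
      using that X g c by (auto simp: packing_def divide_right_mono)
    show "\<rho> x / c + \<rho> y / c < dist (g x) (g y)" if "x \<in> X" "y \<in> X" "x \<noteq> y" for x y
    proof -
      have "\<rho> x + \<rho> y < dist x y" "x \<in> f ` A" "y \<in> f ` A" using that X by (auto simp: packing_def)
      then show ?thesis using g(2)[of x y] c by (simp add: add_divide_distrib[symmetric] divide_strict_right_mono)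
    qed
  qed simp
  finally show "ennreal (\<Sum>x\<in>X. (2 * \<rho> x) powr s) \<le> ennreal (c powr s) * packing_delta s (\<delta> / c) A" .
qed

lemma packing_premeasure_similarity_le:
  fixes f :: "'a::euclidean_space \<Rightarrow> 'b::euclidean_space"
  assumes c: "0 < c" and f: "\<And>x y. x \<in> A \<Longrightarrow> y \<in> A \<Longrightarrow> dist (f x) (f y) = c * dist x y"
  shows "packing_premeasure s (f ` A) \<le> ennreal (c powr s) * packing_premeasure s A"
  unfolding packing_premeasure_def[of s A]
proof (rule ennreal_le_cmult_INF)
  fix \<delta> :: real assume "\<delta> \<in> {0<..}"
  then have "packing_premeasure s (f ` A) \<le> packing_delta s (c * \<delta>) (f ` A)"
    using c by (intro packing_premeasure_lower) simp
  also have "\<dots> \<le> ennreal (c powr s) * packing_delta s (c * \<delta> / c) A"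
    by (rule packing_delta_similarity_le[OF c f])
  finally show "packing_premeasure s (f ` A) \<le> ennreal (c powr s) * packing_delta s \<delta> A"
    using c by simp
qed (use c in simp)

lemma packing_measure_le_suminf:
  "A \<subseteq> (\<Union>i. C i) \<Longrightarrow> packing_measure s A \<le> (\<Sum>i. packing_premeasure s (C i))"
  unfolding packing_measure_def by (rule INF_lower) simp

lemma packing_measure_similarity_le:
  fixes f :: "'a::euclidean_space \<Rightarrow> 'b::euclidean_space"
  assumes c: "0 < c" and f: "\<And>x y. x \<in> A \<Longrightarrow> y \<in> A \<Longrightarrow> dist (f x) (f y) = c * dist x y"
  shows "packing_measure s (f ` A) \<le> ennreal (c powr s) * packing_measure s A"
  unfolding packing_measure_def[of s A]
proof (rule ennreal_le_cmult_INF)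
  fix C :: "nat \<Rightarrow> 'a set" assume "C \<in> {C. A \<subseteq> (\<Union>i. C i)}"
  then have C: "A \<subseteq> (\<Union>i. C i)" by simp
  have "packing_measure s (f ` A) \<le> (\<Sum>i. packing_premeasure s (f ` (C i \<inter> A)))"
    by (rule packing_measure_le_suminf) (use C in blast)
  also have "\<dots> \<le> (\<Sum>i. ennreal (c powr s) * packing_premeasure s (C i))"
  proof (intro suminf_le summableI)
    fix i
    have "packing_premeasure s (f ` (C i \<inter> A)) \<le> ennreal (c powr s) * packing_premeasure s (C i \<inter> A)"
      by (rule packing_premeasure_similarity_le[OF c]) (simp add: f)
    also have "\<dots> \<le> ennreal (c powr s) * packing_premeasure s (C i)"
      by (intro mult_left_mono packing_premeasure_mono) auto
    finally show "packing_premeasure s (f ` (C i \<inter> A)) \<le> ennreal (c powr s) * packing_premeasure s (C i)" .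
  qed
  finally show "packing_measure s (f ` A) \<le> ennreal (c powr s) * (\<Sum>i. packing_premeasure s (C i))"
    by simp
qed (use c in simp)

lemma packing_premeasure_similarity:
  fixes f :: "'a::euclidean_space \<Rightarrow> 'a"
  assumes c: "0 < c" and f: "\<And>x y. x \<in> A \<Longrightarrow> y \<in> A \<Longrightarrow> dist (f x) (f y) = c * dist x y"
  shows "packing_premeasure s (f ` A) = ennreal (c powr s) * packing_premeasure s A"
  by (rule similarity_eqI[OF packing_premeasure_similarity_le c f])

lemma packing_measure_similarity:
  fixes f :: "'a::euclidean_space \<Rightarrow> 'a"
  assumes c: "0 < c" and f: "\<And>x y. x \<in> A \<Longrightarrow> y \<in> A \<Longrightarrow> dist (f x) (f y) = c * dist x y"
  shows "packing_measure s (f ` A) = ennreal (c powr s) * packing_measure s A"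
  by (rule similarity_eqI[OF packing_measure_similarity_le c f])

lemma packing_premeasure_empty [simp]:
  "packing_premeasure s ({} :: 'a::euclidean_space set) = 0"
proof -
  have "packing_premeasure s ({} :: 'a set) \<le> packing_delta s 1 ({} :: 'a set)"
    by (rule packing_premeasure_lower) simp
  also have "\<dots> \<le> 0" by (rule packing_delta_le) (simp add: packing_def)
  finally show ?thesis by simp
qed

lemma packing_measure_mono: "A \<subseteq> B \<Longrightarrow> packing_measure s A \<le> packing_measure s B"
  unfolding packing_measure_def by (rule INF_superset_mono) auto

lemma packing_measure_le_premeasure:
  fixes A :: "'a::euclidean_space set"
  shows "packing_measure s A \<le> packing_premeasure s A"
proof -
  have "packing_measure s A \<le> (\<Sum>n. packing_premeasure s (if n = 0 then A else {}))"
    by (rule packing_measure_le_suminf) auto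
  also have "\<dots> = packing_premeasure s A"
    by (subst suminf_two) auto
  finally show ?thesis .
qed

lemma packing_measure_empty [simp]:
  "packing_measure s ({} :: 'a::euclidean_space set) = 0"
  using packing_measure_le_premeasure[of s "{} :: 'a set"] by simp

lemma packing_measure_Un_le:
  fixes A :: "'a::euclidean_space set"
  shows "packing_measure s (A \<union> B) \<le> packing_measure s A + packing_measure s B"
proof -
  let ?D = "\<lambda>n::nat. if n = 0 then A else if n = 1 then B else {}"
  have "packing_measure s (A \<union> B) \<le> (\<Sum>n. packing_measure s (?D n))"
    by (rule cover_INF_countably_subadditive[where Q = "\<lambda>_. True", OF _ equalityD1[OF Un_conv_UN_nat]])
      (simp add: packing_measure_def)
  also have "\<dots> = packing_measure s A + packing_measure s B"
    by (subst suminf_two) auto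
  finally show ?thesis .
qed

lemma packing_delta_exponent_le:
  fixes A :: "'a::euclidean_space set"
  assumes "t < s" "0 < \<delta>"
  shows "packing_delta s \<delta> A \<le> ennreal ((2 * \<delta>) powr (s - t)) * packing_delta t \<delta> A"
proof (rule packing_delta_le)
  fix X \<rho> assume X: "packing \<delta> A X \<rho>"
  have "(\<Sum>x\<in>X. (2 * \<rho> x) powr s) \<le> (\<Sum>x\<in>X. (2 * \<delta>) powr (s - t) * (2 * \<rho> x) powr t)"
  proof (rule sum_mono)
    fix x assume "x \<in> X"
    then have r: "0 < \<rho> x" "\<rho> x \<le> \<delta>" using X by (auto simp: packing_def)
    have "(2 * \<rho> x) powr s = (2 * \<rho> x) powr (s - t) * (2 * \<rho> x) powr t"
      by (simp add: powr_add[symmetric])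
    also have "\<dots> \<le> (2 * \<delta>) powr (s - t) * (2 * \<rho> x) powr t"
      using r assms by (intro mult_right_mono powr_mono2) auto
    finally show "(2 * \<rho> x) powr s \<le> (2 * \<delta>) powr (s - t) * (2 * \<rho> x) powr t" .
  qed
  then have "ennreal (\<Sum>x\<in>X. (2 * \<rho> x) powr s) \<le> ennreal ((2 * \<delta>) powr (s - t) * (\<Sum>x\<in>X. (2 * \<rho> x) powr t))"
    by (simp add: sum_distrib_left ennreal_leI)
  also have "\<dots> = ennreal ((2 * \<delta>) powr (s - t)) * ennreal (\<Sum>x\<in>X. (2 * \<rho> x) powr t)"
    by (rule ennreal_mult') simp
  also have "\<dots> \<le> ennreal ((2 * \<delta>) powr (s - t)) * packing_delta t \<delta> A"
    by (intro mult_left_mono packing_sum_le) (use X in \<open>auto simp: packing_def\<close>)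
  finally show "ennreal (\<Sum>x\<in>X. (2 * \<rho> x) powr s) \<le> ennreal ((2 * \<delta>) powr (s - t)) * packing_delta t \<delta> A" .
qed

text \<open>The \<open>t\<close>-sums are finite at some gauge \<open>\<delta>0\<close>; at smaller
  gauges \<open>\<delta>\<close> the factor \<open>(2 * \<delta>) powr (s - t)\<close> drives the
  \<open>s\<close>-sums to 0.\<close>

lemma packing_premeasure_zero_above:
  fixes A :: "'a::euclidean_space set"
  assumes fin: "packing_premeasure t A < top" and t: "t < s"
  shows "packing_premeasure s A = 0"
proof -
  obtain \<delta>0 where \<delta>0: "0 < \<delta>0" "packing_delta t \<delta>0 A < top"
    using fin unfolding packing_premeasure_def INF_less_iff by auto
  have "packing_premeasure s A \<le> 0"
  proof (rule LIMSEQ_le[OF LIMSEQ_packing_delta])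
    have "(\<lambda>n. ennreal ((1 / Suc n) powr (s - t)) * (ennreal (2 powr (s - t)) * packing_delta t \<delta>0 A)) \<longlonglongrightarrow> 0"
      by (rule tendsto_powr_gauge_mult) (use \<delta>0 t in \<open>auto simp: ennreal_mult_less_top\<close>)
    moreover have "ennreal ((2 * (1 / Suc n)) powr (s - t)) * packing_delta t \<delta>0 A
        = ennreal ((1 / Suc n) powr (s - t)) * (ennreal (2 powr (s - t)) * packing_delta t \<delta>0 A)" for n
      using powr_mult[of 2 "1 / Suc n" "s - t"] by (simp only: ennreal_mult' powr_ge_zero mult_ac)
    ultimately show "(\<lambda>n. ennreal ((2 * (1 / Suc n)) powr (s - t)) * packing_delta t \<delta>0 A) \<longlonglongrightarrow> 0"
      by simp
    obtain n0 where n0: "1 / Suc n0 < \<delta>0" using nat_approx_posE[OF \<delta>0(1)] by auto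
    have "packing_delta s (1 / Suc n) A \<le> ennreal ((2 * (1 / Suc n)) powr (s - t)) * packing_delta t \<delta>0 A"
      if "n \<ge> n0" for n
    proof (rule order_trans[OF packing_delta_exponent_le[OF t]])
      have "1 / Suc n \<le> \<delta>0" using n0 that frac_le[of 1 1 "real (Suc n0)" "real (Suc n)"] by simp
      then show "ennreal ((2 * (1 / Suc n)) powr (s - t)) * packing_delta t (1 / Suc n) A
          \<le> ennreal ((2 * (1 / Suc n)) powr (s - t)) * packing_delta t \<delta>0 A"
        by (intro mult_left_mono packing_delta_mono_gauge) auto
    qed simp
    then show "\<exists>N. \<forall>n\<ge>N. packing_delta s (1 / Suc n) A \<le> ennreal ((2 * (1 / Suc n)) powr (s - t)) * packing_delta t \<delta>0 A"
      by blast
  qed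
  then show ?thesis by simp
qed

lemma packing_measure_zero_above:
  fixes A :: "'a::euclidean_space set"
  assumes fin: "packing_measure t A < top" and t: "t < s"
  shows "packing_measure s A = 0"
proof -
  obtain C where C: "A \<subseteq> (\<Union>i. C i)" "(\<Sum>i. packing_premeasure t (C i)) < top"
    using fin unfolding packing_measure_def INF_less_iff by auto
  have "packing_premeasure s (C i) = 0" for i
    by (rule packing_premeasure_zero_above[OF _ t]) (use C(2) ennreal_suminf_lessD in blast)
  then have "packing_measure s A \<le> 0"
    using packing_measure_le_suminf[OF C(1), of s] by simp
  then show ?thesis by simp
qed

text \<open>A finite packing satisfies finitely many strict inequalities, so its centres can be
  moved slightly into \<open>B\<close> with the radii unchanged.\<close>

lemma packing_delta_lower_semicontinuous:
  fixes A :: "'a::euclidean_space set"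
  assumes "t < packing_delta s \<delta> A"
  obtains \<gamma> where "0 < \<gamma>" "\<And>B. (\<And>x. x \<in> A \<Longrightarrow> \<exists>y\<in>B. dist x y < \<gamma>) \<Longrightarrow> t < packing_delta s \<delta> B"
proof -
  obtain X \<rho> where X: "packing \<delta> A X \<rho>" "t < ennreal (\<Sum>x\<in>X. (2 * \<rho> x) powr s)"
    using less_packing_deltaE[OF assms] .
  define P where "P = {(x, y). x \<in> X \<and> y \<in> X \<and> x \<noteq> y}"
  \<comment> \<open>Half the smallest slack, because both centres of a pair move; the 1 covers
    packings with fewer than two centres.\<close>
  define \<gamma> where "\<gamma> = Min (insert 1 ((\<lambda>(x, y). (dist x y - \<rho> x - \<rho> y) / 2) ` P))"
  have "finite P" by (rule finite_subset[of _ "X \<times> X"]) (use X in \<open>auto simp: P_def packing_def\<close>)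
  then have \<gamma>: "\<gamma> \<le> (dist x y - \<rho> x - \<rho> y) / 2" if "(x, y) \<in> P" for x y
    unfolding \<gamma>_def using that by (intro Min_le) force+
  have "0 < dist x y - \<rho> x - \<rho> y" if "(x, y) \<in> P" for x y
  proof -
    have "\<rho> x + \<rho> y < dist x y" using that X(1) by (simp add: P_def packing_def)
    then show ?thesis by simp
  qed
  then have \<gamma>0: "0 < \<gamma>"
    unfolding \<gamma>_def using \<open>finite P\<close> by (subst Min_gr_iff) auto
  show thesis
  proof (rule that[OF \<gamma>0])
    fix B assume "\<And>x. x \<in> A \<Longrightarrow> \<exists>y\<in>B. dist x y < \<gamma>"
    then obtain p where p: "\<And>x. x \<in> A \<Longrightarrow> p x \<in> B \<and> dist x (p x) < \<gamma>" by metis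
    have "ennreal (\<Sum>x\<in>X. (2 * \<rho> x) powr s) \<le> packing_delta s \<delta> B"
    proof (rule packing_sum_le)
      show "finite X" using X by (simp add: packing_def)
      show "p x \<in> B \<and> 0 < \<rho> x \<and> \<rho> x \<le> \<delta>" if "x \<in> X" for x
        using that X p by (auto simp: packing_def)
      show "\<rho> x + \<rho> y < dist (p x) (p y)" if xy: "x \<in> X" "y \<in> X" "x \<noteq> y" for x y
      proof -
        have "dist x y \<le> dist x (p x) + dist (p x) (p y) + dist y (p y)"
          by (metis dist_commute dist_triangle3 dist_triangle add_right_mono order_trans)
        moreover have "dist x (p x) < \<gamma>" "dist y (p y) < \<gamma>" using xy X p by (auto simp: packing_def)
        moreover have "\<gamma> \<le> (dist x y - \<rho> x - \<rho> y) / 2" using xy by (intro \<gamma>) (simp add: P_def)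
        ultimately show ?thesis by simp
      qed
    qed
    with X(2) show "t < packing_delta s \<delta> B" by simp
  qed
qed

text \<open>Centres in the closure can be moved into \<open>A\<close> by lower semicontinuity. The
  Baire argument for infinite packing measure depends on this.\<close>

lemma packing_premeasure_closure:
  fixes A :: "'a::euclidean_space set"
  shows "packing_premeasure s (closure A) = packing_premeasure s A"
proof (rule antisym[OF _ packing_premeasure_mono[OF closure_subset]])
  have "packing_delta s \<delta> (closure A) \<le> packing_delta s \<delta> A" for \<delta>
  proof (rule ccontr)
    assume "\<not> ?thesis"
    then have "packing_delta s \<delta> A < packing_delta s \<delta> (closure A)" by simp
    then obtain \<gamma> where "0 < \<gamma>"
      and \<gamma>: "\<And>B. (\<And>x. x \<in> closure A \<Longrightarrow> \<exists>y\<in>B. dist x y < \<gamma>) \<Longrightarrow> packing_delta s \<delta> A < packing_delta s \<delta> B"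
      using packing_delta_lower_semicontinuous by blast
    have "\<exists>y\<in>A. dist x y < \<gamma>" if "x \<in> closure A" for x
      using that \<open>0 < \<gamma>\<close> by (metis closure_approachable dist_commute)
    then show False using \<gamma>[of A] by simp
  qed
  then show "packing_premeasure s (closure A) \<le> packing_premeasure s A"
    by (intro packing_premeasure_greatest) (meson packing_premeasure_lower order_trans)
qed

section \<open>Comparison of the measures\<close>

text \<open>A plain Vitali cover loses the factor \<open>5 powr s\<close>. Here the first
  \<open>n\<close> balls keep their radii and only the later ones are enlarged; as the series
  converges, the enlarged tail is negligible. The constant 1 is what gives
  \<open>Hmin \<le> Pmax\<close>. An enlarged ball has diameter at most
  \<open>10 * \<delta>\<close>.\<close>

lemma hausdorff_delta_le_packing_delta:
  fixes A :: "'a::euclidean_space set"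
  assumes s: "0 \<le> s" and \<delta>: "0 < \<delta>"
  shows "hausdorff_delta s (10 * \<delta>) A \<le> packing_delta s \<delta> A"
proof (cases "packing_delta s \<delta> A = top")
  case False
  \<comment> \<open>All small radii occur around each point, so that a point outside finitely many
    balls still has a ball in \<open>T\<close> that misses them.\<close>
  define T where "T = A \<times> {0<..\<delta>}"
  have T: "0 < snd i \<and> snd i \<le> \<delta>" if "i \<in> T" for i using that by (auto simp: T_def)
  obtain C where C: "countable C" "C \<subseteq> T"
    "pairwise (\<lambda>i j. disjnt (cball (fst i) (snd i)) (cball (fst j) (snd j))) C"
    and cov: "\<And>i. i \<in> T \<Longrightarrow> \<exists>j. j \<in> C \<and> \<not> disjnt (cball (fst i) (snd i)) (cball (fst j) (snd j)) \<and>
                        cball (fst i) (snd i) \<subseteq> ball (fst j) (5 * snd j)"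
    by (rule Vitali_covering_lemma_cballs_balls[OF T, where a = fst]) (blast intro: that)+
  define I where "I = to_nat_on C ` C"
  define x where "x = (\<lambda>i. fst (from_nat_into C i))"
  define r where "r = (\<lambda>i. snd (from_nat_into C i))"
  have fn: "from_nat_into C (to_nat_on C j) = j" if "j \<in> C" for j
    using C(1) that by simp
  have IC: "from_nat_into C i \<in> C" if "i \<in> I" for i
    using that fn by (auto simp: I_def)
  have xr: "x i \<in> A \<and> 0 < r i \<and> r i \<le> \<delta>" if "i \<in> I" for i
    using IC[OF that] C(2) by (auto simp: x_def r_def T_def)
  have disj: "cball (x i) (r i) \<inter> cball (x j) (r j) = {}" if "i \<in> I" "j \<in> I" "i \<noteq> j" for i j
  proof -
    have "from_nat_into C i \<noteq> from_nat_into C j" using that fn by (auto simp: I_def)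
    then show ?thesis using C(3) IC that by (auto simp: pairwise_def disjnt_def x_def r_def)
  qed
  define f where "f = (\<lambda>i. if i \<in> I then ennreal ((2 * r i) powr s) else 0)"
  have f_le: "(\<Sum>i. f i) \<le> packing_delta s \<delta> A"
    unfolding packing_delta_def f_def by (rule SUP_upper2[of "(I, x, r)"]) (use xr disj in auto)
  have tail: "hausdorff_delta s (10 * \<delta>) A \<le> sum f {..<n} + ennreal (5 powr s) * (\<Sum>i. f (i + n))" for n
  proof -
    define D where "D = (\<lambda>i. if i \<in> I then cball (x i) ((if i < n then 1 else 5) * r i) else {})"
    have "A \<subseteq> (\<Union>i. D i)"
    proof
      fix a assume a: "a \<in> A"
      define F where "F = (\<Union>i\<in>I \<inter> {..<n}. cball (x i) (r i))"
      show "a \<in> (\<Union>i. D i)"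
      proof (cases "a \<in> F")
        case True
        then obtain i where "i \<in> I" "i < n" "a \<in> cball (x i) (r i)" by (auto simp: F_def)
        then have "a \<in> D i" by (simp add: D_def)
        then show ?thesis by blast
      next
        case False
        have "closed F" unfolding F_def by (intro closed_UN) auto
        then obtain e where e: "0 < e" "ball a e \<subseteq> - F"
          using False by (metis Compl_iff open_Compl open_contains_ball)
        \<comment> \<open>This ball avoids the first \<open>n\<close> selected balls, so the
          selected ball that meets it has index at least \<open>n\<close> and is among the enlarged
          ones.\<close>
        define \<rho> where "\<rho> = min \<delta> (e/2)"
        have "(a, \<rho>) \<in> T" using a e \<delta> by (simp add: T_def \<rho>_def)
        from cov[OF this] obtain j where j: "j \<in> C"
          "\<not> disjnt (cball a \<rho>) (cball (fst j) (snd j))" "cball a \<rho> \<subseteq> ball (fst j) (5 * snd j)"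
          by auto
        define i where "i = to_nat_on C j"
        have i: "i \<in> I" "x i = fst j" "r i = snd j"
          using j(1) fn by (auto simp: i_def I_def x_def r_def)
        have aF: "cball a \<rho> \<inter> F = {}" using e by (auto simp: \<rho>_def subset_eq)
        have "\<not> i < n"
        proof
          assume "i < n"
          then have "cball (x i) (r i) \<subseteq> F" unfolding F_def using i(1) by (intro UN_upper) simp
          then have "cball a \<rho> \<inter> cball (x i) (r i) = {}" using aF by blast
          then show False using j(2) i by (simp add: disjnt_def)
        qed
        moreover have "a \<in> cball a \<rho>" using \<delta> e by (simp add: \<rho>_def)
        then have "a \<in> ball (fst j) (5 * snd j)" using j(3) by blast
        ultimately have "a \<in> D i" using i by (simp add: D_def)
        then show ?thesis by blast
      qed
    qed
    then have "hausdorff_delta s (10 * \<delta>) A \<le> (\<Sum>i. diam_pow (D i) s)"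
    proof (rule hausdorff_delta_le_suminf)
      fix i
      show "bounded (D i)" by (simp add: D_def)
      show "diameter (D i) \<le> 10 * \<delta>" using xr[of i] \<delta> by (auto simp: D_def)
    qed
    also have "\<dots> \<le> (\<Sum>i. ennreal ((if i < n then 1 else 5) powr s) * f i)"
    proof (intro suminf_le summableI)
      fix i
      define k :: real where "k = (if i < n then 1 else 5)"
      show "diam_pow (D i) s \<le> ennreal ((if i < n then 1 else 5) powr s) * f i"
      proof (cases "i \<in> I")
        case True
        have k: "0 < k" by (simp add: k_def)
        have "diam_pow (cball (x i) (k * r i)) s \<le> ennreal ((k * (2 * r i)) powr s)"
          by (rule diam_pow_le[OF s]) (use xr[OF True] k in auto)
        then show ?thesis
          using True by (simp add: D_def f_def powr_mult[of k] ennreal_mult' flip: k_def)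
      qed (simp add: D_def diam_pow_def)
    qed
    also have "\<dots> = (\<Sum>i. ennreal ((if i + n < n then 1 else 5) powr s) * f (i + n))
        + (\<Sum>i<n. ennreal ((if i < n then 1 else 5) powr s) * f i)"
      by (rule suminf_offset) simp
    also have "\<dots> = sum f {..<n} + ennreal (5 powr s) * (\<Sum>i. f (i + n))"
      by (simp add: add.commute)
    finally show ?thesis .
  qed
  have fin: "(\<Sum>i. f i) < top" using f_le False by (simp add: less_top order.strict_trans1)
  have "hausdorff_delta s (10 * \<delta>) A \<le> (\<Sum>i. f i)"
  proof (rule ennreal_le_epsilon)
    fix e :: real assume e: "0 < e"
    \<comment> \<open>Compensates for the enlargement factor of the tail.\<close>
    define e' where "e' = e / 5 powr s"
    have e': "0 < e'" using e by (simp add: e'_def)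
    have "(\<lambda>n. sum f {..<n} + ennreal e') \<longlonglongrightarrow> (\<Sum>i. f i) + ennreal e'"
      by (intro tendsto_intros summable_LIMSEQ summableI)
    moreover have "(\<Sum>i. f i) < (\<Sum>i. f i) + ennreal e'"
      by (rule ennreal_less_add_pos[OF fin e'])
    ultimately have "\<forall>\<^sub>F n in sequentially. (\<Sum>i. f i) < sum f {..<n} + ennreal e'"
      by (rule order_tendstoD)
    then obtain n where n: "(\<Sum>i. f i) < sum f {..<n} + ennreal e'"
      using eventually_happens by force
    have split: "(\<Sum>i. f i) = (\<Sum>i. f (i + n)) + sum f {..<n}"
      by (rule suminf_offset) simp
    have "sum f {..<n} + (\<Sum>i. f (i + n)) < sum f {..<n} + ennreal e'"
      using n unfolding split by (subst add.commute)
    then have "(\<Sum>i. f (i + n)) < ennreal e'"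
      by (simp add: ennreal_add_left_cancel_less)
    then have "ennreal (5 powr s) * (\<Sum>i. f (i + n)) \<le> ennreal (5 powr s) * ennreal e'"
      by (intro mult_left_mono) auto
    also have "\<dots> = ennreal e" by (simp add: e'_def ennreal_mult'[symmetric])
    finally have "hausdorff_delta s (10 * \<delta>) A \<le> sum f {..<n} + ennreal e"
      using tail[of n] by (meson add_left_mono order_trans)
    also have "\<dots> \<le> (\<Sum>i. f i) + ennreal e"
      unfolding split by (simp add: add_right_mono)
    finally show "hausdorff_delta s (10 * \<delta>) A \<le> (\<Sum>i. f i) + ennreal e" .
  qed
  with f_le show ?thesis by simp
qed simp

lemma hausdorff_measure_le_packing_premeasure:
  fixes A :: "'a::euclidean_space set"
  assumes s: "0 \<le> s"
  shows "hausdorff_measure s A \<le> packing_premeasure s A"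
proof (rule hausdorff_measure_le, rule packing_premeasure_greatest)
  fix \<delta> \<delta>' :: real assume \<delta>: "0 < \<delta>" "0 < \<delta>'"
  define \<eta> where "\<eta> = min (\<delta> / 10) \<delta>'"
  have \<eta>: "0 < \<eta>" "10 * \<eta> \<le> \<delta>" "\<eta> \<le> \<delta>'" using \<delta> by (auto simp: \<eta>_def)
  have "hausdorff_delta s \<delta> A \<le> hausdorff_delta s (10 * \<eta>) A"
    by (rule hausdorff_delta_antimono[OF \<eta>(2)])
  also have "\<dots> \<le> packing_delta s \<eta> A" by (rule hausdorff_delta_le_packing_delta[OF s \<eta>(1)])
  also have "\<dots> \<le> packing_delta s \<delta>' A" by (rule packing_delta_mono_gauge[OF \<eta>(3)])
  finally show "hausdorff_delta s \<delta> A \<le> packing_delta s \<delta>' A" .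
qed

lemma hausdorff_measure_le_packing_measure:
  fixes A :: "'a::euclidean_space set"
  assumes s: "0 \<le> s"
  shows "hausdorff_measure s A \<le> packing_measure s A"
  unfolding packing_measure_def
proof (rule INF_greatest, clarify)
  fix C :: "nat \<Rightarrow> 'a set" assume "A \<subseteq> (\<Union>i. C i)"
  then have "hausdorff_measure s A \<le> (\<Sum>i. hausdorff_measure s (C i))"
    by (rule hausdorff_measure_countably_subadditive)
  also have "\<dots> \<le> (\<Sum>i. packing_premeasure s (C i))"
    by (intro suminf_le summableI hausdorff_measure_le_packing_premeasure s)
  finally show "hausdorff_measure s A \<le> (\<Sum>i. packing_premeasure s (C i))" .
qed

section \<open>The packing premeasure on compact sets\<close>

text \<open>If the premeasure of every neighbourhood of \<open>F\<close> exceeded that of \<open>F\<close> by \<open>e\<close>, then fine packings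
  of these neighbourhoods would have a definite amount of mass in balls that are far from \<open>F\<close> compared
  with their radii, because the other balls can be moved to centres in \<open>F\<close>. Infinitely many such
  families could be chosen disjoint from each other, and the premeasure of \<open>A\<close> would be infinite.\<close>

lemma packing_premeasure_outer_regular:
  fixes A :: "'a::euclidean_space set"
  assumes s: "0 \<le> s" and FA: "F \<subseteq> A" and fin: "packing_premeasure s A < top" and e: "0 < e"
  shows "\<exists>\<eta>>0. packing_premeasure s {x\<in>A. \<exists>y\<in>F. dist x y < \<eta>} \<le> packing_premeasure s F + ennreal e"
proof (rule ccontr)
  assume "\<not> ?thesis"
  then have gt: "packing_premeasure s F + ennreal e < packing_premeasure s {x\<in>A. \<exists>y\<in>F. dist x y < \<eta>}"
    if "0 < \<eta>" for \<eta> using that by (auto simp: not_le)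
  have "packing_premeasure s F < top"
    using packing_premeasure_mono[OF FA] fin by (rule order.strict_trans1)
  then obtain t where t: "packing_premeasure s F = ennreal t" "0 \<le> t"
    by (metis ennreal_cases less_irrefl)
  have "packing_premeasure s F < ennreal (t + e/2)" using e t by (simp add: ennreal_less_iff)
  then obtain \<delta>0 where \<delta>0: "0 < \<delta>0" "packing_delta s \<delta>0 F < ennreal (t + e/2)"
    unfolding packing_premeasure_def INF_less_iff by auto
  \<comment> \<open>Balls within \<open>\<theta> * \<rho>\<close> of \<open>F\<close> will be
    recentred in \<open>F\<close> with radius \<open>(1 - \<theta>) * \<rho>\<close>. The choice of
    \<theta> keeps the loss so small that these balls carry mass below
    \<open>t + 3/4 * e\<close>.\<close>
  obtain \<theta> where \<theta>: "0 < \<theta>" "\<theta> < 1" "t + e/2 < (1 - \<theta>) powr s * (t + 3/4 * e)"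
  proof -
    have "((\<lambda>\<theta>. (1 - \<theta>) powr s * (t + 3/4 * e)) \<longlongrightarrow> (1 - 0) powr s * (t + 3/4 * e)) (at_right 0)"
      by (intro tendsto_intros) auto
    then have "\<forall>\<^sub>F \<theta> in at_right 0. t + e/2 < (1 - \<theta>) powr s * (t + 3/4 * e)"
      using e by (intro order_tendstoD(1)) auto
    moreover have "\<forall>\<^sub>F \<theta> in at_right (0::real). \<theta> < 1"
      by (intro order_tendstoD(2)[OF tendsto_ident_at]) auto
    ultimately have "\<forall>\<^sub>F \<theta> in at_right 0. t + e/2 < (1 - \<theta>) powr s * (t + 3/4 * e) \<and> \<theta> < 1 \<and> 0 < \<theta>"
      by (auto intro!: eventually_conj simp: eventually_at_right_less)
    then show thesis using that eventually_happens trivial_limit_at_right_real by blast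
  qed
  \<comment> \<open>The remaining balls carry at least \<open>e/4\<close> of a mass above
    \<open>t + e\<close>. Their radii are multiplied by \<open>\<theta>/2\<close>, so that the new
    diameter \<open>\<theta> * \<rho>\<close> is less than the distance to \<open>F\<close>.\<close>
  define c where "c = (\<theta>/2) powr s * (e/4)"
  have c: "0 < c" using \<theta> e by (simp add: c_def)
  have far: "\<exists>X \<rho>. packing \<delta> {x\<in>A. \<exists>y\<in>F. dist x y < \<eta>} X \<rho> \<and>
      (\<forall>x\<in>X. \<forall>y\<in>F. 2 * \<rho> x < dist x y) \<and> c \<le> (\<Sum>x\<in>X. (2 * \<rho> x) powr s)"
    if \<delta>: "0 < \<delta>" "\<delta> \<le> \<delta>0" and \<eta>: "0 < \<eta>" for \<delta> \<eta>
  proof -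
    have "ennreal (t + e) < packing_delta s \<delta> {x\<in>A. \<exists>y\<in>F. dist x y < \<eta>}"
      using order.strict_trans2[OF gt[OF \<eta>] packing_premeasure_lower[OF \<delta>(1)]] t e by simp
    then obtain X \<rho> where X: "packing \<delta> {x\<in>A. \<exists>y\<in>F. dist x y < \<eta>} X \<rho>"
      "ennreal (t + e) < ennreal (\<Sum>x\<in>X. (2 * \<rho> x) powr s)"
      by (rule less_packing_deltaE)
    have sumX: "t + e < (\<Sum>x\<in>X. (2 * \<rho> x) powr s)"
      using X(2) t e by (subst (asm) ennreal_less_iff) auto
    have finX: "finite X" using X by (simp add: packing_def)
    define B where "B = {x\<in>X. \<exists>y\<in>F. dist x y \<le> \<theta> * \<rho> x}"
    then have "\<forall>x\<in>B. \<exists>y\<in>F. dist x y \<le> \<theta> * \<rho> x" by blast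
    then obtain p where p: "\<And>x. x \<in> B \<Longrightarrow> p x \<in> F \<and> dist x (p x) \<le> \<theta> * \<rho> x" by metis
    have BX: "B \<subseteq> X" by (auto simp: B_def)
    have "ennreal (\<Sum>x\<in>B. (2 * ((1 - \<theta>) * \<rho> x)) powr s) \<le> packing_delta s \<delta>0 F"
    proof (rule packing_sum_le)
      show "finite B" using finX BX finite_subset by blast
      show "p x \<in> F \<and> 0 < (1 - \<theta>) * \<rho> x \<and> (1 - \<theta>) * \<rho> x \<le> \<delta>0" if "x \<in> B" for x
      proof -
        have r: "0 < \<rho> x" "\<rho> x \<le> \<delta>" using that BX X by (auto simp: packing_def)
        have "(1 - \<theta>) * \<rho> x \<le> 1 * \<rho> x" using r \<theta> by (intro mult_right_mono) auto
        then have "(1 - \<theta>) * \<rho> x \<le> \<delta>0" using r \<delta> by linarith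
        then show ?thesis using r \<theta> p[OF that] by simp
      qed
      show "(1 - \<theta>) * \<rho> x + (1 - \<theta>) * \<rho> y < dist (p x) (p y)" if xy: "x \<in> B" "y \<in> B" "x \<noteq> y" for x y
      proof -
        have "dist x y \<le> dist x (p x) + dist (p x) (p y) + dist y (p y)"
          by (metis dist_commute dist_triangle3 dist_triangle add_right_mono order_trans)
        moreover have "\<rho> x + \<rho> y < dist x y" using xy BX X(1) unfolding packing_def by blast
        ultimately show ?thesis using p[OF xy(1)] p[OF xy(2)] by (simp add: algebra_simps)
      qed
    qed
    then have "ennreal (\<Sum>x\<in>B. (2 * ((1 - \<theta>) * \<rho> x)) powr s) < ennreal (t + e/2)"
      using \<delta>0(2) by (rule order.strict_trans1)
    then have "(\<Sum>x\<in>B. (2 * ((1 - \<theta>) * \<rho> x)) powr s) < t + e/2"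
      using t e by (subst (asm) ennreal_less_iff) (auto intro: sum_nonneg)
    moreover have "(2 * ((1 - \<theta>) * \<rho> x)) powr s = (1 - \<theta>) powr s * (2 * \<rho> x) powr s" for x
      using powr_mult[of "1 - \<theta>" "2 * \<rho> x" s] by (simp add: mult_ac)
    ultimately have "(1 - \<theta>) powr s * (\<Sum>x\<in>B. (2 * \<rho> x) powr s) < (1 - \<theta>) powr s * (t + 3/4 * e)"
      using \<theta>(3) by (simp add: sum_distrib_left)
    then have near: "(\<Sum>x\<in>B. (2 * \<rho> x) powr s) < t + 3/4 * e"
      using \<theta> by simp
    have "(\<Sum>x\<in>X. (2 * \<rho> x) powr s) = (\<Sum>x\<in>X - B. (2 * \<rho> x) powr s) + (\<Sum>x\<in>B. (2 * \<rho> x) powr s)"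
      by (rule sum.subset_diff[OF BX finX])
    then have "e/4 \<le> (\<Sum>x\<in>X - B. (2 * \<rho> x) powr s)" using near sumX by simp
    then have "c \<le> (\<theta>/2) powr s * (\<Sum>x\<in>X - B. (2 * \<rho> x) powr s)"
      unfolding c_def by (rule mult_left_mono) simp
    also have "\<dots> = (\<Sum>x\<in>X - B. (2 * (\<theta>/2 * \<rho> x)) powr s)"
      unfolding sum_distrib_left using powr_mult[of "\<theta>/2" _ s]
      by (intro sum.cong refl) (metis mult.left_commute)
    finally have "c \<le> (\<Sum>x\<in>X - B. (2 * (\<theta>/2 * \<rho> x)) powr s)" .
    moreover have "packing \<delta> {x\<in>A. \<exists>y\<in>F. dist x y < \<eta>} (X - B) (\<lambda>x. \<theta>/2 * \<rho> x)"
      unfolding packing_def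
    proof (intro conjI ballI impI)
      show "finite (X - B)" "X - B \<subseteq> {x\<in>A. \<exists>y\<in>F. dist x y < \<eta>}" using X by (auto simp: packing_def)
      have le: "\<theta>/2 * \<rho> x \<le> \<rho> x" and pos: "0 < \<rho> x" "\<rho> x \<le> \<delta>" if "x \<in> X" for x
        using that X \<theta> mult_right_mono[of "\<theta>/2" 1 "\<rho> x"] by (auto simp: packing_def less_imp_le)
      show "0 < \<theta>/2 * \<rho> x" if "x \<in> X - B" for x
        using that pos[of x] \<theta> by auto
      show "\<theta>/2 * \<rho> x \<le> \<delta>" if "x \<in> X - B" for x
        using that by (intro order_trans[OF le pos(2)]) auto
      show "\<theta>/2 * \<rho> x + \<theta>/2 * \<rho> y < dist x y" if "x \<in> X - B" "y \<in> X - B" "x \<noteq> y" for x y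
      proof -
        have "\<rho> x + \<rho> y < dist x y" using that X(1) unfolding packing_def by blast
        moreover have "\<theta>/2 * \<rho> x \<le> \<rho> x" "\<theta>/2 * \<rho> y \<le> \<rho> y" using that by (auto intro!: le simp only: Diff_iff)
        ultimately show ?thesis by linarith
      qed
    qed
    moreover have "\<forall>x\<in>X - B. \<forall>y\<in>F. 2 * (\<theta>/2 * \<rho> x) < dist x y"
      by (auto simp: B_def not_le)
    ultimately show ?thesis by blast
  qed
  have many: "\<exists>X \<rho>. packing \<delta> A X \<rho> \<and> (\<forall>x\<in>X. \<forall>y\<in>F. 2 * \<rho> x < dist x y) \<and>
      real n * c \<le> (\<Sum>x\<in>X. (2 * \<rho> x) powr s)" if \<delta>: "0 < \<delta>" "\<delta> \<le> \<delta>0" for n \<delta>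
  proof (induction n)
    case 0
    have "packing \<delta> A {} (\<lambda>_. 0)" by (simp add: packing_def)
    then show ?case by force
  next
    case (Suc n)
    then obtain X \<rho> where X: "packing \<delta> A X \<rho>" "\<forall>x\<in>X. \<forall>y\<in>F. 2 * \<rho> x < dist x y"
      "real n * c \<le> (\<Sum>x\<in>X. (2 * \<rho> x) powr s)" by blast
    have finX: "finite X" using X by (simp add: packing_def)
    \<comment> \<open>The next family lives within \<open>\<gamma>/2\<close> of \<open>F\<close>
      with radii at most \<open>\<gamma>/2\<close>. An old ball satisfies
      \<open>2 * \<rho> x < dist x y\<close> for \<open>y\<close> in \<open>F\<close>, and
      \<open>\<gamma> \<le> \<rho> x\<close>, so it stays clear of the new ones.\<close>
    define \<gamma> where "\<gamma> = Min (insert 1 (\<rho> ` X))"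
    have \<gamma>0: "0 < \<gamma>" using X finX by (auto simp: \<gamma>_def packing_def)
    have \<gamma>: "\<gamma> \<le> \<rho> x" if "x \<in> X" for x using that finX by (auto simp: \<gamma>_def)
    have mm: "0 < min \<delta> (\<gamma>/2)" "min \<delta> (\<gamma>/2) \<le> \<delta>0" "0 < \<gamma>/2" using \<delta> \<gamma>0 by auto
    obtain Y \<sigma> where Y: "packing (min \<delta> (\<gamma>/2)) {x\<in>A. \<exists>y\<in>F. dist x y < \<gamma>/2} Y \<sigma>"
      "\<forall>x\<in>Y. \<forall>y\<in>F. 2 * \<sigma> x < dist x y" "c \<le> (\<Sum>x\<in>Y. (2 * \<sigma> x) powr s)"
      using far[OF mm] by blast
    have finY: "finite Y" using Y by (simp add: packing_def)
    have XY: "\<rho> x + \<sigma> g < dist x g" if x: "x \<in> X" "g \<in> Y" for x g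
    proof -
      obtain y where y: "y \<in> F" "dist g y < \<gamma>/2" using Y(1) x by (auto simp: packing_def)
      have "2 * \<rho> x < dist x y" using X(2) x y by blast
      moreover have "dist x y \<le> dist x g + dist g y" by (rule dist_triangle)
      moreover have "\<sigma> g \<le> \<gamma>/2" using Y(1) x by (auto simp: packing_def)
      ultimately show ?thesis using y \<gamma>[OF x(1)] by simp
    qed
    have pos: "0 < \<rho> x" if "x \<in> X" for x using X that by (auto simp: packing_def)
    have posY: "0 < \<sigma> x" if "x \<in> Y" for x using Y that by (auto simp: packing_def)
    have disj: "X \<inter> Y = {}"
    proof (rule ccontr)
      assume "X \<inter> Y \<noteq> {}"
      then obtain x where "x \<in> X" "x \<in> Y" by blast
      then show False using XY[of x x] pos[of x] posY[of x] by simp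
    qed
    define \<tau> where "\<tau> = (\<lambda>x. if x \<in> X then \<rho> x else \<sigma> x)"
    have \<tau>: "\<tau> x = \<rho> x" if "x \<in> X" for x using that by (simp add: \<tau>_def)
    have \<tau>Y: "\<tau> x = \<sigma> x" if "x \<in> Y" for x using that disj by (auto simp: \<tau>_def)
    have "packing \<delta> A (X \<union> Y) \<tau>"
      unfolding packing_def
    proof (intro conjI ballI impI)
      show "finite (X \<union> Y)" using finX finY by simp
      show "X \<union> Y \<subseteq> A" using X Y by (auto simp: packing_def)
      show "0 < \<tau> x" "\<tau> x \<le> \<delta>" if "x \<in> X \<union> Y" for x
        using that X(1) Y(1) by (auto simp: \<tau> \<tau>Y packing_def)
      show "\<tau> x + \<tau> y < dist x y" if "x \<in> X \<union> Y" "y \<in> X \<union> Y" "x \<noteq> y" for x y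
        using that X(1) Y(1) XY[of x y] XY[of y x]
        by (auto simp: \<tau> \<tau>Y packing_def dist_commute add.commute)
    qed
    moreover have "\<forall>x\<in>X \<union> Y. \<forall>y\<in>F. 2 * \<tau> x < dist x y"
      using X(2) Y(2) by (auto simp: \<tau> \<tau>Y)
    moreover have "real (Suc n) * c \<le> (\<Sum>x\<in>X \<union> Y. (2 * \<tau> x) powr s)"
    proof -
      have "(\<Sum>x\<in>X \<union> Y. (2 * \<tau> x) powr s) = (\<Sum>x\<in>X. (2 * \<tau> x) powr s) + (\<Sum>x\<in>Y. (2 * \<tau> x) powr s)"
        by (rule sum.union_disjoint[OF finX finY disj])
      also have "\<dots> = (\<Sum>x\<in>X. (2 * \<rho> x) powr s) + (\<Sum>x\<in>Y. (2 * \<sigma> x) powr s)"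
        by (simp add: \<tau> \<tau>Y)
      finally show ?thesis using X(3) Y(3) by (simp add: algebra_simps)
    qed
    ultimately show ?case by blast
  qed
  obtain \<delta>1 where \<delta>1: "0 < \<delta>1" "packing_delta s \<delta>1 A < top"
    using fin unfolding packing_premeasure_def INF_less_iff by auto
  define \<delta> where "\<delta> = min \<delta>0 \<delta>1"
  have \<delta>: "0 < \<delta>" "\<delta> \<le> \<delta>0" "\<delta> \<le> \<delta>1" using \<delta>0 \<delta>1 by (auto simp: \<delta>_def)
  have "packing_delta s \<delta> A < top"
    using packing_delta_mono_gauge[OF \<delta>(3)] \<delta>1(2) by (rule order.strict_trans1)
  then obtain b where b: "packing_delta s \<delta> A = ennreal b" "0 \<le> b"
    by (metis ennreal_cases less_irrefl)
  obtain n where n: "b < real n * c" using c ex_less_of_nat_mult by blast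
  from many[OF \<delta>(1,2), of n] obtain X \<rho> where X: "packing \<delta> A X \<rho>" "real n * c \<le> (\<Sum>x\<in>X. (2 * \<rho> x) powr s)"
    by blast
  have "ennreal (\<Sum>x\<in>X. (2 * \<rho> x) powr s) \<le> ennreal b"
    unfolding b(1)[symmetric] by (rule packing_sum_le) (use X in \<open>auto simp: packing_def\<close>)
  then show False using n X(2) b(2) by (simp add: ennreal_le_iff)
qed

lemma subadditive_UN_le:
  fixes \<mu> :: "'a set \<Rightarrow> ennreal"
  assumes "\<mu> {} = 0" "\<And>A B. \<mu> (A \<union> B) \<le> \<mu> A + \<mu> B" "finite I"
  shows "\<mu> (\<Union>i\<in>I. A i) \<le> (\<Sum>i\<in>I. \<mu> (A i))"
  using assms(3)
proof (induction I)
  case (insert i I)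
  have "\<mu> (\<Union>i\<in>insert i I. A i) \<le> \<mu> (A i) + \<mu> (\<Union>i\<in>I. A i)"
    using assms(2)[of "A i" "\<Union>i\<in>I. A i"] by simp
  also have "\<dots> \<le> \<mu> (A i) + (\<Sum>i\<in>I. \<mu> (A i))"
    by (intro add_left_mono insert.IH)
  finally show ?case using insert by simp
qed (simp add: assms(1))

text \<open>The premeasure is only finitely subadditive in general. Outer regularity thickens the
  pieces of a countable cover to relatively open sets at a total cost \<open>e\<close>, and
  compactness leaves finitely many of them.\<close>

lemma packing_measure_eq_premeasure:
  fixes A :: "'a::euclidean_space set"
  assumes s: "0 \<le> s" and A: "compact A" and fin: "packing_premeasure s A < top"
  shows "packing_measure s A = packing_premeasure s A"
proof (rule antisym[OF packing_measure_le_premeasure])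
  show "packing_premeasure s A \<le> packing_measure s A"
    unfolding packing_measure_def
  proof (rule INF_greatest, clarify, rule ennreal_le_epsilon)
    fix C :: "nat \<Rightarrow> 'a set" and e :: real
    assume cover: "A \<subseteq> (\<Union>i. C i)" and e: "0 < e"
    define N where "N = (\<lambda>i \<eta>. {x\<in>A. \<exists>y\<in>C i \<inter> A. dist x y < \<eta>})"
    have "\<exists>\<eta>>0. packing_premeasure s (N i \<eta>) \<le> packing_premeasure s (C i \<inter> A) + ennreal (e * (1/2) ^ Suc i)" for i
      unfolding N_def by (rule packing_premeasure_outer_regular[OF s _ fin]) (use e in auto)
    then obtain \<eta> where \<eta>: "\<And>i. 0 < \<eta> i"
      "\<And>i. packing_premeasure s (N i (\<eta> i)) \<le> packing_premeasure s (C i \<inter> A) + ennreal (e * (1/2) ^ Suc i)"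
      by metis
    have "A \<subseteq> (\<Union>i\<in>UNIV. \<Union>y\<in>C i \<inter> A. ball y (\<eta> i))"
    proof
      fix x assume x: "x \<in> A"
      then obtain i where "x \<in> C i" using cover by blast
      then show "x \<in> (\<Union>i. \<Union>y\<in>C i \<inter> A. ball y (\<eta> i))" using x \<eta>(1)[of i] by force
    qed
    then obtain I where I: "finite I" "A \<subseteq> (\<Union>i\<in>I. \<Union>y\<in>C i \<inter> A. ball y (\<eta> i))"
      by (rule compactE_image[OF A, rotated]) auto
    have "A \<subseteq> (\<Union>i\<in>I. N i (\<eta> i))"
    proof
      fix x assume x: "x \<in> A"
      then obtain i y where i: "i \<in> I" "y \<in> C i \<inter> A" "dist y x < \<eta> i" using I(2) by auto
      then have "x \<in> N i (\<eta> i)"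
        unfolding N_def using x by (intro CollectI conjI bexI[of _ y]) (auto simp: dist_commute)
      then show "x \<in> (\<Union>i\<in>I. N i (\<eta> i))" using i by blast
    qed
    then have "packing_premeasure s A \<le> packing_premeasure s (\<Union>i\<in>I. N i (\<eta> i))"
      by (rule packing_premeasure_mono)
    also have "\<dots> \<le> (\<Sum>i\<in>I. packing_premeasure s (N i (\<eta> i)))"
      by (rule subadditive_UN_le[OF packing_premeasure_empty packing_premeasure_Un_le I(1)])
    also have "\<dots> \<le> (\<Sum>i\<in>I. packing_premeasure s (C i) + ennreal (e * (1/2) ^ Suc i))"
    proof (rule sum_mono)
      fix i
      have "packing_premeasure s (C i \<inter> A) \<le> packing_premeasure s (C i)"
        by (rule packing_premeasure_mono) simp
      then show "packing_premeasure s (N i (\<eta> i)) \<le> packing_premeasure s (C i) + ennreal (e * (1/2) ^ Suc i)"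
        using \<eta>(2)[of i] by (meson add_right_mono order_trans)
    qed
    also have "\<dots> \<le> (\<Sum>i. packing_premeasure s (C i) + ennreal (e * (1/2) ^ Suc i))"
      by (rule sum_le_suminf) (use I in auto)
    also have "\<dots> = (\<Sum>i. packing_premeasure s (C i)) + (\<Sum>i. ennreal (e * (1/2) ^ Suc i))"
      by (simp add: suminf_add[symmetric])
    also have "(\<Sum>n. ennreal (e * (1/2) ^ Suc n)) = ennreal e"
      by (rule suminf_ennreal_eq) (use e sums_mult[OF power_half_series, of e] in auto)
    finally show "packing_premeasure s A \<le> (\<Sum>i. packing_premeasure s (C i)) + ennreal e" .
  qed
qed

text \<open>Outer regularity of the premeasure replaces Caratheodory's criterion here.\<close>

lemma compact_additive:
  fixes \<mu> :: "'a::euclidean_space set \<Rightarrow> ennreal"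
  assumes s: "0 \<le> s"
    and mono: "\<And>A B. A \<subseteq> B \<Longrightarrow> \<mu> A \<le> \<mu> B" and Un: "\<And>A B. \<mu> (A \<union> B) \<le> \<mu> A + \<mu> B"
    and le: "\<And>A. \<mu> A \<le> packing_premeasure s A"
    and disj: "\<And>A B. compact A \<Longrightarrow> compact B \<Longrightarrow> A \<inter> B = {} \<Longrightarrow> packing_premeasure s (A \<union> B) < top \<Longrightarrow>
      \<mu> A + \<mu> B \<le> \<mu> (A \<union> B)"
    and A: "compact A" and B: "compact B" and fin: "packing_premeasure s (A \<union> B) < top"
    and null: "packing_measure s (A \<inter> B) = 0"
  shows "\<mu> (A \<union> B) = \<mu> A + \<mu> B"
proof (rule antisym[OF Un ennreal_le_epsilon])
  fix e :: real assume e: "0 < e"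
  \<comment> \<open>The overlap is compact with finite premeasure, so being null for the packing
    measure makes it null for the premeasure, to which outer regularity applies.\<close>
  have "packing_premeasure s (A \<inter> B) = 0"
    using packing_measure_eq_premeasure[OF s compact_Int[OF A B]] null
      order.strict_trans1[OF packing_premeasure_mono fin, of "A \<inter> B"] by auto
  then obtain \<eta> where \<eta>: "0 < \<eta>"
    "packing_premeasure s {x\<in>A \<union> B. \<exists>y\<in>A \<inter> B. dist x y < \<eta>} \<le> ennreal (e/2)"
    using packing_premeasure_outer_regular[OF s _ fin, of "A \<inter> B" "e/2"] e by auto
  \<comment> \<open>Removing this open neighbourhood of the overlap leaves disjoint compact sets and
    costs each of \<open>A\<close> and \<open>B\<close> at most \<open>e/2\<close>.\<close>
  define V where "V = (\<Union>y\<in>A \<inter> B. ball y \<eta>)"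
  have "open V" by (auto simp: V_def)
  have small: "\<mu> (D \<inter> V) \<le> ennreal (e/2)" if "D \<subseteq> A \<union> B" for D
  proof -
    have "D \<inter> V \<subseteq> {x\<in>A \<union> B. \<exists>y\<in>A \<inter> B. dist x y < \<eta>}"
      using that by (auto simp: V_def dist_commute)
    then show ?thesis
      using \<eta>(2) le packing_premeasure_mono by (meson order_trans)
  qed
  have split: "\<mu> D \<le> \<mu> (D - V) + ennreal (e/2)" if "D \<subseteq> A \<union> B" for D
    using Un[of "D - V" "D \<inter> V"] small[OF that] unfolding Un_Diff_Int
    by (meson add_left_mono order_trans)
  have "A \<inter> B \<subseteq> V" using \<eta>(1) by (force simp: V_def)
  have e2: "ennreal e = ennreal (e/2) + ennreal (e/2)"
    using e ennreal_plus[of "e/2" "e/2"] by (simp del: ennreal_plus)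
  have "\<mu> A + \<mu> B \<le> (\<mu> (A - V) + ennreal (e/2)) + (\<mu> (B - V) + ennreal (e/2))"
    by (intro add_mono split) auto
  also have "\<dots> = \<mu> (A - V) + \<mu> (B - V) + ennreal e"
    unfolding e2 by (simp only: add_ac)
  also have "\<mu> (A - V) + \<mu> (B - V) \<le> \<mu> ((A - V) \<union> (B - V))"
  proof (rule disj)
    show "compact (A - V)" "compact (B - V)" using A B \<open>open V\<close> by (auto intro: compact_diff)
    show "(A - V) \<inter> (B - V) = {}" using \<open>A \<inter> B \<subseteq> V\<close> by blast
    show "packing_premeasure s ((A - V) \<union> (B - V)) < top"
      by (rule order.strict_trans1[OF packing_premeasure_mono fin]) auto
  qed
  also have "\<dots> \<le> \<mu> (A \<union> B)" by (rule mono) auto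
  finally show "\<mu> A + \<mu> B \<le> \<mu> (A \<union> B) + ennreal e" by (simp add: add_right_mono)
qed

lemma compact_additive_UN:
  fixes \<mu> :: "'a::euclidean_space set \<Rightarrow> ennreal"
  assumes s: "0 \<le> s"
    and empty: "\<mu> {} = 0"
    and Un: "\<And>A B. compact A \<Longrightarrow> compact B \<Longrightarrow> packing_premeasure s (A \<union> B) < top \<Longrightarrow>
      packing_measure s (A \<inter> B) = 0 \<Longrightarrow> \<mu> (A \<union> B) = \<mu> A + \<mu> B"
    and I: "finite I" and A: "\<And>i. i \<in> I \<Longrightarrow> compact (A i)"
    and fin: "packing_premeasure s (\<Union>i\<in>I. A i) < top"
    and null: "\<And>i j. i \<in> I \<Longrightarrow> j \<in> I \<Longrightarrow> i \<noteq> j \<Longrightarrow> packing_measure s (A i \<inter> A j) = 0"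
  shows "\<mu> (\<Union>i\<in>I. A i) = (\<Sum>i\<in>I. \<mu> (A i))"
  using I A fin null
proof (induction I)
  case (insert i I)
  have "packing_measure s (A i \<inter> (\<Union>j\<in>I. A j)) \<le> (\<Sum>j\<in>I. packing_measure s (A i \<inter> A j))"
    unfolding Int_UN_distrib by (rule subadditive_UN_le[OF packing_measure_empty packing_measure_Un_le insert.hyps(1)])
  also have "\<dots> = 0" by (rule sum.neutral) (use insert in auto)
  finally have "\<mu> (A i \<union> (\<Union>j\<in>I. A j)) = \<mu> (A i) + \<mu> (\<Union>j\<in>I. A j)"
    using insert by (intro Un compact_UN) auto
  moreover have "\<mu> (\<Union>j\<in>I. A j) = (\<Sum>j\<in>I. \<mu> (A j))"
  proof (rule insert.IH)
    show "packing_premeasure s (\<Union>j\<in>I. A j) < top"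
      by (rule order.strict_trans1[OF packing_premeasure_mono insert.prems(2)]) auto
  qed (use insert.prems in auto)
  ultimately show ?case using insert by simp
qed (simp add: empty)

text \<open>Disjoint compact sets lie at positive distance, where the separated case applies;
  \<open>compact_additive\<close> then admits null overlaps.\<close>

lemma hausdorff_measure_additive_UN:
  fixes A :: "'i \<Rightarrow> 'a::euclidean_space set"
  assumes s: "0 \<le> s" and I: "finite I" and A: "\<And>i. i \<in> I \<Longrightarrow> compact (A i)"
    and fin: "packing_premeasure s (\<Union>i\<in>I. A i) < top"
    and null: "\<And>i j. i \<in> I \<Longrightarrow> j \<in> I \<Longrightarrow> i \<noteq> j \<Longrightarrow> packing_measure s (A i \<inter> A j) = 0"
  shows "hausdorff_measure s (\<Union>i\<in>I. A i) = (\<Sum>i\<in>I. hausdorff_measure s (A i))"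
proof (rule compact_additive_UN[OF s _ _ I A fin null])
  fix A B :: "'a set"
  assume AB: "compact A" "compact B" "packing_premeasure s (A \<union> B) < top" "packing_measure s (A \<inter> B) = 0"
  show "hausdorff_measure s (A \<union> B) = hausdorff_measure s A + hausdorff_measure s B"
  proof (rule compact_additive[OF s hausdorff_measure_mono hausdorff_measure_Un_le
        hausdorff_measure_le_packing_premeasure[OF s] _ AB])
    fix A B :: "'a set" assume "compact A" "compact B" "A \<inter> B = {}"
    then obtain d where "0 < d" "\<forall>x\<in>A. \<forall>y\<in>B. d \<le> dist x y"
      using separate_compact_closed compact_imp_closed by metis
    then show "hausdorff_measure s A + hausdorff_measure s B \<le> hausdorff_measure s (A \<union> B)"
      by (intro hausdorff_measure_Un_separated) auto
  qed
qed auto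

text \<open>For separated sets additivity is available for the premeasure; on compact sets of finite
  premeasure it transfers to the packing measure.\<close>

lemma packing_measure_additive_UN:
  fixes A :: "'i \<Rightarrow> 'a::euclidean_space set"
  assumes s: "0 \<le> s" and I: "finite I" and A: "\<And>i. i \<in> I \<Longrightarrow> compact (A i)"
    and fin: "packing_premeasure s (\<Union>i\<in>I. A i) < top"
    and null: "\<And>i j. i \<in> I \<Longrightarrow> j \<in> I \<Longrightarrow> i \<noteq> j \<Longrightarrow> packing_measure s (A i \<inter> A j) = 0"
  shows "packing_measure s (\<Union>i\<in>I. A i) = (\<Sum>i\<in>I. packing_measure s (A i))"
proof (rule compact_additive_UN[OF s _ _ I A fin null])
  fix A B :: "'a set"
  assume AB: "compact A" "compact B" "packing_premeasure s (A \<union> B) < top" "packing_measure s (A \<inter> B) = 0"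
  show "packing_measure s (A \<union> B) = packing_measure s A + packing_measure s B"
  proof (rule compact_additive[OF s packing_measure_mono packing_measure_Un_le
        packing_measure_le_premeasure _ AB])
    fix A B :: "'a set"
    assume AB: "compact A" "compact B" "A \<inter> B = {}" and fin: "packing_premeasure s (A \<union> B) < top"
    then obtain d where "0 < d" "\<forall>x\<in>A. \<forall>y\<in>B. d \<le> dist x y"
      using separate_compact_closed compact_imp_closed by metis
    then have "packing_premeasure s A + packing_premeasure s B \<le> packing_premeasure s (A \<union> B)"
      by (intro packing_premeasure_Un_separated) auto
    also have "\<dots> = packing_measure s (A \<union> B)"
      using AB fin by (intro packing_measure_eq_premeasure[OF s, symmetric] compact_Un)
    finally show "packing_measure s A + packing_measure s B \<le> packing_measure s (A \<union> B)"
      by (meson add_mono order_trans packing_measure_le_premeasure)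
  qed
qed auto

text \<open>By Baire, the closure of some member of any countable cover contains a relatively open
  piece of \<open>A\<close>; the premeasure of that member equals that of its closure, hence is
  infinite.\<close>

lemma packing_measure_eq_top:
  fixes A :: "'a::euclidean_space set"
  assumes A: "compact A" "A \<noteq> {}"
    and loc: "\<And>x e. x \<in> A \<Longrightarrow> 0 < e \<Longrightarrow> packing_premeasure s (A \<inter> ball x e) = top"
  shows "packing_measure s A = top"
proof -
  have "top \<le> packing_measure s A"
    unfolding packing_measure_def
  proof (rule INF_greatest, clarify)
    fix C :: "nat \<Rightarrow> 'a set" assume cover: "A \<subseteq> (\<Union>i. C i)"
    have "\<exists>i. \<not> A \<subseteq> closure (A - closure (C i))"
    proof (rule ccontr)
      assume "\<not> ?thesis"
      then have all: "A \<subseteq> closure (A - closure (C i))" for i by blast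
      \<comment> \<open>If all these relatively open sets were dense in \<open>A\<close>, so would
        be their intersection, which is empty because the \<open>C i\<close> cover
        \<open>A\<close>.\<close>
      have "A \<subseteq> closure (\<Inter>i. A - closure (C i))"
      proof (intro Baire)
        show "closed A" by (rule compact_imp_closed[OF A(1)])
        show "countable (range (\<lambda>i. A - closure (C i)))" by simp
        show "openin (top_of_set A) T \<and> A \<subseteq> closure T" if T: "T \<in> range (\<lambda>i. A - closure (C i))" for T
        proof -
          obtain i where i: "T = A - closure (C i)" using T by blast
          have "openin (top_of_set A) (A \<inter> - closure (C i))" by (rule openin_open_Int) auto
          then show ?thesis using i all by (simp add: Diff_eq)
        qed
      qed
      moreover have "(\<Inter>i. A - closure (C i)) = {}"
        using cover closure_subset[of "C _"] by blast
      ultimately have "A \<subseteq> closure {}" by (simp only:)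
      then show False using A by simp
    qed
    then obtain i x where i: "x \<in> A" "x \<notin> closure (A - closure (C i))" by blast
    then obtain e where e: "0 < e" "\<forall>y\<in>A - closure (C i). \<not> dist y x < e"
      unfolding closure_approachable by blast
    then have "A \<inter> ball x e \<subseteq> closure (C i)" by (auto simp: dist_commute)
    then have "packing_premeasure s (A \<inter> ball x e) \<le> packing_premeasure s (C i)"
      using packing_premeasure_mono packing_premeasure_closure by metis
    then have "packing_premeasure s (C i) = top" using loc[OF i(1) e(1)] by (simp add: top_unique)
    then show "top \<le> (\<Sum>i. packing_premeasure s (C i))"
      using ennreal_suminf_lessD less_top by (metis less_irrefl order_refl)
  qed
  then show ?thesis by (simp add: top_unique)
qed

section \<open>Residual sets of sequences\<close>

text \<open>The exponent of the metric is one more than the zero-based index of the first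
  difference, so the open ball of radius \<open>(1/2) ^ k\<close> is exactly the cylinder of the
  first \<open>k\<close> letters.\<close>

lemma dOmega_less_iff: "dOmega u v < (1/2) ^ k \<longleftrightarrow> (\<forall>n<k. u n = v n)"
proof (cases "u = v")
  case False
  then obtain n where n: "u n \<noteq> v n" by blast
  define L where "L = (LEAST n. u n \<noteq> v n)"
  have L: "u L \<noteq> v L" unfolding L_def using n by (rule LeastI)
  have least: "u n = v n" if "n < L" for n using that not_less_Least unfolding L_def by blast
  have "dOmega u v < (1/2) ^ k \<longleftrightarrow> (1/2::real) ^ Suc L < (1/2) ^ k"
    using False by (simp add: dOmega_def L_def)
  also have "\<dots> \<longleftrightarrow> k < Suc L"
    by (rule power_strict_decreasing_iff) auto
  also have "\<dots> \<longleftrightarrow> (\<forall>n<k. u n = v n)"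
    using L least by (metis less_Suc_eq_le not_less order_less_le_trans)
  finally show ?thesis .
qed (simp add: dOmega_def)

lemma dOmega_nonneg: "0 \<le> dOmega u v"
  by (simp add: dOmega_def)

text \<open>Where \<open>u\<close> and \<open>w\<close> first differ, \<open>v\<close> must differ
  from one of them.\<close>

lemma dOmega_ultrametric: "dOmega u w \<le> max (dOmega u v) (dOmega v w)"
proof (cases "u = w")
  case False
  define L where "L = (LEAST n. u n \<noteq> w n)"
  have "u L \<noteq> w L" unfolding L_def by (rule LeastI_ex) (use False in blast)
  then have "v L \<noteq> u L \<or> v L \<noteq> w L" by metis
  then have "\<not> dOmega u v < (1/2) ^ Suc L \<or> \<not> dOmega v w < (1/2) ^ Suc L"
    unfolding dOmega_less_iff by (metis lessI)
  then show ?thesis using False by (auto simp: dOmega_def[of u w] L_def)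
next
  case True
  then have "dOmega u w = 0" by (simp add: dOmega_def)
  then show ?thesis using dOmega_nonneg[of u v] by (simp add: le_max_iff_disj)
qed

interpretation Omega: Metric_space "Omega N" dOmega for N
proof
  show "0 \<le> dOmega u v" for u v by (rule dOmega_nonneg)
  show "dOmega u v = dOmega v u" for u v
    by (simp add: dOmega_def eq_commute)
  show "dOmega u v = 0 \<longleftrightarrow> u = v" for u v by (simp add: dOmega_def)
  show "dOmega u w \<le> dOmega u v + dOmega v w" for u v w
    using dOmega_ultrametric[of u w v] dOmega_nonneg[of u v] dOmega_nonneg[of v w] by simp
qed

lemma openin_Omega_top:
  "openin (Omega_top N) U \<longleftrightarrow> U \<subseteq> Omega N \<and>
     (\<forall>\<omega>\<in>U. \<exists>k. \<forall>\<omega>'\<in>Omega N. (\<forall>n<k. \<omega>' n = \<omega> n) \<longrightarrow> \<omega>' \<in> U)"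
proof -
  have "(\<exists>r>0. Omega.mball N \<omega> r \<subseteq> U) \<longleftrightarrow> (\<exists>k. \<forall>\<omega>'\<in>Omega N. (\<forall>n<k. \<omega>' n = \<omega> n) \<longrightarrow> \<omega>' \<in> U)"
    if \<omega>: "\<omega> \<in> Omega N" for \<omega>
  proof -
    have ball: "Omega.mball N \<omega> ((1/2) ^ k) = {\<omega>'\<in>Omega N. \<forall>n<k. \<omega>' n = \<omega> n}" for k
      using \<omega> by (auto simp: Omega.mball_def dOmega_less_iff)
    have "(\<exists>r>0. Omega.mball N \<omega> r \<subseteq> U) \<longleftrightarrow> (\<exists>k. Omega.mball N \<omega> ((1/2) ^ k) \<subseteq> U)"
    proof
      assume "\<exists>r>0. Omega.mball N \<omega> r \<subseteq> U"
      then obtain r where r: "0 < r" "Omega.mball N \<omega> r \<subseteq> U" by blast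
      then obtain k where "(1/2) ^ k < r" using real_arch_pow_inv[of r "1/2"] by auto
      then have "Omega.mball N \<omega> ((1/2) ^ k) \<subseteq> Omega.mball N \<omega> r"
        by (auto simp: Omega.mball_def)
      then show "\<exists>k. Omega.mball N \<omega> ((1/2) ^ k) \<subseteq> U" using r by blast
    next
      assume "\<exists>k. Omega.mball N \<omega> ((1/2) ^ k) \<subseteq> U"
      then obtain k where "Omega.mball N \<omega> ((1/2) ^ k) \<subseteq> U" by blast
      then show "\<exists>r>0. Omega.mball N \<omega> r \<subseteq> U" by (intro exI[of _ "(1/2) ^ k"]) auto
    qed
    then show ?thesis unfolding ball by blast
  qed
  then show ?thesis unfolding Omega_top_def Omega.openin_mtopology by blast
qed

text \<open>The sets \<open>P i\<close> need not be open: if every cylinder contains a cylinder on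
  which \<open>P i\<close> holds, the sequences violating \<open>P i\<close> form a nowhere dense
  set, and countability of the index type does the rest.\<close>

lemma residual_in_OmegaI:
  fixes P :: "'i::countable \<Rightarrow> (nat \<Rightarrow> nat) \<Rightarrow> bool"
  assumes AN: "A \<subseteq> Omega N" and PA: "\<And>\<omega>. \<omega> \<in> Omega N \<Longrightarrow> (\<And>i. P i \<omega>) \<Longrightarrow> \<omega> \<in> A"
    and dense: "\<And>i \<omega>0 k. \<omega>0 \<in> Omega N \<Longrightarrow> \<exists>\<omega>\<in>Omega N. \<exists>m. (\<forall>n<k. \<omega> n = \<omega>0 n) \<and>
      (\<forall>\<omega>'\<in>Omega N. (\<forall>n<m. \<omega>' n = \<omega> n) \<longrightarrow> P i \<omega>')"
  shows "residual_in (Omega_top N) A"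
proof -
  have top: "topspace (Omega_top N) = Omega N" by (simp add: Omega_top_def)
  \<comment> \<open>Intersecting with the complement of \<open>A\<close> makes the union of the
    \<open>C n\<close> equal to this complement, as \<open>meagre_in\<close> demands.\<close>
  define C where "C = (\<lambda>n::nat. {\<omega> \<in> Omega N - A. \<not> P (from_nat n) \<omega>})"
  have "Omega N - A = (\<Union>n. C n)"
  proof
    show "Omega N - A \<subseteq> (\<Union>n. C n)"
    proof
      fix \<omega> assume "\<omega> \<in> Omega N - A"
      moreover then obtain i where "\<not> P i \<omega>" using PA by blast
      ultimately have "\<omega> \<in> C (to_nat i)" by (simp add: C_def)
      then show "\<omega> \<in> (\<Union>n. C n)" by blast
    qed
  qed (auto simp: C_def)
  moreover have "nowhere_dense_in (Omega_top N) (C n)" for n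
    unfolding nowhere_dense_in_def
  proof
    show "C n \<subseteq> topspace (Omega_top N)" by (auto simp: C_def top)
    show "Omega_top N interior_of (Omega_top N closure_of C n) = {}"
    proof (rule ccontr)
      let ?W = "Omega_top N interior_of (Omega_top N closure_of C n)"
      assume "?W \<noteq> {}"
      then obtain \<omega>0 where \<omega>0: "\<omega>0 \<in> ?W" by blast
      have "openin (Omega_top N) ?W" by simp
      then obtain k where k: "?W \<subseteq> Omega N" "\<forall>\<omega>\<in>Omega N. (\<forall>n<k. \<omega> n = \<omega>0 n) \<longrightarrow> \<omega> \<in> ?W"
        unfolding openin_Omega_top using \<omega>0 by blast
      then obtain \<omega> m where \<omega>: "\<omega> \<in> Omega N" "\<forall>n<k. \<omega> n = \<omega>0 n"
        "\<forall>\<omega>'\<in>Omega N. (\<forall>n<m. \<omega>' n = \<omega> n) \<longrightarrow> P (from_nat n) \<omega>'"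
        using dense[of \<omega>0 k "from_nat n"] \<omega>0 by blast
      have "\<omega> \<in> ?W" using bspec[OF k(2) \<omega>(1)] \<omega>(2) by blast
      then have "\<omega> \<in> Omega_top N closure_of C n"
        by (rule subsetD[OF interior_of_subset])
      moreover have "openin (Omega_top N) {\<omega>'\<in>Omega N. \<forall>n<m. \<omega>' n = \<omega> n}"
        unfolding openin_Omega_top
      proof (intro conjI ballI exI[of _ m] impI)
        fix \<omega>1 \<omega>2 assume *: "\<omega>1 \<in> {\<omega>'\<in>Omega N. \<forall>n<m. \<omega>' n = \<omega> n}" "\<omega>2 \<in> Omega N" "\<forall>n<m. \<omega>2 n = \<omega>1 n"
        have "\<omega>2 n = \<omega> n" if "n < m" for n using * that by simp
        then show "\<omega>2 \<in> {\<omega>'\<in>Omega N. \<forall>n<m. \<omega>' n = \<omega> n}" using *(2) by blast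
      qed blast
      moreover have "\<omega> \<in> {\<omega>'\<in>Omega N. \<forall>n<m. \<omega>' n = \<omega> n}" using \<omega>(1) by simp
      ultimately have "\<exists>\<omega>'. \<omega>' \<in> C n \<and> \<omega>' \<in> {\<omega>'\<in>Omega N. \<forall>n<m. \<omega>' n = \<omega> n}"
        by (intro conjunct2[OF iffD1[OF in_closure_of], rule_format] conjI)
      then obtain \<omega>' where \<omega>': "\<omega>' \<in> C n" "\<omega>' \<in> Omega N" "\<forall>n<m. \<omega>' n = \<omega> n"
        by blast
      then have "P (from_nat n) \<omega>'" using \<omega>(3) by blast
      then show False using \<omega>'(1) by (simp add: C_def)
    qed
  qed
  ultimately have "meagre_in (Omega_top N) (Omega N - A)"
    unfolding meagre_in_def by (intro exI[of _ C] conjI allI)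
  then show ?thesis by (simp add: residual_in_def top AN)
qed

section \<open>Attractors\<close>

definition shift :: "(nat \<Rightarrow> 'b) \<Rightarrow> nat \<Rightarrow> 'b" where
  "shift \<omega> = (\<lambda>n. \<omega> (Suc n))"

lemma shift_apply: "shift \<omega> n = \<omega> (Suc n)"
  by (simp add: shift_def)

lemma Omega_shift: "\<omega> \<in> Omega N \<Longrightarrow> shift \<omega> \<in> Omega N"
  by (simp add: Omega_def shift_def)

lemma Omega_apply: "\<omega> \<in> Omega N \<Longrightarrow> \<omega> n \<in> {1..N}"
  by (simp add: Omega_def)

text \<open>\<open>comps\<close> adds new maps on the inside; self-similarity and all inductions
  along \<open>shift\<close> need the outermost map peeled off instead.\<close>

lemma comps_Suc_front:
  "comps S J \<omega> (Suc k) = {S (\<omega> 0) j \<circ> f | j f. j \<in> J (\<omega> 0) \<and> f \<in> comps S J (shift \<omega>) k}"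
proof (induction k)
  case (Suc k)
  have "comps S J \<omega> (Suc (Suc k)) = {f \<circ> S (\<omega> (Suc k)) j | f j. f \<in> comps S J \<omega> (Suc k) \<and> j \<in> J (\<omega> (Suc k))}"
    by (rule comps.simps)
  also have "\<dots> = {S (\<omega> 0) i \<circ> (g \<circ> S (\<omega> (Suc k)) j) | i g j.
      i \<in> J (\<omega> 0) \<and> g \<in> comps S J (shift \<omega>) k \<and> j \<in> J (\<omega> (Suc k))}"
    unfolding Suc.IH by (simp only: comp_assoc[symmetric], blast)
  also have "\<dots> = {S (\<omega> 0) j \<circ> f | j f. j \<in> J (\<omega> 0) \<and> f \<in> comps S J (shift \<omega>) (Suc k)}"
    unfolding comps.simps(2)[of _ _ "shift \<omega>"] shift_apply by blast
  finally show ?case .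
qed auto

text \<open>\<open>rm\<close> and \<open>q\<close> bound all ratios: \<open>q\<close> makes every
  letter contract uniformly, \<open>rm\<close> limits how far a scale can drop in one step.\<close>

locale random_ifs =
  fixes K :: "'a::euclidean_space set" and N :: nat and J :: "nat \<Rightarrow> nat set"
    and S :: "nat \<Rightarrow> nat \<Rightarrow> 'a \<Rightarrow> 'a" and r :: "nat \<Rightarrow> nat \<Rightarrow> real" and rm q :: real
  assumes K: "compact K" "K \<noteq> {}"
    and J: "\<And>i. i \<in> {1..N} \<Longrightarrow> finite (J i) \<and> J i \<noteq> {}"
    and maps: "\<And>i j. i \<in> {1..N} \<Longrightarrow> j \<in> J i \<Longrightarrow> S i j ` K \<subseteq> K"
    and sim: "\<And>i j x y. i \<in> {1..N} \<Longrightarrow> j \<in> J i \<Longrightarrow> x \<in> K \<Longrightarrow> y \<in> K \<Longrightarrow>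
               dist (S i j x) (S i j y) = r i j * dist x y"
    and ratio: "\<And>i j. i \<in> {1..N} \<Longrightarrow> j \<in> J i \<Longrightarrow> rm \<le> r i j \<and> r i j \<le> q"
    and rm: "0 < rm" "rm < 1" and q: "0 < q" "q < 1"
begin

abbreviation F :: "(nat \<Rightarrow> nat) \<Rightarrow> 'a set" where
  "F \<equiv> attractor K S J"

definition level :: "nat \<Rightarrow> (nat \<Rightarrow> nat) \<Rightarrow> 'a set" where
  "level k \<omega> = (\<Union>f\<in>comps S J \<omega> k. f ` K)"

text \<open>The added 1 makes \<open>D\<close> positive and a strict bound for distances, even if
  \<open>K\<close> is a single point.\<close>

definition D :: real where "D = diameter K + 1"

lemma D_pos: "0 < D"
  using diameter_ge_0[OF compact_imp_bounded[OF K(1)]] by (simp add: D_def)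

lemma dist_less_D: "x \<in> K \<Longrightarrow> y \<in> K \<Longrightarrow> dist x y < D"
  using diameter_bounded_bound[OF compact_imp_bounded[OF K(1)]] by (fastforce simp: D_def)

lemma ratio_pos: "i \<in> {1..N} \<Longrightarrow> j \<in> J i \<Longrightarrow> 0 < r i j"
  using ratio rm by fastforce

lemma inj_S:
  assumes "i \<in> {1..N}" "j \<in> J i"
  shows "inj_on (S i j) K"
proof (rule inj_onI)
  fix x y assume "x \<in> K" "y \<in> K" "S i j x = S i j y"
  then have "r i j * dist x y = 0" using sim[OF assms, of x y] by simp
  then show "x = y" using ratio_pos[OF assms] by simp
qed

lemma continuous_S: "i \<in> {1..N} \<Longrightarrow> j \<in> J i \<Longrightarrow> continuous_on K (S i j)"
  by (rule lipschitz_on_continuous_on[of "r i j"], rule lipschitz_onI)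
    (auto simp: sim less_imp_le[OF ratio_pos])

lemma level_0 [simp]: "level 0 \<omega> = K"
  by (simp add: level_def)

lemma level_Suc: "level (Suc k) \<omega> = (\<Union>j\<in>J (\<omega> 0). S (\<omega> 0) j ` level k (shift \<omega>))"
  unfolding level_def comps_Suc_front image_UN image_comp by blast

lemma level_compact: "\<omega> \<in> Omega N \<Longrightarrow> compact (level k \<omega>) \<and> level k \<omega> \<noteq> {} \<and> level k \<omega> \<subseteq> K"
proof (induction k arbitrary: \<omega>)
  case (Suc k)
  note IH = Suc.IH[OF Omega_shift[OF Suc.prems]] and \<omega>0 = Omega_apply[OF Suc.prems, of 0]
  have "compact (S (\<omega> 0) j ` level k (shift \<omega>))" if "j \<in> J (\<omega> 0)" for j
    using IH continuous_S[OF \<omega>0 that] by (intro compact_continuous_image) (auto intro: continuous_on_subset)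
  moreover have "S (\<omega> 0) j ` level k (shift \<omega>) \<subseteq> K" if "j \<in> J (\<omega> 0)" for j
    using IH maps[OF \<omega>0 that] by blast
  ultimately show ?case
    using J[OF \<omega>0] IH unfolding level_Suc by (auto intro!: compact_UN)
qed (use K in auto)

lemma level_Suc_subset: "\<omega> \<in> Omega N \<Longrightarrow> level (Suc k) \<omega> \<subseteq> level k \<omega>"
proof (induction k arbitrary: \<omega>)
  case 0
  then show ?case using level_compact by (metis level_0)
next
  case (Suc k)
  have "level (Suc k) (shift \<omega>) \<subseteq> level k (shift \<omega>)"
    by (rule Suc.IH[OF Omega_shift[OF Suc.prems]])
  then show ?case unfolding level_Suc[of _ \<omega>] by blast
qed

lemma level_antimono: "\<omega> \<in> Omega N \<Longrightarrow> k \<le> l \<Longrightarrow> level l \<omega> \<subseteq> level k \<omega>"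
  by (rule lift_Suc_antimono_le[of "\<lambda>k. level k \<omega>"]) (auto dest: level_Suc_subset)

lemma F_eq_level: "F \<omega> = (\<Inter>k. level k \<omega>)"
  by (simp add: attractor_def level_def)

lemma F_compact: "\<omega> \<in> Omega N \<Longrightarrow> compact (F \<omega>)"
  unfolding F_eq_level by (rule compact_Inter) (use level_compact in auto)

lemma F_nonempty: "\<omega> \<in> Omega N \<Longrightarrow> F \<omega> \<noteq> {}"
  unfolding F_eq_level by (rule compact_nest) (use level_compact level_antimono in auto)

lemma F_subset: "\<omega> \<in> Omega N \<Longrightarrow> F \<omega> \<subseteq> K"
  unfolding F_eq_level using level_0 by blast

lemma F_unfold:
  assumes \<omega>: "\<omega> \<in> Omega N"
  shows "F \<omega> = (\<Union>j\<in>J (\<omega> 0). S (\<omega> 0) j ` F (shift \<omega>))"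
proof
  note \<omega>0 = Omega_apply[OF \<omega>, of 0] and \<omega>' = Omega_shift[OF \<omega>]
  show "(\<Union>j\<in>J (\<omega> 0). S (\<omega> 0) j ` F (shift \<omega>)) \<subseteq> F \<omega>"
  proof
    fix x assume "x \<in> (\<Union>j\<in>J (\<omega> 0). S (\<omega> 0) j ` F (shift \<omega>))"
    then obtain j y where j: "j \<in> J (\<omega> 0)" "x = S (\<omega> 0) j y" "y \<in> F (shift \<omega>)" by blast
    have "x \<in> level (Suc k) \<omega>" for k
      using j unfolding level_Suc F_eq_level by blast
    then show "x \<in> F \<omega>"
      unfolding F_eq_level using level_Suc_subset[OF \<omega>] by blast
  qed
  show "F \<omega> \<subseteq> (\<Union>j\<in>J (\<omega> 0). S (\<omega> 0) j ` F (shift \<omega>))"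
  proof
    fix x assume "x \<in> F \<omega>"
    then have "\<forall>k. \<exists>j. j \<in> J (\<omega> 0) \<and> x \<in> S (\<omega> 0) j ` level k (shift \<omega>)"
      unfolding F_eq_level using level_Suc by blast
    then obtain a where a: "\<And>k. a k \<in> J (\<omega> 0) \<and> x \<in> S (\<omega> 0) (a k) ` level k (shift \<omega>)"
      by metis
    \<comment> \<open>The first map of the address may depend on the level \<open>k\<close>. One
      index occurs for infinitely many \<open>k\<close>, and since levels decrease it then serves
      all of them.\<close>
    have "finite (range a)" using a J[OF \<omega>0] by (auto intro: finite_subset)
    then obtain k0 where k0: "infinite {k. a k = a k0}"
      using pigeonhole_infinite[of UNIV a] by auto
    have j: "a k0 \<in> J (\<omega> 0)" using a by blast
    have in_k: "x \<in> S (\<omega> 0) (a k0) ` level k (shift \<omega>)" for k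
    proof -
      obtain l where "l \<ge> k" "a l = a k0"
        using k0 unfolding infinite_nat_iff_unbounded_le by blast
      then show ?thesis using a[of l] level_antimono[OF \<omega>', of k l] by auto
    qed
    from in_k[of 0] obtain y where y: "y \<in> K" "x = S (\<omega> 0) (a k0) y" by auto
    \<comment> \<open>Injectivity on \<open>K\<close> forces the preimages found at the various
      levels to coincide with \<open>y\<close>.\<close>
    have "y \<in> level k (shift \<omega>)" for k
    proof -
      obtain z where "z \<in> level k (shift \<omega>)" "x = S (\<omega> 0) (a k0) z" using in_k[of k] by auto
      moreover then have "z \<in> K" using level_compact[OF \<omega>'] by blast
      ultimately show ?thesis using y inj_S[OF \<omega>0 j] by (auto dest: inj_onD)
    qed
    then have "y \<in> F (shift \<omega>)" by (simp add: F_eq_level)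
    then show "x \<in> (\<Union>j\<in>J (\<omega> 0). S (\<omega> 0) j ` F (shift \<omega>))" using y j by blast
  qed
qed

lemma sim_F:
  assumes "\<omega> \<in> Omega N" "i \<in> {1..N}" "j \<in> J i" "x \<in> F \<omega>" "y \<in> F \<omega>"
  shows "dist (S i j x) (S i j y) = r i j * dist x y"
  using assms F_subset by (intro sim) auto

text \<open>Both attractors begin with the same map, so points can be matched one letter later; the
  error then contracts by \<open>q\<close> per common letter.\<close>

lemma F_near:
  assumes "\<omega> \<in> Omega N" "\<omega>' \<in> Omega N" "\<forall>n<m. \<omega>' n = \<omega> n" "x \<in> F \<omega>"
  shows "\<exists>y\<in>F \<omega>'. dist x y \<le> q ^ m * D"
  using assms
proof (induction m arbitrary: \<omega> \<omega>' x)
  case 0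
  then obtain y where "y \<in> F \<omega>'" using F_nonempty by blast
  then show ?case using 0 F_subset dist_less_D[of x y] by force
next
  case (Suc m)
  note \<omega>0 = Omega_apply[OF Suc.prems(1), of 0]
  obtain j z where z: "j \<in> J (\<omega> 0)" "x = S (\<omega> 0) j z" "z \<in> F (shift \<omega>)"
    using Suc.prems F_unfold by blast
  have "\<exists>y\<in>F (shift \<omega>'). dist z y \<le> q ^ m * D"
  proof (rule Suc.IH[OF Omega_shift[OF Suc.prems(1)] Omega_shift[OF Suc.prems(2)] _ z(3)])
    show "\<forall>n<m. shift \<omega>' n = shift \<omega> n" using Suc.prems(3) by (simp add: shift_apply)
  qed
  then obtain y where y: "y \<in> F (shift \<omega>')" "dist z y \<le> q ^ m * D" by blast
  have zy: "z \<in> K" "y \<in> K" using y z Suc.prems F_subset Omega_shift by blast+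
  have "dist x (S (\<omega> 0) j y) = r (\<omega> 0) j * dist z y"
    unfolding z by (rule sim[OF \<omega>0 z(1) zy])
  also have "\<dots> \<le> q * (q ^ m * D)"
    using y ratio[OF \<omega>0 z(1)] q by (intro mult_mono) auto
  finally have "dist x (S (\<omega> 0) j y) \<le> q ^ Suc m * D" by (simp add: mult.assoc)
  moreover have "S (\<omega> 0) j y \<in> F \<omega>'"
    unfolding F_unfold[OF Suc.prems(2)] using Suc.prems(3) y z(1) by force
  ultimately show ?case by blast
qed

lemma q_power_D_small:
  assumes "0 < e"
  obtains m where "q ^ m * D < e"
proof -
  obtain m where "q ^ m < e / D"
    using real_arch_pow_inv[of "e / D" q] assms D_pos q by auto
  then show thesis using D_pos by (intro that[of m]) (simp add: pos_less_divide_eq)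
qed

lemma F_subset_open_stable:
  assumes \<omega>: "\<omega> \<in> Omega N" and V: "open V" "F \<omega> \<subseteq> V"
  shows "\<exists>m. \<forall>\<omega>'\<in>Omega N. (\<forall>n<m. \<omega>' n = \<omega> n) \<longrightarrow> F \<omega>' \<subseteq> V"
proof -
  obtain e where e: "0 < e" "(\<Union>x\<in>F \<omega>. ball x e) \<subseteq> V"
    using compact_subset_open_imp_ball_epsilon_subset[OF F_compact[OF \<omega>] V] by blast
  obtain m where m: "q ^ m * D < e" using q_power_D_small[OF e(1)] .
  have "F \<omega>' \<subseteq> V" if \<omega>': "\<omega>' \<in> Omega N" "\<forall>n<m. \<omega>' n = \<omega> n" for \<omega>'
  proof
    fix x assume "x \<in> F \<omega>'"
    moreover have "\<forall>n<m. \<omega> n = \<omega>' n" using \<omega>' by simp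
    ultimately obtain y where "y \<in> F \<omega>" "dist x y \<le> q ^ m * D"
      using F_near[OF \<omega>'(1) \<omega>] by blast
    then have "x \<in> (\<Union>x\<in>F \<omega>. ball x e)" using m by (auto simp: dist_commute intro!: bexI[of _ y])
    then show "x \<in> V" using e by blast
  qed
  then show ?thesis by blast
qed

text \<open>A finite open cover of \<open>F \<omega>\<close> also covers the attractors of all
  sequences that share a long prefix with \<omega>.\<close>

lemma hausdorff_delta_stable:
  assumes \<omega>: "\<omega> \<in> Omega N" and s: "0 \<le> s" and \<delta>: "0 < \<delta>" "hausdorff_measure s (F \<omega>) < t"
  shows "\<exists>m. \<forall>\<omega>'\<in>Omega N. (\<forall>n<m. \<omega>' n = \<omega> n) \<longrightarrow> hausdorff_delta s \<delta> (F \<omega>') < t"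
proof -
  \<comment> \<open>Half the gauge leaves room for passing to open sets.\<close>
  have "hausdorff_delta s (\<delta>/2) (F \<omega>) < t"
    using hausdorff_measure_upper[of "\<delta>/2" s "F \<omega>"] \<delta> by (simp add: order.strict_trans1)
  then obtain I :: "nat set" and V d where I: "finite I" "F \<omega> \<subseteq> (\<Union>i\<in>I. V i)"
    "\<And>i. i \<in> I \<Longrightarrow> open (V i) \<and> bounded (V i) \<and> diameter (V i) \<le> d i \<and> 0 < d i \<and> d i \<le> \<delta>"
    "ennreal (\<Sum>i\<in>I. d i powr s) < t"
    using hausdorff_delta_finite_open_cover[OF s F_compact[OF \<omega>], of "\<delta>/2" t \<delta>] \<delta> by auto
  have "open (\<Union>i\<in>I. V i)" using I(3) by blast
  from F_subset_open_stable[OF \<omega> this I(2)]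
  obtain m where m: "\<And>\<omega>'. \<omega>' \<in> Omega N \<Longrightarrow> \<forall>n<m. \<omega>' n = \<omega> n \<Longrightarrow> F \<omega>' \<subseteq> (\<Union>i\<in>I. V i)" by blast
  have "hausdorff_delta s \<delta> (F \<omega>') < t" if "\<omega>' \<in> Omega N" "\<forall>n<m. \<omega>' n = \<omega> n" for \<omega>'
  proof -
    have "hausdorff_delta s \<delta> (F \<omega>') \<le> ennreal (\<Sum>i\<in>I. d i powr s)"
      by (rule hausdorff_delta_le_finite[OF s I(1) m[OF that]]) (use I(3) \<delta> in auto)
    then show ?thesis using I(4) by simp
  qed
  then show ?thesis by blast
qed

lemma packing_delta_stable:
  assumes \<omega>: "\<omega> \<in> Omega N" and \<delta>: "0 < \<delta>" "t < packing_premeasure s (F \<omega>)"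
  shows "\<exists>m. \<forall>\<omega>'\<in>Omega N. (\<forall>n<m. \<omega>' n = \<omega> n) \<longrightarrow> t < packing_delta s \<delta> (F \<omega>')"
proof -
  have "t < packing_delta s \<delta> (F \<omega>)"
    using packing_premeasure_lower[OF \<delta>(1)] \<delta>(2) by (rule order.strict_trans2[rotated])
  then obtain \<gamma> where \<gamma>: "0 < \<gamma>" "\<And>B. (\<And>x. x \<in> F \<omega> \<Longrightarrow> \<exists>y\<in>B. dist x y < \<gamma>) \<Longrightarrow> t < packing_delta s \<delta> B"
    using packing_delta_lower_semicontinuous by blast
  obtain m where m: "q ^ m * D < \<gamma>" using q_power_D_small[OF \<gamma>(1)] .
  have "t < packing_delta s \<delta> (F \<omega>')" if \<omega>': "\<omega>' \<in> Omega N" "\<forall>n<m. \<omega>' n = \<omega> n" for \<omega>'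
    by (rule \<gamma>(2)) (use F_near[OF \<omega> \<omega>'] m in force)
  then show ?thesis by blast
qed

text \<open>Pulling a packing back along the maps of the first generation increases its separation; once
  the separation exceeds the diameter of \<open>K\<close>, at most one ball is left.\<close>

lemma packing_sum_bound:
  assumes s: "0 \<le> s" and "\<omega> \<in> Omega N" "\<And>n. (\<Sum>j\<in>J (\<omega> n). r (\<omega> n) j powr s) \<le> 1"
    and "packing (D / rm) (F \<omega>) X \<rho>"
    and "\<And>x y. x \<in> X \<Longrightarrow> y \<in> X \<Longrightarrow> x \<noteq> y \<Longrightarrow> D * q ^ n < dist x y"
  shows "(\<Sum>x\<in>X. (2 * \<rho> x) powr s) \<le> (2 * D / rm) powr s"
  using assms(2-)
proof (induction n arbitrary: \<omega> X \<rho>)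
  have single: "(\<Sum>x\<in>X. (2 * \<rho> x) powr s) \<le> (2 * D / rm) powr s"
    if X: "packing (D / rm) (F \<omega>) X \<rho>" "\<And>x y. x \<in> X \<Longrightarrow> y \<in> X \<Longrightarrow> x = y" for X \<rho> \<omega>
  proof (cases "X = {}")
    case False
    then obtain x where x: "X = {x}" using X(2) by blast
    have "0 < \<rho> x" "\<rho> x \<le> D / rm" using X(1) x by (auto simp: packing_def)
    then have "2 * \<rho> x \<le> 2 * D / rm" "0 \<le> 2 * \<rho> x" by auto
    then have "(2 * \<rho> x) powr s \<le> (2 * D / rm) powr s" by (intro powr_mono2 s)
    then show ?thesis by (simp add: x)
  qed simp
  {
    case 0
    have "x = y" if "x \<in> X" "y \<in> X" for x y
    proof (rule ccontr)
      assume "x \<noteq> y"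
      moreover have "x \<in> K" "y \<in> K" using that 0(3) F_subset[OF 0(1)] unfolding packing_def by blast+
      ultimately show False using 0(4)[OF that] dist_less_D[of x y] by simp
    qed
    with single[OF 0(3)] show ?case by blast
  next
    case (Suc n)
    note \<omega>0 = Omega_apply[OF Suc.prems(1), of 0] and \<omega>' = Omega_shift[OF Suc.prems(1)] and X = Suc.prems(3)
    show ?case
    proof (cases "\<forall>x\<in>X. \<forall>y\<in>X. x = y")
      case True
      with single[OF X] show ?thesis by blast
    next
      case False
      have XF: "X \<subseteq> F \<omega>" and finX: "finite X" using X by (auto simp: packing_def)
      have pos: "0 < \<rho> x" if "x \<in> X" for x using X that by (auto simp: packing_def)
      \<comment> \<open>The gauge \<open>D / rm\<close> reproduces itself: two centres in
        \<open>K\<close> force radii below \<open>D\<close>, and division by a ratio at least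
        \<open>rm\<close> brings them back below \<open>D / rm\<close>.\<close>
      have small: "\<rho> x \<le> D" if "x \<in> X" for x
      proof -
        obtain y where y: "y \<in> X" "y \<noteq> x" using False by metis
        then have "\<rho> x + \<rho> y < dist x y" using X that by (auto simp: packing_def)
        moreover have "dist x y < D"
          using that y XF F_subset[OF Suc.prems(1)] by (intro dist_less_D) auto
        ultimately show ?thesis using pos[OF y(1)] by simp
      qed
      have "\<forall>x\<in>X. \<exists>j y. j \<in> J (\<omega> 0) \<and> y \<in> F (shift \<omega>) \<and> x = S (\<omega> 0) j y"
        using XF unfolding F_unfold[OF Suc.prems(1)] by blast
      then obtain a b where ab: "\<And>x. x \<in> X \<Longrightarrow> a x \<in> J (\<omega> 0) \<and> b x \<in> F (shift \<omega>) \<and> x = S (\<omega> 0) (a x) (b x)"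
        by metis
      \<comment> \<open>The centres assigned to the \<open>j\<close>-th copy are pulled back to a
        packing of \<open>F (shift \<omega>)\<close>. Its distances grow by at least
        \<open>1 / q\<close>, which lowers the separation exponent \<open>n\<close> by one; its sum
        changes by \<open>r powr s\<close>.\<close>
      have part: "(\<Sum>x\<in>{x\<in>X. a x = j}. (2 * \<rho> x) powr s) \<le> r (\<omega> 0) j powr s * (2 * D / rm) powr s"
        if j: "j \<in> J (\<omega> 0)" for j
      proof -
        let ?c = "r (\<omega> 0) j" and ?f = "S (\<omega> 0) j"
        note c = ratio_pos[OF \<omega>0 j]
        define Y where "Y = b ` {x\<in>X. a x = j}"
        have fY: "?f y \<in> X \<and> a (?f y) = j \<and> b (?f y) = y" if "y \<in> Y" for y
          using that ab by (auto simp: Y_def)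
        have YF: "Y \<subseteq> F (shift \<omega>)" using ab by (auto simp: Y_def)
        have inj: "inj_on b {x\<in>X. a x = j}"
          by (rule inj_onI) (metis (mono_tags, lifting) ab mem_Collect_eq)
        have dY: "dist (?f y) (?f z) = ?c * dist y z" if "y \<in> Y" "z \<in> Y" for y z
          using that YF by (intro sim_F[OF \<omega>' \<omega>0 j]) auto
        have ne: "?f y \<noteq> ?f z" if "y \<in> Y" "z \<in> Y" "y \<noteq> z" for y z
          using fY that by metis
        have "(\<Sum>y\<in>Y. (2 * (\<rho> (?f y) / ?c)) powr s) \<le> (2 * D / rm) powr s"
        proof (rule Suc.IH[OF \<omega>'])
          show "(\<Sum>j\<in>J (shift \<omega> n). r (shift \<omega> n) j powr s) \<le> 1" for n
            using Suc.prems(2)[of "Suc n"] by (simp add: shift_apply)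
          show "packing (D / rm) (F (shift \<omega>)) Y (\<lambda>y. \<rho> (?f y) / ?c)"
            unfolding packing_def
          proof (intro conjI ballI impI)
            show "finite Y" "Y \<subseteq> F (shift \<omega>)" using finX YF by (auto simp: Y_def)
            show "0 < \<rho> (?f y) / ?c" if "y \<in> Y" for y using fY[OF that] pos c by simp
            show "\<rho> (?f y) / ?c \<le> D / rm" if "y \<in> Y" for y
              using fY[OF that] small ratio[OF \<omega>0 j] rm D_pos by (intro frac_le) auto
            show "\<rho> (?f y) / ?c + \<rho> (?f z) / ?c < dist y z" if yz: "y \<in> Y" "z \<in> Y" "y \<noteq> z" for y z
            proof -
              have "\<rho> (?f y) + \<rho> (?f z) < ?c * dist y z"
                using X fY[OF yz(1)] fY[OF yz(2)] ne[OF yz] dY[OF yz(1,2)] unfolding packing_def by metis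
              then show ?thesis using c by (simp add: add_divide_distrib[symmetric] pos_divide_less_eq mult.commute)
            qed
          qed
          show "D * q ^ n < dist y z" if yz: "y \<in> Y" "z \<in> Y" "y \<noteq> z" for y z
          proof -
            have "D * q ^ Suc n < ?c * dist y z"
              using Suc.prems(4) fY[OF yz(1)] fY[OF yz(2)] ne[OF yz] dY[OF yz(1,2)] by metis
            also have "\<dots> \<le> q * dist y z"
              using ratio[OF \<omega>0 j] by (intro mult_right_mono) auto
            finally show ?thesis using q by (simp add: mult.left_commute)
          qed
        qed
        moreover have "(2 * \<rho> (?f y)) powr s = ?c powr s * (2 * (\<rho> (?f y) / ?c)) powr s" for y
          using c by (simp add: powr_mult[symmetric])
        ultimately have "(\<Sum>y\<in>Y. (2 * \<rho> (?f y)) powr s) \<le> ?c powr s * (2 * D / rm) powr s"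
          by (simp add: sum_distrib_left[symmetric] mult_left_mono)
        also have "(\<Sum>y\<in>Y. (2 * \<rho> (?f y)) powr s) = (\<Sum>x\<in>{x\<in>X. a x = j}. (2 * \<rho> x) powr s)"
          unfolding Y_def using ab by (subst sum.reindex[OF inj]) (auto intro!: sum.cong)
        finally show ?thesis .
      qed
      have "(\<Sum>x\<in>X. (2 * \<rho> x) powr s) = (\<Sum>j\<in>J (\<omega> 0). \<Sum>x\<in>{x\<in>X. a x = j}. (2 * \<rho> x) powr s)"
        by (rule sum.group[symmetric]) (use finX J[OF \<omega>0] ab in auto)
      also have "\<dots> \<le> (\<Sum>j\<in>J (\<omega> 0). r (\<omega> 0) j powr s * (2 * D / rm) powr s)"
        by (rule sum_mono[OF part])
      also have "\<dots> = (\<Sum>j\<in>J (\<omega> 0). r (\<omega> 0) j powr s) * (2 * D / rm) powr s"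
        by (simp add: sum_distrib_right)
      \<comment> \<open>The weights sum to at most 1, so the bound does not deteriorate with the
        depth of the recursion.\<close>
      also have "\<dots> \<le> 1 * (2 * D / rm) powr s"
        by (intro mult_right_mono Suc.prems(2)) auto
      finally show ?thesis by simp
    qed
  }
qed

text \<open>The premeasure is an infimum over gauges, so the single coarse gauge
  \<open>D / rm\<close> suffices. A finite packing has a positive minimal separation, which exceeds
  \<open>D * q ^ n\<close> for some \<open>n\<close>, and the bound is independent of
  \<open>n\<close>.\<close>

lemma packing_premeasure_bound:
  assumes s: "0 \<le> s" and \<omega>: "\<omega> \<in> Omega N" "\<And>n. (\<Sum>j\<in>J (\<omega> n). r (\<omega> n) j powr s) \<le> 1"
  shows "packing_premeasure s (F \<omega>) \<le> ennreal ((2 * D / rm) powr s)"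
proof -
  have "packing_premeasure s (F \<omega>) \<le> packing_delta s (D / rm) (F \<omega>)"
    using D_pos rm by (intro packing_premeasure_lower) simp
  also have "\<dots> \<le> ennreal ((2 * D / rm) powr s)"
  proof (rule packing_delta_le, rule ennreal_leI)
    fix X \<rho> assume X: "packing (D / rm) (F \<omega>) X \<rho>"
    define P where "P = {(x, y). x \<in> X \<and> y \<in> X \<and> x \<noteq> y}"
    define e where "e = Min (insert 1 ((\<lambda>(x, y). dist x y) ` P))"
    have "finite P" by (rule finite_subset[of _ "X \<times> X"]) (use X in \<open>auto simp: P_def packing_def\<close>)
    then have e: "e \<le> dist x y" if "(x, y) \<in> P" for x y
      unfolding e_def using that by (intro Min_le) force+
    have "0 < e"
      unfolding e_def using \<open>finite P\<close> by (subst Min_gr_iff) (auto simp: P_def)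
    then obtain n where "q ^ n * D < e" by (rule q_power_D_small)
    then have "D * q ^ n < dist x y" if "x \<in> X" "y \<in> X" "x \<noteq> y" for x y
      using e[of x y] that by (simp add: P_def mult.commute)
    then show "(\<Sum>x\<in>X. (2 * \<rho> x) powr s) \<le> (2 * D / rm) powr s"
      by (intro packing_sum_bound[OF s \<omega> X])
  qed
  finally show ?thesis .
qed

end

section \<open>Images of balls and volume counting\<close>

text \<open>The image of an open ball is open by invariance of domain, that of a slightly smaller
  closed ball is compact. The target ball is connected and misses the image of the sphere, so it
  cannot leave the image.\<close>

lemma ball_subset_similarity_image:
  fixes f :: "'a::euclidean_space \<Rightarrow> 'a"
  assumes c: "0 < c" and f: "\<And>u v. u \<in> ball x e \<Longrightarrow> v \<in> ball x e \<Longrightarrow> dist (f u) (f v) = c * dist u v"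
  shows "ball (f x) (c * e) \<subseteq> f ` ball x e"
proof
  fix y assume "y \<in> ball (f x) (c * e)"
  then have "dist (f x) y / c < e" using c by (simp add: pos_divide_less_eq mult.commute)
  then obtain t where t: "dist (f x) y / c < t" "t < e" using dense by blast
  have t0: "0 < t" using t(1) c by (meson divide_nonneg_pos order_le_less_trans zero_le_dist)
  have sub: "cball x t \<subseteq> ball x e" using t by auto
  have sub': "ball x t \<subseteq> ball x e" using t by auto
  have inj: "inj_on f (ball x e)"
    using f c by (intro inj_onI) (metis dist_eq_0_iff less_irrefl mult_eq_0_iff)
  have cont: "continuous_on (ball x e) f"
    by (rule lipschitz_on_continuous_on[of c], rule lipschitz_onI) (use f c in auto)
  have op: "open (f ` ball x t)"
    by (rule invariance_of_domain[OF continuous_on_subset[OF cont sub'] open_ball inj_on_subset[OF inj sub']])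
  have "compact (f ` cball x t)"
    by (rule compact_continuous_image[OF continuous_on_subset[OF cont sub]]) simp
  then have cl: "open (- f ` cball x t)" by (simp add: compact_imp_closed open_Compl)
  have xe: "x \<in> ball x e" using t0 t by simp
  \<comment> \<open>Distances to \<open>f x\<close> are scaled exactly, so a point of the target
    ball in the image of the closed ball comes from the open one.\<close>
  have cover: "ball (f x) (c * t) \<subseteq> f ` ball x t \<union> - f ` cball x t"
  proof
    fix z assume z: "z \<in> ball (f x) (c * t)"
    show "z \<in> f ` ball x t \<union> - f ` cball x t"
    proof (cases "z \<in> f ` cball x t")
      case True
      then obtain u where u: "u \<in> cball x t" "z = f u" by blast
      then have "c * dist x u < c * t" using z f[OF xe, of u] sub by auto
      then show ?thesis using u c by auto
    qed simp
  qed
  have disj: "f ` ball x t \<inter> - f ` cball x t \<inter> ball (f x) (c * t) = {}" by auto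
  have "f ` ball x t \<inter> ball (f x) (c * t) = {} \<or> - f ` cball x t \<inter> ball (f x) (c * t) = {}"
    by (rule connectedD[OF connected_ball op cl disj cover])
  moreover have "f x \<in> f ` ball x t \<inter> ball (f x) (c * t)" using t0 c by auto
  ultimately have "ball (f x) (c * t) \<subseteq> f ` cball x t" by blast
  moreover have "y \<in> ball (f x) (c * t)" using t(1) c by (simp add: pos_divide_less_eq mult.commute)
  ultimately show "y \<in> f ` ball x e" using sub by blast
qed

text \<open>The disjoint balls all lie in \<open>ball z (a + b)\<close>; comparing Lebesgue
  measures, the volume of the unit ball cancels.\<close>

lemma card_disjoint_balls_le:
  fixes X :: "'a::euclidean_space set"
  assumes X: "finite X" and a: "0 < a" and b: "0 \<le> b" and near: "\<And>x. x \<in> X \<Longrightarrow> dist z x \<le> b"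
    and disj: "\<And>x y. x \<in> X \<Longrightarrow> y \<in> X \<Longrightarrow> x \<noteq> y \<Longrightarrow> ball x a \<inter> ball y a = {}"
  shows "real (card X) * a ^ DIM('a) \<le> (a + b) ^ DIM('a)"
proof -
  have "(\<Sum>x\<in>X. measure lborel (ball x a)) = measure lborel (\<Union>x\<in>X. ball x a)"
  proof (rule measure_finite_Union[symmetric])
    show "emeasure lborel (ball x a) \<noteq> \<infinity>" for x :: 'a
      using emeasure_lborel_ball_finite[of x a] by simp
  qed (use X disj in \<open>auto simp: disjoint_family_on_def\<close>)
  also have "\<dots> \<le> measure lborel (ball z (a + b))"
  proof (rule measure_mono_fmeasurable)
    show "(\<Union>x\<in>X. ball x a) \<subseteq> ball z (a + b)"
    proof
      fix y assume "y \<in> (\<Union>x\<in>X. ball x a)"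
      then obtain x where "x \<in> X" "dist x y < a" by auto
      then show "y \<in> ball z (a + b)" using near[of x] dist_triangle[of z y x] by simp
    qed
    show "(\<Union>x\<in>X. ball x a) \<in> sets lborel" by (simp add: borel_open open_UN)
    show "ball z (a + b) \<in> fmeasurable lborel"
      using emeasure_lborel_ball_finite[of z "a + b"] by (intro fmeasurableI) simp_all
  qed
  finally show ?thesis
    using a b by (simp add: content_ball)
qed

section \<open>Moran sums, natural masses and self-similarity of the measures\<close>

context random_ifs
begin

text \<open>The Moran sum of the \<open>i\<close>-th system; it is strictly decreasing in
  \<open>s\<close> and equals 1 at the similarity dimension of that system.\<close>

definition gsum :: "real \<Rightarrow> nat \<Rightarrow> real" where
  "gsum s i = (\<Sum>j\<in>J i. r i j powr s)"

lemma gsum_pos: "i \<in> {1..N} \<Longrightarrow> 0 < gsum s i"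
  unfolding gsum_def using J ratio_pos by (intro sum_pos) fastforce+

text \<open>\<open>nu s k \<omega> V\<close> is the mass of those cylinders of generation \<open>k\<close> that meet \<open>V\<close>, for the natural
  probability measure with weights \<open>r i j powr s / gsum s i\<close>.\<close>

primrec nu :: "real \<Rightarrow> nat \<Rightarrow> (nat \<Rightarrow> nat) \<Rightarrow> 'a set \<Rightarrow> real" where
  "nu s 0 \<omega> V = (if V \<inter> K = {} then 0 else 1)"
| "nu s (Suc k) \<omega> V =
    (\<Sum>j\<in>J (\<omega> 0). r (\<omega> 0) j powr s * nu s k (shift \<omega>) {y\<in>K. S (\<omega> 0) j y \<in> V}) / gsum s (\<omega> 0)"

lemma nu_bounds: "\<omega> \<in> Omega N \<Longrightarrow> 0 \<le> nu s k \<omega> V \<and> nu s k \<omega> V \<le> 1"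
proof (induction k arbitrary: \<omega> V)
  case (Suc k)
  note IH = Suc.IH[OF Omega_shift[OF Suc.prems]] and g = gsum_pos[OF Omega_apply[OF Suc.prems, of 0], of s]
  have "(\<Sum>j\<in>J (\<omega> 0). r (\<omega> 0) j powr s * nu s k (shift \<omega>) {y\<in>K. S (\<omega> 0) j y \<in> V})
      \<le> (\<Sum>j\<in>J (\<omega> 0). r (\<omega> 0) j powr s * 1)"
    using IH by (intro sum_mono mult_left_mono) auto
  also have "\<dots> = gsum s (\<omega> 0)" by (simp add: gsum_def)
  finally show ?case using IH g by (auto intro!: divide_nonneg_pos sum_nonneg)
qed auto

lemma nu_eq_0: "\<omega> \<in> Omega N \<Longrightarrow> V \<inter> K = {} \<Longrightarrow> nu s k \<omega> V = 0"
proof (induction k arbitrary: \<omega> V)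
  case (Suc k)
  have "nu s k (shift \<omega>) {y\<in>K. S (\<omega> 0) j y \<in> V} = 0" if "j \<in> J (\<omega> 0)" for j
    by (rule Suc.IH[OF Omega_shift[OF Suc.prems(1)]])
      (use Suc.prems(2) maps[OF Omega_apply[OF Suc.prems(1)] that] in blast)
  then show ?case by simp
qed auto

text \<open>Each cylinder contains points of \<open>F \<omega>\<close>, hence meets some
  \<open>V i\<close>. This is the covering half of the mass distribution principle, at a finite
  generation, so no limit measure has to be constructed.\<close>

lemma nu_cover:
  assumes "\<omega> \<in> Omega N" "finite I" "F \<omega> \<subseteq> (\<Union>i\<in>I. V i)"
  shows "1 \<le> (\<Sum>i\<in>I. nu s k \<omega> (V i))"
  using assms
proof (induction k arbitrary: \<omega> V)
  case 0
  obtain x where x: "x \<in> F \<omega>" using F_nonempty 0 by blast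
  then obtain i where i: "i \<in> I" "x \<in> V i" using 0 by blast
  have "x \<in> K" using F_subset[OF 0(1)] x by blast
  then have "nu s 0 \<omega> (V i) = 1" using i by auto
  moreover have "nu s 0 \<omega> (V i) \<le> (\<Sum>i\<in>I. nu s 0 \<omega> (V i))"
    using i 0 by (intro member_le_sum) auto
  ultimately show ?case by linarith
next
  case (Suc k)
  note \<omega>' = Omega_shift[OF Suc.prems(1)] and g = gsum_pos[OF Omega_apply[OF Suc.prems(1), of 0], of s]
  let ?n = "\<lambda>i j. nu s k (shift \<omega>) {y\<in>K. S (\<omega> 0) j y \<in> V i}"
  have le: "1 \<le> (\<Sum>i\<in>I. ?n i j)" if j: "j \<in> J (\<omega> 0)" for j
  proof (rule Suc.IH[OF \<omega>' Suc.prems(2)])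
    show "F (shift \<omega>) \<subseteq> (\<Union>i\<in>I. {y\<in>K. S (\<omega> 0) j y \<in> V i})"
    proof
      fix y assume y: "y \<in> F (shift \<omega>)"
      then have "S (\<omega> 0) j y \<in> F \<omega>" unfolding F_unfold[OF Suc.prems(1)] using j by blast
      then obtain i where "i \<in> I" "S (\<omega> 0) j y \<in> V i" using Suc.prems(3) by blast
      moreover have "y \<in> K" using subsetD[OF F_subset[OF \<omega>'] y] .
      ultimately show "y \<in> (\<Union>i\<in>I. {y\<in>K. S (\<omega> 0) j y \<in> V i})" by (intro UN_I CollectI conjI)
    qed
  qed
  have "gsum s (\<omega> 0) = (\<Sum>j\<in>J (\<omega> 0). r (\<omega> 0) j powr s * 1)"
    by (simp add: gsum_def)
  also have "\<dots> \<le> (\<Sum>j\<in>J (\<omega> 0). r (\<omega> 0) j powr s * (\<Sum>i\<in>I. ?n i j))"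
    by (intro sum_mono mult_left_mono le) simp_all
  also have "\<dots> = (\<Sum>j\<in>J (\<omega> 0). \<Sum>i\<in>I. r (\<omega> 0) j powr s * ?n i j)"
    by (simp add: sum_distrib_left)
  also have "\<dots> = (\<Sum>i\<in>I. \<Sum>j\<in>J (\<omega> 0). r (\<omega> 0) j powr s * ?n i j)"
    by (rule sum.swap)
  finally have "gsum s (\<omega> 0) \<le> \<dots>" .
  then have "1 \<le> (\<Sum>i\<in>I. \<Sum>j\<in>J (\<omega> 0). r (\<omega> 0) j powr s * ?n i j) / gsum s (\<omega> 0)"
    using g by (simp add: pos_le_divide_eq)
  also have "\<dots> = (\<Sum>i\<in>I. nu s (Suc k) \<omega> (V i))"
    by (simp add: sum_divide_distrib)
  finally show ?case .
qed

text \<open>Subadditivity and scaling alone give this, so it serves Hausdorff measure, packing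
  premeasure and packing measure alike.\<close>

lemma self_similar_le:
  fixes \<mu> :: "'a set \<Rightarrow> ennreal"
  assumes \<omega>: "\<omega> \<in> Omega N" and "\<mu> {} = 0" "\<And>A B. \<mu> (A \<union> B) \<le> \<mu> A + \<mu> B"
    and "\<And>c f A. 0 < c \<Longrightarrow> (\<And>x y. x \<in> A \<Longrightarrow> y \<in> A \<Longrightarrow> dist (f x) (f y) = c * dist x y) \<Longrightarrow>
      \<mu> (f ` A) \<le> ennreal (c powr s) * \<mu> A"
  shows "\<mu> (F \<omega>) \<le> ennreal (gsum s (\<omega> 0)) * \<mu> (F (shift \<omega>))"
proof -
  note \<omega>0 = Omega_apply[OF \<omega>, of 0] and \<omega>' = Omega_shift[OF \<omega>]
  have "\<mu> (F \<omega>) \<le> (\<Sum>j\<in>J (\<omega> 0). \<mu> (S (\<omega> 0) j ` F (shift \<omega>)))"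
    unfolding F_unfold[OF \<omega>] by (rule subadditive_UN_le) (use assms J[OF \<omega>0] in auto)
  also have "\<dots> \<le> (\<Sum>j\<in>J (\<omega> 0). ennreal (r (\<omega> 0) j powr s) * \<mu> (F (shift \<omega>)))"
    by (intro sum_mono assms(4) ratio_pos \<omega>0 sim_F[OF \<omega>'])
  also have "\<dots> = ennreal (gsum s (\<omega> 0)) * \<mu> (F (shift \<omega>))"
    by (simp add: gsum_def sum_distrib_right[symmetric])
  finally show ?thesis .
qed

lemma hausdorff_measure_F_le:
  assumes "\<omega> \<in> Omega N" "0 \<le> s"
  shows "hausdorff_measure s (F \<omega>) \<le> ennreal (gsum s (\<omega> 0)) * hausdorff_measure s (F (shift \<omega>))"
  by (rule self_similar_le[where \<mu> = "hausdorff_measure s", OF assms(1)])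
    (simp_all add: hausdorff_measure_Un_le hausdorff_measure_similarity[OF assms(2)])

lemma packing_premeasure_F_le:
  assumes "\<omega> \<in> Omega N"
  shows "packing_premeasure s (F \<omega>) \<le> ennreal (gsum s (\<omega> 0)) * packing_premeasure s (F (shift \<omega>))"
  by (rule self_similar_le[where \<mu> = "packing_premeasure s", OF assms])
    (simp_all add: packing_premeasure_Un_le packing_premeasure_similarity)

lemma packing_measure_F_le:
  assumes "\<omega> \<in> Omega N"
  shows "packing_measure s (F \<omega>) \<le> ennreal (gsum s (\<omega> 0)) * packing_measure s (F (shift \<omega>))"
  by (rule self_similar_le[where \<mu> = "packing_measure s", OF assms])
    (simp_all add: packing_measure_Un_le packing_measure_similarity)

text \<open>The first-generation copies overlap in null sets, so the measure is additive over them,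
  and their scaling factors sum to 1. It is this invariance that lets any finite word precede a
  near-extremal sequence.\<close>

lemma measure_F_shift:
  fixes \<mu> :: "real \<Rightarrow> 'a set \<Rightarrow> ennreal"
  assumes \<omega>: "\<omega> \<in> Omega N" and s: "0 \<le> s" and g: "\<And>i. i \<in> {1..N} \<Longrightarrow> gsum s i = 1"
    and sep: "\<And>\<omega> l i j. \<omega> \<in> Omega N \<Longrightarrow> l \<in> {1..N} \<Longrightarrow> i \<in> J l \<Longrightarrow> j \<in> J l \<Longrightarrow> i \<noteq> j \<Longrightarrow>
               packing_measure s (S l i ` F \<omega> \<inter> S l j ` F \<omega>) = 0"
    and add: "\<And>I A. finite I \<Longrightarrow> (\<And>i::nat. i \<in> I \<Longrightarrow> compact (A i)) \<Longrightarrow> packing_premeasure s (\<Union>i\<in>I. A i) < top \<Longrightarrow>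
      (\<And>i j. i \<in> I \<Longrightarrow> j \<in> I \<Longrightarrow> i \<noteq> j \<Longrightarrow> packing_measure s (A i \<inter> A j) = 0) \<Longrightarrow>
      \<mu> s (\<Union>i\<in>I. A i) = (\<Sum>i\<in>I. \<mu> s (A i))"
    and sim: "\<And>c f A. 0 < c \<Longrightarrow> (\<And>x y. x \<in> A \<Longrightarrow> y \<in> A \<Longrightarrow> dist (f x) (f y) = c * dist x y) \<Longrightarrow>
      \<mu> s (f ` A) = ennreal (c powr s) * \<mu> s A"
  shows "\<mu> s (F \<omega>) = \<mu> s (F (shift \<omega>))"
proof -
  note \<omega>0 = Omega_apply[OF \<omega>, of 0] and \<omega>' = Omega_shift[OF \<omega>]
  have "\<mu> s (F \<omega>) = (\<Sum>j\<in>J (\<omega> 0). \<mu> s (S (\<omega> 0) j ` F (shift \<omega>)))"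
    unfolding F_unfold[OF \<omega>]
  proof (rule add)
    show "compact (S (\<omega> 0) j ` F (shift \<omega>))" if "j \<in> J (\<omega> 0)" for j
      by (rule compact_continuous_image[OF continuous_on_subset[OF continuous_S[OF \<omega>0 that] F_subset[OF \<omega>']] F_compact[OF \<omega>']])
    have "packing_premeasure s (F \<omega>) \<le> ennreal ((2 * D / rm) powr s)"
      using g Omega_apply[OF \<omega>] by (intro packing_premeasure_bound[OF s \<omega>]) (simp add: gsum_def)
    then show "packing_premeasure s (\<Union>j\<in>J (\<omega> 0). S (\<omega> 0) j ` F (shift \<omega>)) < top"
      unfolding F_unfold[OF \<omega>, symmetric] by (rule order.strict_trans1) simp
  qed (use J[OF \<omega>0] sep[OF \<omega>' \<omega>0] in auto)
  also have "\<dots> = (\<Sum>j\<in>J (\<omega> 0). ennreal (r (\<omega> 0) j powr s) * \<mu> s (F (shift \<omega>)))"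
    by (intro sum.cong refl sim ratio_pos[OF \<omega>0] sim_F[OF \<omega>' \<omega>0])
  also have "\<dots> = ennreal (gsum s (\<omega> 0)) * \<mu> s (F (shift \<omega>))"
    by (simp add: gsum_def sum_distrib_right[symmetric])
  finally show ?thesis using g[OF \<omega>0] by simp
qed

lemma Omega_funpow_shift: "\<omega> \<in> Omega N \<Longrightarrow> (shift ^^ k) \<omega> \<in> Omega N"
  by (induction k) (auto intro: Omega_shift)

text \<open>Iterating \<open>F_unfold\<close> along an address of \<open>x\<close>. It carries
  properties of the tail attractor into arbitrarily small neighbourhoods of every point.\<close>

lemma local_copy:
  assumes "\<omega> \<in> Omega N" "x \<in> F \<omega>"
  shows "\<exists>g c. 0 < c \<and> c \<le> q ^ k \<and> g ` F ((shift ^^ k) \<omega>) \<subseteq> F \<omega> \<and> x \<in> g ` F ((shift ^^ k) \<omega>) \<and>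
    (\<forall>y\<in>F ((shift ^^ k) \<omega>). \<forall>z\<in>F ((shift ^^ k) \<omega>). dist (g y) (g z) = c * dist y z)"
  using assms
proof (induction k arbitrary: \<omega> x)
  case 0
  then show ?case by (intro exI[of _ id] exI[of _ 1]) auto
next
  case (Suc k)
  note \<omega>0 = Omega_apply[OF Suc.prems(1), of 0] and \<omega>' = Omega_shift[OF Suc.prems(1)]
  have eq: "(shift ^^ Suc k) \<omega> = (shift ^^ k) (shift \<omega>)" by (simp add: funpow_swap1)
  obtain j y where j: "j \<in> J (\<omega> 0)" "y \<in> F (shift \<omega>)" "x = S (\<omega> 0) j y"
    using Suc.prems(2) unfolding F_unfold[OF Suc.prems(1)] by blast
  obtain g c where g: "0 < c" "c \<le> q ^ k" "g ` F ((shift ^^ k) (shift \<omega>)) \<subseteq> F (shift \<omega>)"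
    "y \<in> g ` F ((shift ^^ k) (shift \<omega>))"
    "\<And>y z. y \<in> F ((shift ^^ k) (shift \<omega>)) \<Longrightarrow> z \<in> F ((shift ^^ k) (shift \<omega>)) \<Longrightarrow> dist (g y) (g z) = c * dist y z"
    using Suc.IH[OF \<omega>' j(2)] by blast
  have "dist (S (\<omega> 0) j (g u)) (S (\<omega> 0) j (g v)) = r (\<omega> 0) j * c * dist u v"
    if "u \<in> F ((shift ^^ k) (shift \<omega>))" "v \<in> F ((shift ^^ k) (shift \<omega>))" for u v
  proof -
    have "g u \<in> F (shift \<omega>)" "g v \<in> F (shift \<omega>)" using g(3) that by blast+
    then show ?thesis using sim_F[OF \<omega>' \<omega>0 j(1)] g(5)[OF that] by simp
  qed
  moreover have "0 < r (\<omega> 0) j * c" using ratio_pos[OF \<omega>0 j(1)] g by simp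
  moreover have "r (\<omega> 0) j * c \<le> q ^ Suc k"
    using ratio[OF \<omega>0 j(1)] g(1,2) q by (auto intro!: mult_mono)
  moreover have "(S (\<omega> 0) j \<circ> g) ` F ((shift ^^ k) (shift \<omega>)) \<subseteq> F \<omega>"
    unfolding F_unfold[OF Suc.prems(1)] using g(3) j(1) by auto
  moreover have "x \<in> (S (\<omega> 0) j \<circ> g) ` F ((shift ^^ k) (shift \<omega>))"
    using g(4) j(3) by auto
  ultimately show ?case
    unfolding eq by (intro exI[of _ "S (\<omega> 0) j \<circ> g"] exI[of _ "r (\<omega> 0) j * c"]) auto
qed

end

section \<open>The open set condition and the Hausdorff lower bound\<close>

locale random_ifs_osc = random_ifs +
  fixes U
  assumes U: "open U" "U \<noteq> {}" "U \<subseteq> K"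
    and SU: "\<And>i j. i \<in> {1..N} \<Longrightarrow> j \<in> J i \<Longrightarrow> S i j ` U \<subseteq> U"
    and SU_disjoint: "\<And>i j j'. i \<in> {1..N} \<Longrightarrow> j \<in> J i \<Longrightarrow> j' \<in> J i \<Longrightarrow> j \<noteq> j' \<Longrightarrow> S i j ` U \<inter> S i j' ` U = {}"
begin

text \<open>The disjoint balls in \<open>U\<close> count the cylinders of size about \<open>d\<close> near \<open>V\<close>.\<close>

lemma nu_le_card:
  assumes s: "0 \<le> s" and a: "0 < a" "ball x0 a \<subseteq> U"
    and "\<omega> \<in> Omega N" "\<And>n. 1 \<le> gsum s (\<omega> n)" "0 < d" "d \<le> 1" "q ^ k \<le> d" "d \<le> rm ^ l"
  shows "\<exists>X. finite X \<and> (\<forall>x\<in>X. ball x (a * d) \<subseteq> U \<and> (\<exists>v\<in>V. dist v x \<le> D / rm * d)) \<and>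
    (\<forall>x\<in>X. \<forall>y\<in>X. x \<noteq> y \<longrightarrow> ball x (a * d) \<inter> ball y (a * d) = {}) \<and>
    nu s k \<omega> V * (\<Prod>i<l. gsum s (\<omega> i)) \<le> (d / rm) powr s * card X"
  using assms(4-)
proof (induction k arbitrary: \<omega> V d l)
  \<comment> \<open>The stopping case, at scale above \<open>rm\<close>: the whole remaining system
    counts as one cylinder, represented by the ball at \<open>x0\<close>. Its mass is at most 1, and
    \<open>(d / rm) powr s\<close> is at least 1.\<close>
  have base: "\<exists>X. finite X \<and> (\<forall>x\<in>X. ball x (a * d) \<subseteq> U \<and> (\<exists>v\<in>V. dist v x \<le> D / rm * d)) \<and>
    (\<forall>x\<in>X. \<forall>y\<in>X. x \<noteq> y \<longrightarrow> ball x (a * d) \<inter> ball y (a * d) = {}) \<and>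
    nu s k \<omega> V * (\<Prod>i<l. gsum s (\<omega> i)) \<le> (d / rm) powr s * card X"
    if \<omega>: "\<omega> \<in> Omega N" and d: "rm < d" "d \<le> 1" "d \<le> rm ^ l" for \<omega> V d l k
  proof (cases "V \<inter> K = {}")
    case True
    then show ?thesis using nu_eq_0[OF \<omega> True] by (intro exI[of _ "{}"]) auto
  next
    case False
    then obtain v where v: "v \<in> V" "v \<in> K" by blast
    \<comment> \<open>The condition \<open>d \<le> rm ^ l\<close> guarantees that at least
      \<open>l\<close> letters are read before stopping; so no factor of the product is left
      here.\<close>
    have "l = 0"
    proof (rule ccontr)
      assume "l \<noteq> 0"
      then have "rm ^ l \<le> rm ^ 1" using rm by (intro power_decreasing) auto
      then show False using d by simp
    qed
    have "x0 \<in> K" using a U(3) by force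
    then have "dist v x0 \<le> D" using dist_less_D v by force
    also have "\<dots> \<le> D / rm * d" using rm d D_pos by (simp add: pos_le_divide_eq)
    finally have 1: "dist v x0 \<le> D / rm * d" .
    have 2: "ball x0 (a * d) \<subseteq> U"
      using a d rm by (intro order_trans[OF subset_ball a(2)]) (simp add: mult_le_cancel_left2)
    have "1 \<le> (d / rm) powr s" using d rm s by (intro ge_one_powr_ge_zero) (auto simp: pos_le_divide_eq)
    then have "nu s k \<omega> V \<le> (d / rm) powr s" using nu_bounds[OF \<omega>, of s k V] by linarith
    then show ?thesis
      using 1 2 v \<open>l = 0\<close> by (intro exI[of _ "{x0}"]) auto
  qed
  {
    case 0
    then have "rm < d" using rm by simp
    then show ?case by (rule base[OF 0(1) _ 0(4) 0(6)])
  next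
    case (Suc k)
    note \<omega> = Suc.prems(1) and d = Suc.prems(3-6)
    note \<omega>0 = Omega_apply[OF \<omega>, of 0] and \<omega>' = Omega_shift[OF \<omega>]
    show ?case
    proof (cases "rm < d")
      case True
      then show ?thesis by (rule base[OF \<omega> _ d(2) d(4)])
    next
      case False
      let ?r = "\<lambda>j. r (\<omega> 0) j" and ?S = "\<lambda>j. S (\<omega> 0) j"
      let ?V = "\<lambda>j. {y\<in>K. ?S j y \<in> V}"
      \<comment> \<open>The scale \<open>d\<close> as seen inside the \<open>j\<close>-th copy. The
        recursion follows scales rather than generations, so it stops at cylinders with ratio
        comparable to the original \<open>d\<close>; \<open>q ^ k \<le> d\<close> ensures that it
        stops before the \<open>k\<close> generations are exhausted.\<close>
      define e where "e = (\<lambda>j. d / ?r j)"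
      have e: "0 < e j" "e j \<le> 1" "q ^ k \<le> e j" "e j \<le> rm ^ (l - 1)" "?r j * e j = d" if j: "j \<in> J (\<omega> 0)" for j
      proof -
        note c = ratio_pos[OF \<omega>0 j] and cr = ratio[OF \<omega>0 j]
        show "0 < e j" using c d by (simp add: e_def)
        show "e j \<le> 1" using c cr False by (simp add: e_def)
        have "q ^ k * ?r j \<le> q ^ k * q" using cr q by (intro mult_left_mono) auto
        also have "\<dots> \<le> d" using d by (simp add: mult.commute)
        finally show "q ^ k \<le> e j" using c by (simp add: e_def pos_le_divide_eq)
        show "e j \<le> rm ^ (l - 1)"
        proof (cases l)
          case 0
          then show ?thesis using \<open>e j \<le> 1\<close> by simp
        next
          case (Suc m)
          have "d \<le> rm ^ m * rm" using d Suc by (simp add: mult.commute)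
          also have "\<dots> \<le> rm ^ m * ?r j" using cr rm by (intro mult_left_mono) auto
          finally show ?thesis using c Suc by (simp add: e_def pos_divide_le_eq)
        qed
        show "?r j * e j = d" using c by (simp add: e_def)
      qed
      define Q where "Q = (\<lambda>j X. finite X \<and> (\<forall>x\<in>X. ball x (a * e j) \<subseteq> U \<and> (\<exists>v\<in>?V j. dist v x \<le> D / rm * e j)) \<and>
        (\<forall>x\<in>X. \<forall>y\<in>X. x \<noteq> y \<longrightarrow> ball x (a * e j) \<inter> ball y (a * e j) = {}) \<and>
        nu s k (shift \<omega>) (?V j) * (\<Prod>i<l - 1. gsum s (shift \<omega> i)) \<le> (e j / rm) powr s * card X)"
      have "\<exists>X. Q j X" if j: "j \<in> J (\<omega> 0)" for j
        unfolding Q_def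
      proof (rule Suc.IH[OF \<omega>'])
        show "1 \<le> gsum s (shift \<omega> n)" for n using Suc.prems(2) by (simp add: shift_apply)
      qed (use e[OF j] in auto)
      then obtain X where Q: "\<And>j. j \<in> J (\<omega> 0) \<Longrightarrow> Q j (X j)"
        by metis
      have X1: "finite (X j)" and X2: "\<forall>x\<in>X j. ball x (a * e j) \<subseteq> U \<and> (\<exists>v\<in>?V j. dist v x \<le> D / rm * e j)"
        and X3: "\<forall>x\<in>X j. \<forall>y\<in>X j. x \<noteq> y \<longrightarrow> ball x (a * e j) \<inter> ball y (a * e j) = {}"
        and X4: "nu s k (shift \<omega>) (?V j) * (\<Prod>i<l - 1. gsum s (shift \<omega> i)) \<le> (e j / rm) powr s * card (X j)"
        if "j \<in> J (\<omega> 0)" for j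
      proof -
        note Qj = Q[OF that, unfolded Q_def]
        show "finite (X j)" by (rule conjunct1[OF Qj])
        show "\<forall>x\<in>X j. ball x (a * e j) \<subseteq> U \<and> (\<exists>v\<in>?V j. dist v x \<le> D / rm * e j)"
          by (rule Qj[THEN conjunct2, THEN conjunct1])
        show "\<forall>x\<in>X j. \<forall>y\<in>X j. x \<noteq> y \<longrightarrow> ball x (a * e j) \<inter> ball y (a * e j) = {}"
          by (rule Qj[THEN conjunct2, THEN conjunct2, THEN conjunct1])
        show "nu s k (shift \<omega>) (?V j) * (\<Prod>i<l - 1. gsum s (shift \<omega> i)) \<le> (e j / rm) powr s * card (X j)"
          by (rule Qj[THEN conjunct2, THEN conjunct2, THEN conjunct2])
      qed
      note X = X1 bspec[OF X2] X3[rule_format] X4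
      have XU: "X j \<subseteq> U" if "j \<in> J (\<omega> 0)" for j
        using X(2)[OF that] e(1)[OF that] a(1) by (force simp: subset_eq)
      \<comment> \<open>Balls of radius \<open>a * e j\<close> become balls of radius
        \<open>a * d\<close> for every \<open>j\<close>, although the ratios differ.\<close>
      have ball_image: "ball (?S j x) (a * d) \<subseteq> ?S j ` ball x (a * e j)" if j: "j \<in> J (\<omega> 0)" "x \<in> X j" for j x
      proof -
        have "ball (?S j x) (?r j * (a * e j)) \<subseteq> ?S j ` ball x (a * e j)"
          by (rule ball_subset_similarity_image[OF ratio_pos[OF \<omega>0 j(1)]])
            (use X(2)[OF j] U(3) in \<open>auto intro!: sim[OF \<omega>0 j(1)]\<close>)
        moreover have "?r j * (a * e j) = a * d" using e(5)[OF j(1)] by (metis mult.left_commute)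
        ultimately show ?thesis by simp
      qed
      \<comment> \<open>Within one copy disjointness is inherited through injectivity; across copies
        it comes from the disjoint images of \<open>U\<close>.\<close>
      define Y where "Y = (\<Union>j\<in>J (\<omega> 0). ?S j ` X j)"
      have finJ: "finite (J (\<omega> 0))" using J[OF \<omega>0] by blast
      have cardY: "card Y = (\<Sum>j\<in>J (\<omega> 0). card (X j))"
      proof -
        have "card Y = (\<Sum>j\<in>J (\<omega> 0). card (?S j ` X j))"
          unfolding Y_def
        proof (rule card_UN_disjoint[OF finJ])
          show "\<forall>j\<in>J (\<omega> 0). finite (?S j ` X j)" using X(1) by simp
          show "\<forall>i\<in>J (\<omega> 0). \<forall>j\<in>J (\<omega> 0). i \<noteq> j \<longrightarrow> ?S i ` X i \<inter> ?S j ` X j = {}"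
            using XU SU_disjoint[OF \<omega>0] by blast
        qed
        also have "\<dots> = (\<Sum>j\<in>J (\<omega> 0). card (X j))"
        proof (intro sum.cong refl card_image)
          show "inj_on (?S j) (X j)" if "j \<in> J (\<omega> 0)" for j
            using inj_S[OF \<omega>0 that] XU[OF that] U(3) by (blast intro: inj_on_subset)
        qed
        finally show ?thesis .
      qed
      show ?thesis
      proof (intro exI[of _ Y] conjI ballI impI)
        show "finite Y" unfolding Y_def using finJ X(1) by blast
        show "ball y (a * d) \<subseteq> U" if "y \<in> Y" for y
        proof -
          obtain j x where j: "j \<in> J (\<omega> 0)" "x \<in> X j" "y = ?S j x" using \<open>y \<in> Y\<close> unfolding Y_def by blast
          then show ?thesis using ball_image[OF j(1,2)] X(2)[OF j(1,2)] SU[OF \<omega>0 j(1)] by blast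
        qed
        show "\<exists>v\<in>V. dist v y \<le> D / rm * d" if "y \<in> Y" for y
        proof -
          obtain j x where j: "j \<in> J (\<omega> 0)" "x \<in> X j" "y = ?S j x" using \<open>y \<in> Y\<close> unfolding Y_def by blast
          then obtain v where v: "v \<in> K" "?S j v \<in> V" "dist v x \<le> D / rm * e j" using X(2)[OF j(1,2)] by blast
          have "x \<in> K" using XU[OF j(1)] j(2) U(3) by blast
          then have "dist (?S j v) y = ?r j * dist v x" unfolding j(3) using v(1) by (intro sim[OF \<omega>0 j(1)])
          also have "\<dots> \<le> ?r j * (D / rm * e j)"
            using v(3) ratio_pos[OF \<omega>0 j(1)] by (intro mult_left_mono) auto
          also have "\<dots> = D / rm * d" using e(5)[OF j(1)] by (metis mult.left_commute)
          finally show ?thesis using v(2) by blast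
        qed
        show "ball y (a * d) \<inter> ball z (a * d) = {}" if yz: "y \<in> Y" "z \<in> Y" "y \<noteq> z" for y z
        proof -
          obtain i x where i: "i \<in> J (\<omega> 0)" "x \<in> X i" "y = ?S i x" using yz unfolding Y_def by blast
          obtain j w where j: "j \<in> J (\<omega> 0)" "w \<in> X j" "z = ?S j w" using yz unfolding Y_def by blast
          have sub: "ball y (a * d) \<subseteq> ?S i ` ball x (a * e i)" "ball z (a * d) \<subseteq> ?S j ` ball w (a * e j)"
            using ball_image i j by auto
          have BU: "ball x (a * e i) \<subseteq> U" "ball w (a * e j) \<subseteq> U" using X(2) i j by auto
          show ?thesis
          proof (cases "i = j")
            case True
            then have "ball x (a * e i) \<inter> ball w (a * e j) = {}" using X(3)[of i x w] i j yz by auto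
            moreover have "inj_on (?S i) U" using inj_S[OF \<omega>0 i(1)] U(3) by (blast intro: inj_on_subset)
            ultimately have "?S i ` ball x (a * e i) \<inter> ?S j ` ball w (a * e j) = {}"
              using BU True by (metis image_empty inj_on_image_Int)
            then show ?thesis using sub by blast
          next
            case False
            then show ?thesis using SU_disjoint[OF \<omega>0 i(1) j(1)] sub BU by blast
          qed
        qed
        \<comment> \<open>Only an inequality, because \<open>l - 1\<close> truncates: for
          \<open>l = 0\<close> the right side has the extra factor
          \<open>gsum s (\<omega> 0) \<ge> 1\<close>.\<close>
        have prod: "(\<Prod>i<l. gsum s (\<omega> i)) \<le> gsum s (\<omega> 0) * (\<Prod>i<l - 1. gsum s (shift \<omega> i))"
        proof (cases l)
          case 0
          then show ?thesis using Suc.prems(2)[of 0] by simp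
        next
          case (Suc m)
          then show ?thesis by (simp only: prod.lessThan_Suc_shift) (simp add: shift_apply)
        qed
        let ?n = "\<lambda>j. nu s k (shift \<omega>) (?V j)" and ?P = "\<Prod>i<l - 1. gsum s (shift \<omega> i)"
        have "nu s (Suc k) \<omega> V * (\<Prod>i<l. gsum s (\<omega> i)) \<le> nu s (Suc k) \<omega> V * (gsum s (\<omega> 0) * ?P)"
          using prod conjunct1[OF nu_bounds[OF \<omega>]] by (rule mult_left_mono)
        also have "\<dots> = (\<Sum>j\<in>J (\<omega> 0). ?r j powr s * ?n j) * ?P"
          using gsum_pos[OF \<omega>0, of s] by simp
        also have "\<dots> = (\<Sum>j\<in>J (\<omega> 0). ?r j powr s * (?n j * ?P))"
          by (simp only: sum_distrib_right mult.assoc)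
        also have "\<dots> \<le> (\<Sum>j\<in>J (\<omega> 0). ?r j powr s * ((e j / rm) powr s * card (X j)))"
          using X(4) by (intro sum_mono mult_left_mono) auto
        also have "\<dots> = (\<Sum>j\<in>J (\<omega> 0). (d / rm) powr s * card (X j))"
        proof (intro sum.cong refl)
          fix j assume "j \<in> J (\<omega> 0)"
          \<comment> \<open>The ratio and the inner scale recombine to \<open>d\<close>, so all
            copies contribute with the same weight per ball.\<close>
          then have eq: "?r j * (e j / rm) = d / rm" using e(5) by simp
          then show "?r j powr s * ((e j / rm) powr s * card (X j)) = (d / rm) powr s * card (X j)"
            using powr_mult[of "?r j" "e j / rm" s] unfolding eq by (simp only: mult.assoc)
        qed
        also have "\<dots> = (d / rm) powr s * card Y"
          unfolding cardY by (simp add: sum_distrib_left)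
        finally show "nu s (Suc k) \<omega> V * (\<Prod>i<l. gsum s (\<omega> i)) \<le> (d / rm) powr s * card Y" .
      qed
    qed
  }
qed

text \<open>Mass distribution: a set of diameter at most \<open>d\<close> has natural mass at most a
  constant times \<open>d powr s\<close> divided by the product of Moran sums, while every cover has
  total mass at least 1. The product appears because the natural weights are normalised by
  \<open>gsum\<close>.\<close>

lemma hausdorff_measure_lower_bound:
  assumes s: "0 \<le> s"
  obtains c where "0 < c" "\<forall>\<omega>\<in>Omega N. \<forall>l. (\<forall>n. 1 \<le> gsum s (\<omega> n)) \<longrightarrow>
    ennreal (c * (\<Prod>i<l. gsum s (\<omega> i))) \<le> hausdorff_measure s (F \<omega>)"
proof -
  obtain x0 where "x0 \<in> U" using U(2) by blast
  then obtain a where a: "0 < a" "ball x0 a \<subseteq> U" using U(1) open_contains_ball by blast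
  \<comment> \<open>The counted centres lie within \<open>D / rm * d\<close> of a set of diameter at
    most \<open>d\<close>, so they are at mutual distance at most \<open>b * d\<close>. Then
    \<open>M\<close> bounds their number by volume.\<close>
  define b where "b = 2 * (D / rm) + 1"
  define M where "M = ((a + b) / a) ^ DIM('a)"
  have b: "0 < b" using D_pos rm by (simp add: b_def add_pos_pos)
  have M: "0 < M" using a b by (simp add: M_def)
  have nu_le: "nu s k \<omega> V * (\<Prod>i<l. gsum s (\<omega> i)) \<le> (d / rm) powr s * M"
    if \<omega>: "\<omega> \<in> Omega N" "\<And>n. 1 \<le> gsum s (\<omega> n)" and d: "0 < d" "d \<le> 1" "q ^ k \<le> d" "d \<le> rm ^ l"
      and V: "bounded V" "diameter V \<le> d" for \<omega> k l d V
  proof -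
    obtain X where X: "finite X" "\<forall>x\<in>X. ball x (a * d) \<subseteq> U \<and> (\<exists>v\<in>V. dist v x \<le> D / rm * d)"
      "\<forall>x\<in>X. \<forall>y\<in>X. x \<noteq> y \<longrightarrow> ball x (a * d) \<inter> ball y (a * d) = {}"
      "nu s k \<omega> V * (\<Prod>i<l. gsum s (\<omega> i)) \<le> (d / rm) powr s * card X"
      using nu_le_card[OF s a \<omega> d, of V] by (elim exE conjE) (rule that)
    have "real (card X) \<le> M"
    proof (cases "X = {}")
      case False
      then obtain z where z: "z \<in> X" by blast
      then obtain v where v: "v \<in> V" "dist v z \<le> D / rm * d" using X(2) by blast
      have "dist z x \<le> b * d" if x: "x \<in> X" for x
      proof -
        obtain w where w: "w \<in> V" "dist w x \<le> D / rm * d" using X(2) x by blast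
        have "dist v w \<le> d" using diameter_bounded_bound[OF V(1) v(1) w(1)] V(2) by simp
        moreover have "dist z x \<le> dist v z + dist v w + dist w x"
          by (metis add.commute add_right_mono dist_triangle dist_triangle3 order_trans)
        moreover have "b * d = D / rm * d + d + D / rm * d"
          by (simp add: b_def distrib_right)
        ultimately show ?thesis using v w by linarith
      qed
      then have "real (card X) * (a * d) ^ DIM('a) \<le> (a * d + b * d) ^ DIM('a)"
        using X a b d by (intro card_disjoint_balls_le) auto
      also have "\<dots> = M * (a * d) ^ DIM('a)"
      proof -
        have "a * d + b * d = (a + b) / a * (a * d)" using a by (simp add: field_simps)
        then show ?thesis by (simp only: M_def power_mult_distrib)
      qed
      finally show ?thesis using a d by simp
    qed (use M in simp)
    then have "(d / rm) powr s * card X \<le> (d / rm) powr s * M" by (intro mult_left_mono) auto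
    with X(4) show ?thesis by linarith
  qed
  define c where "c = rm powr s / M"
  have c: "0 < c" using rm M by (simp add: c_def)
  have "ennreal (c * (\<Prod>i<l. gsum s (\<omega> i))) \<le> hausdorff_measure s (F \<omega>)"
    if \<omega>: "\<omega> \<in> Omega N" "\<And>n. 1 \<le> gsum s (\<omega> n)" for \<omega> l
  proof (rule ccontr)
    let ?P = "\<Prod>i<l. gsum s (\<omega> i)"
    have P: "0 < ?P" using \<omega>(2) by (intro prod_pos) (smt (verit))
    assume "\<not> ?thesis"
    then have "hausdorff_measure s (F \<omega>) < ennreal (c * ?P)" by simp
    \<comment> \<open>The gauge depends on \<open>l\<close>, so that each covering set is small
      enough for \<open>l\<close> letters to be read; half of it leaves room for open
      enlargement.\<close>
    then have "hausdorff_delta s (rm ^ l / 2) (F \<omega>) < ennreal (c * ?P)"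
      using rm by (intro order.strict_trans1[OF hausdorff_measure_upper]) auto
    then obtain I :: "nat set" and V d where I: "finite I" "F \<omega> \<subseteq> (\<Union>i\<in>I. V i)"
      "\<And>i. i \<in> I \<Longrightarrow> open (V i) \<and> bounded (V i) \<and> diameter (V i) \<le> d i \<and> 0 < d i \<and> d i \<le> rm ^ l"
      "ennreal (\<Sum>i\<in>I. d i powr s) < ennreal (c * ?P)"
      using hausdorff_delta_finite_open_cover[OF s F_compact[OF \<omega>(1)], of "rm ^ l / 2" "ennreal (c * ?P)" "rm ^ l"] rm
      by auto
    \<comment> \<open>A finite cover has a smallest size, so one generation \<open>k\<close> is deep
      enough for all its members.\<close>
    define e where "e = Min (insert 1 (d ` I))"
    have e: "0 < e" "\<And>i. i \<in> I \<Longrightarrow> e \<le> d i" using I by (auto simp: e_def Min_gr_iff)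
    obtain k where "q ^ k < e" using real_arch_pow_inv[OF e(1) q(2)] by blast
    then have k: "q ^ k \<le> d i" if "i \<in> I" for i using e(2)[OF that] by simp
    have rl: "rm ^ l \<le> 1" using rm by (intro power_le_one) auto
    have "?P \<le> (\<Sum>i\<in>I. nu s k \<omega> (V i)) * ?P"
      using nu_cover[OF \<omega>(1) I(1,2), of s k] P by (simp add: mult_le_cancel_right1)
    also have "\<dots> = (\<Sum>i\<in>I. nu s k \<omega> (V i) * ?P)" by (rule sum_distrib_right)
    also have "\<dots> \<le> (\<Sum>i\<in>I. (d i / rm) powr s * M)"
      using I(3) k rl by (intro sum_mono nu_le \<omega>) (auto intro: order_trans)
    also have "\<dots> = (\<Sum>i\<in>I. d i powr s) / c"
      using rm M by (simp add: c_def powr_divide sum_distrib_right[symmetric] sum_divide_distrib[symmetric])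
    finally have "c * ?P \<le> (\<Sum>i\<in>I. d i powr s)" using c by (simp add: pos_le_divide_eq mult.commute)
    then show False using I(4) by (simp add: ennreal_leI leD)
  qed
  then have "\<forall>\<omega>\<in>Omega N. \<forall>l. (\<forall>n. 1 \<le> gsum s (\<omega> n)) \<longrightarrow>
      ennreal (c * (\<Prod>i<l. gsum s (\<omega> i))) \<le> hausdorff_measure s (F \<omega>)"
    by blast
  with c show thesis by (rule that)
qed

end

section \<open>Typical sequences\<close>

text \<open>Each occurrence of a factor at least \<theta> gains a factor \<theta>, and the factors
  in between do not lose it.\<close>

lemma prod_infinitely_often_ge:
  fixes f :: "nat \<Rightarrow> real"
  assumes f: "\<And>i. 1 \<le> f i" and \<theta>: "1 \<le> \<theta>" and inf: "\<And>m. \<exists>l\<ge>m. \<theta> \<le> f l"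
  shows "\<exists>l. \<theta> ^ n \<le> (\<Prod>i<l. f i)"
proof (induction n)
  case 0
  show ?case by (intro exI[of _ 0]) simp
next
  case (Suc n)
  then obtain l where l: "\<theta> ^ n \<le> (\<Prod>i<l. f i)" by blast
  obtain k where k: "l \<le> k" "\<theta> \<le> f k" using inf by blast
  have "(\<Prod>i<l. f i) \<le> (\<Prod>i<k. f i)"
  proof -
    have f0: "0 \<le> f i" for i using f[of i] by linarith
    have "(\<Prod>i<k. f i) = (\<Prod>i<l. f i) * (\<Prod>i\<in>{..<k} - {..<l}. f i)"
      using k(1) by (subst prod.subset_diff[of "{..<l}"]) (auto simp: mult.commute)
    moreover have "1 \<le> (\<Prod>i\<in>{..<k} - {..<l}. f i)" by (rule prod_ge_1) (rule f)
    moreover have "0 \<le> (\<Prod>i<l. f i)" by (rule prod_nonneg) (simp add: f0)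
    ultimately show ?thesis by (simp add: mult_le_cancel_left1)
  qed
  then have "\<theta> ^ n * \<theta> \<le> (\<Prod>i<k. f i) * f k"
    using l k(2) \<theta> by (intro mult_mono) (auto intro: prod_nonneg order_trans[OF zero_le_one f])
  then show ?case by (intro exI[of _ "Suc k"]) (simp add: mult.commute)
qed

text \<open>The preceding fact for the reciprocals.\<close>

lemma prod_infinitely_often_le:
  fixes f :: "nat \<Rightarrow> real"
  assumes f: "\<And>i. 0 < f i \<and> f i \<le> 1" and \<theta>: "0 < \<theta>" "\<theta> \<le> 1" and inf: "\<And>m. \<exists>l\<ge>m. f l \<le> \<theta>"
  shows "\<exists>l. (\<Prod>i<l. f i) \<le> \<theta> ^ n"
proof -
  have "\<exists>l. (1 / \<theta>) ^ n \<le> (\<Prod>i<l. 1 / f i)"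
  proof (rule prod_infinitely_often_ge)
    show "1 \<le> 1 / f i" for i using f[of i] by simp
    show "1 \<le> 1 / \<theta>" using \<theta> by simp
    show "\<exists>l\<ge>m. 1 / \<theta> \<le> 1 / f l" for m
    proof -
      obtain l where "l \<ge> m" "f l \<le> \<theta>" using inf by blast
      then show ?thesis using f[of l] by (intro exI[of _ l]) (simp add: frac_le)
    qed
  qed
  then obtain l where l: "1 / \<theta> ^ n \<le> 1 / (\<Prod>i<l. f i)" by (auto simp: power_one_over prod_dividef)
  have "0 < (\<Prod>i<l. f i)" using f by (intro prod_pos) auto
  then have "(\<Prod>i<l. f i) \<le> \<theta> ^ n" using l \<theta> by (simp add: field_simps)
  then show ?thesis by blast
qed

lemma dimension_eqI:
  fixes \<mu> :: "real \<Rightarrow> ennreal"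
  assumes s: "0 \<le> s" and above: "\<And>t. s < t \<Longrightarrow> \<mu> t = 0" and below: "\<And>t. 0 \<le> t \<Longrightarrow> t < s \<Longrightarrow> \<mu> t \<noteq> 0"
  shows "Inf {t. 0 \<le> t \<and> \<mu> t = 0} = s"
proof (rule antisym)
  have ne: "{t. 0 \<le> t \<and> \<mu> t = 0} \<noteq> {}" using above[of "s + 1"] s by (auto intro!: exI[of _ "s + 1"])
  show "s \<le> Inf {t. 0 \<le> t \<and> \<mu> t = 0}"
    by (rule cInf_greatest[OF ne]) (use below in force)
  show "Inf {t. 0 \<le> t \<and> \<mu> t = 0} \<le> s"
  proof (rule field_le_epsilon)
    fix e :: real assume "0 < e"
    then show "Inf {t. 0 \<le> t \<and> \<mu> t = 0} \<le> s + e"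
      using above[of "s + e"] s by (intro cInf_lower) (auto intro!: bdd_belowI[of _ 0])
  qed
qed

text \<open>For fixed \<open>\<omega>0\<close> these sequences reach every cylinder, so properties
  that survive prepending letters hold on a dense set.\<close>

definition prefixed :: "nat \<Rightarrow> (nat \<Rightarrow> nat) \<Rightarrow> (nat \<Rightarrow> nat) \<Rightarrow> nat \<Rightarrow> nat" where
  "prefixed k \<omega> \<omega>0 = (\<lambda>n. if n < k then \<omega> n else \<omega>0 (n - k))"

lemma prefixed_Omega: "\<omega> \<in> Omega N \<Longrightarrow> \<omega>0 \<in> Omega N \<Longrightarrow> prefixed k \<omega> \<omega>0 \<in> Omega N"
  by (simp add: Omega_def prefixed_def)

lemma prefixed_induct:
  assumes "\<omega> \<in> Omega N" "\<omega>0 \<in> Omega N" "\<Phi> \<omega>0" and step: "\<And>\<omega>. \<omega> \<in> Omega N \<Longrightarrow> \<Phi> (shift \<omega>) \<Longrightarrow> \<Phi> \<omega>"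
  shows "\<Phi> (prefixed k \<omega> \<omega>0)"
  using assms(1)
proof (induction k arbitrary: \<omega>)
  case 0
  then show ?case using assms(3) by (simp add: prefixed_def)
next
  case (Suc k)
  have "shift (prefixed (Suc k) \<omega> \<omega>0) = prefixed k (shift \<omega>) \<omega>0"
    by (auto simp: shift_def prefixed_def)
  then show ?case
    using step[OF prefixed_Omega[OF Suc.prems assms(2)]] Suc.IH[OF Omega_shift[OF Suc.prems]] by metis
qed

context random_ifs_osc
begin

text \<open>Near-extremal sequences are dense because prepending letters changes neither measure.
  Their near-extremality at a fixed gauge persists on a cylinder, and the countably many such
  conditions together force the extremal values.\<close>

lemma typical_equal_dimensions:
  assumes s: "0 \<le> s" and N: "1 \<le> N" and g: "\<And>i. i \<in> {1..N} \<Longrightarrow> gsum s i = 1"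
    and sep: "\<And>\<omega> l i j. \<omega> \<in> Omega N \<Longrightarrow> l \<in> {1..N} \<Longrightarrow> i \<in> J l \<Longrightarrow> j \<in> J l \<Longrightarrow> i \<noteq> j \<Longrightarrow>
               packing_measure s (S l i ` F \<omega> \<inter> S l j ` F \<omega>) = 0"
  defines "Hmin \<equiv> (INF \<omega>\<in>Omega N. hausdorff_measure s (F \<omega>))"
    and "Pmax \<equiv> (SUP \<omega>\<in>Omega N. packing_measure s (F \<omega>))"
  shows "residual_in (Omega_top N) {\<omega> \<in> Omega N.
    hausdorff_dim (F \<omega>) = s \<and> packing_dim (F \<omega>) = s \<and> 0 < hausdorff_measure s (F \<omega>) \<and>
    hausdorff_measure s (F \<omega>) = Hmin \<and> Hmin \<le> Pmax \<and> Pmax = packing_measure s (F \<omega>) \<and>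
    packing_measure s (F \<omega>) < \<infinity>}"
proof -
  define C where "C = ennreal ((2 * D / rm) powr s)"
  have Ctop: "C < top" by (simp add: C_def)
  have P0C: "packing_premeasure s (F \<omega>) \<le> C" if "\<omega> \<in> Omega N" for \<omega>
    unfolding C_def using g Omega_apply[OF that] by (intro packing_premeasure_bound[OF s that]) (simp add: gsum_def)
  have PP0: "packing_measure s (F \<omega>) = packing_premeasure s (F \<omega>)" if "\<omega> \<in> Omega N" for \<omega>
    by (rule packing_measure_eq_premeasure[OF s F_compact[OF that] order.strict_trans1[OF P0C[OF that] Ctop]])
  have HP: "hausdorff_measure s (F \<omega>) \<le> packing_measure s (F \<omega>)" for \<omega>
    by (rule hausdorff_measure_le_packing_measure[OF s])
  obtain c where c: "0 < c" "\<And>\<omega>. \<omega> \<in> Omega N \<Longrightarrow> ennreal c \<le> hausdorff_measure s (F \<omega>)"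
  proof -
    obtain c where c: "0 < c" "\<forall>\<omega>\<in>Omega N. \<forall>l. (\<forall>n. 1 \<le> gsum s (\<omega> n)) \<longrightarrow>
        ennreal (c * (\<Prod>i<l. gsum s (\<omega> i))) \<le> hausdorff_measure s (F \<omega>)"
      by (rule hausdorff_measure_lower_bound[OF s])
    \<comment> \<open>The empty product, \<open>l = 0\<close>, already gives a positive bound
      uniform in \<omega>.\<close>
    have "ennreal c \<le> hausdorff_measure s (F \<omega>)" if "\<omega> \<in> Omega N" for \<omega>
      using c(2)[rule_format, OF that, of 0] g Omega_apply[OF that] by simp
    with c(1) show thesis by (rule that)
  qed
  have cpos: "0 < ennreal c" using c by simp
  have Hpos: "0 < hausdorff_measure s (F \<omega>)" if "\<omega> \<in> Omega N" for \<omega>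
    using cpos c(2)[OF that] by (rule order.strict_trans2)
  have Pfin: "packing_measure s (F \<omega>) < top" if "\<omega> \<in> Omega N" for \<omega>
    unfolding PP0[OF that] by (rule order.strict_trans1[OF P0C[OF that] Ctop])
  have Hshift: "hausdorff_measure s (F \<omega>) = hausdorff_measure s (F (shift \<omega>))" if "\<omega> \<in> Omega N" for \<omega>
    by (rule measure_F_shift[where \<mu> = hausdorff_measure, OF that s g sep])
      (auto intro!: hausdorff_measure_additive_UN[OF s] hausdorff_measure_similarity[OF s])
  have Pshift: "packing_measure s (F \<omega>) = packing_measure s (F (shift \<omega>))" if "\<omega> \<in> Omega N" for \<omega>
    by (rule measure_F_shift[where \<mu> = packing_measure, OF that s g sep])
      (auto intro!: packing_measure_additive_UN[OF s] packing_measure_similarity)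
  have ne: "Omega N \<noteq> {}"
  proof -
    have "(\<lambda>_. 1) \<in> Omega N" using N by (simp add: Omega_def)
    then show ?thesis by blast
  qed
  have Hmin_le: "Hmin \<le> hausdorff_measure s (F \<omega>)" if "\<omega> \<in> Omega N" for \<omega>
    unfolding Hmin_def by (rule INF_lower[OF that])
  have Pmax_ge: "packing_measure s (F \<omega>) \<le> Pmax" if "\<omega> \<in> Omega N" for \<omega>
    unfolding Pmax_def by (rule SUP_upper[OF that])
  have HminPmax: "Hmin \<le> Pmax"
    using ne Hmin_le HP Pmax_ge by (meson all_not_in_conv order_trans)
  have "Pmax \<le> C" unfolding Pmax_def by (rule SUP_least) (simp add: PP0 P0C)
  then have Pmax_fin: "Pmax < top" using Ctop by (rule order.strict_trans1)
  have Pmax_pos: "0 < Pmax"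
    using ne Hpos HP Pmax_ge by (meson all_not_in_conv order.strict_trans2 order_trans)
  have Hmin_fin: "Hmin < top" using HminPmax Pmax_fin by (rule order.strict_trans1)
  \<comment> \<open>The flag \<open>b\<close> selects the Hausdorff or the packing condition,
    \<open>m\<close> the tolerance and \<open>n\<close> the gauge.\<close>
  define P :: "bool \<times> nat \<times> nat \<Rightarrow> (nat \<Rightarrow> nat) \<Rightarrow> bool" where "P = (\<lambda>(b, m, n) \<omega>.
    if b then hausdorff_delta s (1 / Suc n) (F \<omega>) < Hmin + ennreal (1 / Suc m)
    else Pmax - ennreal (1 / Suc m) < packing_delta s (1 / Suc n) (F \<omega>))"
  show ?thesis
  proof (rule residual_in_OmegaI[where P = P])
    fix \<omega> assume \<omega>: "\<omega> \<in> Omega N" and P: "\<And>i. P i \<omega>"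
    have "hausdorff_measure s (F \<omega>) \<le> Hmin"
    proof (rule ennreal_le_epsilon)
      fix e :: real assume "0 < e"
      then obtain m where m: "1 / Suc m < e" using nat_approx_posE by auto
      have "hausdorff_delta s (1 / Suc n) (F \<omega>) \<le> Hmin + ennreal (1 / Suc m)" for n
        using P[of "(True, m, n)"] by (simp add: P_def less_imp_le)
      then have "hausdorff_measure s (F \<omega>) \<le> Hmin + ennreal (1 / Suc m)"
        by (intro LIMSEQ_le_const2[OF LIMSEQ_hausdorff_delta]) blast
      also have "\<dots> \<le> Hmin + ennreal e" using m by (intro add_left_mono ennreal_leI) simp
      finally show "hausdorff_measure s (F \<omega>) \<le> Hmin + ennreal e" .
    qed
    then have H: "hausdorff_measure s (F \<omega>) = Hmin" using Hmin_le[OF \<omega>] by (rule antisym)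
    have "Pmax \<le> packing_measure s (F \<omega>)"
    proof (rule ennreal_le_epsilon)
      fix e :: real assume "0 < e"
      then obtain m where m: "1 / Suc m < e" using nat_approx_posE by auto
      have "Pmax - ennreal (1 / Suc m) \<le> packing_delta s (1 / Suc n) (F \<omega>)" for n
        using P[of "(False, m, n)"] by (simp add: P_def less_imp_le)
      then have "Pmax - ennreal (1 / Suc m) \<le> packing_premeasure s (F \<omega>)"
        by (intro LIMSEQ_le_const[OF LIMSEQ_packing_delta]) blast
      then have "Pmax \<le> packing_premeasure s (F \<omega>) + ennreal (1 / Suc m)"
        by (simp add: ennreal_minus_le_iff add.commute)
      also have "\<dots> \<le> packing_premeasure s (F \<omega>) + ennreal e"
        using m by (intro add_left_mono ennreal_leI) simp
      finally show "Pmax \<le> packing_measure s (F \<omega>) + ennreal e" by (simp add: PP0[OF \<omega>])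
    qed
    then have Pm: "packing_measure s (F \<omega>) = Pmax" using Pmax_ge[OF \<omega>] by (intro antisym)
    have "hausdorff_dim (F \<omega>) = s"
      unfolding hausdorff_dim_def
    proof (rule dimension_eqI[OF s])
      show "hausdorff_measure t (F \<omega>) = 0" if "s < t" for t
        using Pfin[OF \<omega>] HP[of \<omega>] s that by (intro hausdorff_measure_zero_above[of s]) auto
      show "hausdorff_measure t (F \<omega>) \<noteq> 0" if "0 \<le> t" "t < s" for t
        using hausdorff_measure_zero_above[of t "F \<omega>" s] Hpos[OF \<omega>] that by auto
    qed
    moreover have "packing_dim (F \<omega>) = s"
      unfolding packing_dim_def
    proof (rule dimension_eqI[OF s])
      show "packing_measure t (F \<omega>) = 0" if "s < t" for t
        by (rule packing_measure_zero_above[OF Pfin[OF \<omega>] that])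
      show "packing_measure t (F \<omega>) \<noteq> 0" if "0 \<le> t" "t < s" for t
        using packing_measure_zero_above[of t "F \<omega>" s] Hpos[OF \<omega>] HP[of \<omega>] that by auto
    qed
    ultimately show "\<omega> \<in> {\<omega> \<in> Omega N.
      hausdorff_dim (F \<omega>) = s \<and> packing_dim (F \<omega>) = s \<and> 0 < hausdorff_measure s (F \<omega>) \<and>
      hausdorff_measure s (F \<omega>) = Hmin \<and> Hmin \<le> Pmax \<and> Pmax = packing_measure s (F \<omega>) \<and>
      packing_measure s (F \<omega>) < \<infinity>}"
      using \<omega> Hpos[OF \<omega>] H Pm HminPmax Pfin[OF \<omega>] by simp
  next
    fix i :: "bool \<times> nat \<times> nat" and \<omega>0 k assume \<omega>0: "\<omega>0 \<in> Omega N"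
    obtain b m n where i: "i = (b, m, n)" using prod_cases3 by blast
    have n: "0 < 1 / real (Suc n)" by simp
    show "\<exists>\<omega>\<in>Omega N. \<exists>m. (\<forall>n<k. \<omega> n = \<omega>0 n) \<and> (\<forall>\<omega>'\<in>Omega N. (\<forall>n<m. \<omega>' n = \<omega> n) \<longrightarrow> P i \<omega>')"
    proof (cases b)
      case True
      have "Hmin < Hmin + ennreal (1 / Suc m)"
        by (rule ennreal_less_add_pos[OF Hmin_fin]) simp
      then obtain \<omega>1 where \<omega>1: "\<omega>1 \<in> Omega N" "hausdorff_measure s (F \<omega>1) < Hmin + ennreal (1 / Suc m)"
        unfolding Hmin_def INF_less_iff by blast
      let ?\<omega> = "prefixed k \<omega>0 \<omega>1"
      have \<omega>: "?\<omega> \<in> Omega N" by (rule prefixed_Omega[OF \<omega>0 \<omega>1(1)])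
      \<comment> \<open>The near-minimiser placed behind the first \<open>k\<close> letters of
        \<open>\<omega>0\<close> keeps its measure.\<close>
      have "hausdorff_measure s (F ?\<omega>) < Hmin + ennreal (1 / Suc m)"
        by (rule prefixed_induct[where \<Phi> = "\<lambda>\<omega>. hausdorff_measure s (F \<omega>) < Hmin + ennreal (1 / Suc m)", OF \<omega>0 \<omega>1])
          (simp only: Hshift)
      from hausdorff_delta_stable[OF \<omega> s n this] obtain l where
        l: "\<forall>\<omega>'\<in>Omega N. (\<forall>n<l. \<omega>' n = ?\<omega> n) \<longrightarrow> hausdorff_delta s (1 / Suc n) (F \<omega>') < Hmin + ennreal (1 / Suc m)"
        by blast
      show ?thesis
      proof (intro bexI[OF _ \<omega>] exI[of _ l] conjI)
        show "\<forall>n<k. ?\<omega> n = \<omega>0 n" by (simp add: prefixed_def)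
        show "\<forall>\<omega>'\<in>Omega N. (\<forall>n<l. \<omega>' n = ?\<omega> n) \<longrightarrow> P i \<omega>'"
          using l True by (simp add: i P_def)
      qed
    next
      case False
      \<comment> \<open>Subtraction truncates at 0, so strictness needs \<open>Pmax\<close> positive
        as well as finite.\<close>
      have "Pmax - ennreal (1 / Suc m) < Pmax"
        using Pmax_fin Pmax_pos by (intro ennreal_between) auto
      then obtain \<omega>1 where \<omega>1: "\<omega>1 \<in> Omega N" "Pmax - ennreal (1 / Suc m) < packing_measure s (F \<omega>1)"
        unfolding Pmax_def less_SUP_iff by blast
      let ?\<omega> = "prefixed k \<omega>0 \<omega>1"
      have \<omega>: "?\<omega> \<in> Omega N" by (rule prefixed_Omega[OF \<omega>0 \<omega>1(1)])
      have "Pmax - ennreal (1 / Suc m) < packing_measure s (F ?\<omega>)"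
        by (rule prefixed_induct[where \<Phi> = "\<lambda>\<omega>. Pmax - ennreal (1 / Suc m) < packing_measure s (F \<omega>)", OF \<omega>0 \<omega>1])
          (simp only: Pshift)
      \<comment> \<open>Stability is available for the premeasure, which equals the packing measure
        here.\<close>
      from packing_delta_stable[OF \<omega> n this[unfolded PP0[OF \<omega>]]] obtain l where
        l: "\<forall>\<omega>'\<in>Omega N. (\<forall>n<l. \<omega>' n = ?\<omega> n) \<longrightarrow> Pmax - ennreal (1 / Suc m) < packing_delta s (1 / Suc n) (F \<omega>')"
        by blast
      show ?thesis
      proof (intro bexI[OF _ \<omega>] exI[of _ l] conjI)
        show "\<forall>n<k. ?\<omega> n = \<omega>0 n" by (simp add: prefixed_def)
        show "\<forall>\<omega>'\<in>Omega N. (\<forall>n<l. \<omega>' n = ?\<omega> n) \<longrightarrow> P i \<omega>'"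
          using l False by (simp add: i P_def)
      qed
    qed
  qed blast
qed

text \<open>A finite premeasure at \<open>t\<close> would bound the Hausdorff measure at
  \<open>t\<close>, hence make the one at \<open>s\<close> vanish, against the lower bound with
  Moran sum 1.\<close>

lemma constant_attractor_premeasure_eq_top:
  assumes t: "0 \<le> t" "t < s" and i: "i \<in> {1..N}" "gsum s i = 1"
  shows "packing_premeasure t (F (\<lambda>_. i)) = top"
proof (rule ccontr)
  have s: "0 \<le> s" using t by simp
  have \<omega>: "(\<lambda>_. i) \<in> Omega N" using i(1) by (simp add: Omega_def)
  assume "packing_premeasure t (F (\<lambda>_. i)) \<noteq> top"
  then have "hausdorff_measure t (F (\<lambda>_. i)) < top"
    using hausdorff_measure_le_packing_premeasure[OF t(1), of "F (\<lambda>_. i)"]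
    by (simp add: less_top order.strict_trans1)
  then have 0: "hausdorff_measure s (F (\<lambda>_. i)) = 0"
    by (rule hausdorff_measure_zero_above) (use t in auto)
  obtain c where c: "0 < c" "\<forall>\<omega>\<in>Omega N. \<forall>l. (\<forall>n. 1 \<le> gsum s (\<omega> n)) \<longrightarrow>
      ennreal (c * (\<Prod>i<l. gsum s (\<omega> i))) \<le> hausdorff_measure s (F \<omega>)"
    by (rule hausdorff_measure_lower_bound[OF s])
  from c(2)[rule_format, OF \<omega>, of 0] show False using 0 c(1) i(2) by simp
qed

text \<open>Prefixed copies of the constant sequence \<open>i1\<close> make small Hausdorff sums
  above \<open>s1\<close> typical, those of \<open>i2\<close> make large packing sums below
  \<open>s2\<close> typical. Infinitely many \<open>i2\<close> make the Hausdorff measure at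
  \<open>s1\<close> infinite; infinitely many \<open>i1\<close> make the packing measure at
  \<open>s2\<close> vanish.\<close>

lemma typical_distinct_dimensions:
  assumes s: "0 \<le> s1" "s1 < s2" and i1: "i1 \<in> {1..N}" and i2: "i2 \<in> {1..N}"
    and g1: "gsum s1 i1 = 1" "1 < gsum s1 i2" "\<And>i. i \<in> {1..N} \<Longrightarrow> 1 \<le> gsum s1 i"
    and g2: "gsum s2 i2 = 1" "gsum s2 i1 < 1" "\<And>i. i \<in> {1..N} \<Longrightarrow> gsum s2 i \<le> 1"
  shows "residual_in (Omega_top N) {\<omega> \<in> Omega N.
    hausdorff_dim (F \<omega>) = s1 \<and> s1 < s2 \<and> packing_dim (F \<omega>) = s2 \<and>
    hausdorff_measure s1 (F \<omega>) = \<infinity> \<and> packing_measure s2 (F \<omega>) = 0}"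
proof -
  have s2: "0 < s2" using s by simp
  define C where "C = (2 * D / rm) powr s2"
  have PC: "packing_measure s2 (F \<omega>) \<le> ennreal C" if "\<omega> \<in> Omega N" for \<omega>
  proof (rule order_trans[OF packing_measure_le_premeasure])
    show "packing_premeasure s2 (F \<omega>) \<le> ennreal C"
      unfolding C_def using g2(3) Omega_apply[OF that] s2
      by (intro packing_premeasure_bound[OF _ that]) (auto simp: gsum_def)
  qed
  obtain c where c: "0 < c" "\<forall>\<omega>\<in>Omega N. \<forall>l. (\<forall>n. 1 \<le> gsum s1 (\<omega> n)) \<longrightarrow>
      ennreal (c * (\<Prod>i<l. gsum s1 (\<omega> i))) \<le> hausdorff_measure s1 (F \<omega>)"
    by (rule hausdorff_measure_lower_bound[OF s(1)])
  \<comment> \<open>Countably many exponents increasing to \<open>s2\<close>, cut off at 0.\<close>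
  define t where "t = (\<lambda>m. max 0 (s2 - 1 / Suc m))"
  have t: "0 \<le> t m" "t m < s2" for m using s2 by (auto simp: t_def)
  \<comment> \<open>Together with \<open>top_step\<close>, infinite premeasure is a tail property:
    finitely many similar copies of a finite premeasure stay finite, and one copy of an infinite one
    is infinite.\<close>
  have top_shift: "packing_premeasure u (F (shift \<omega>)) = top"
    if "\<omega> \<in> Omega N" "packing_premeasure u (F \<omega>) = top" for u \<omega>
  proof (rule ccontr)
    assume "packing_premeasure u (F (shift \<omega>)) \<noteq> top"
    then have "packing_premeasure u (F (shift \<omega>)) < top" by (simp only: less_top)
    then have "ennreal (gsum u (\<omega> 0)) * packing_premeasure u (F (shift \<omega>)) < top"
      by (simp add: ennreal_mult_less_top)
    from order.strict_trans1[OF packing_premeasure_F_le[OF that(1)] this] that(2) show False by simp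
  qed
  have top_funpow: "packing_premeasure u (F ((shift ^^ k) \<omega>)) = top"
    if "\<omega> \<in> Omega N" "packing_premeasure u (F \<omega>) = top" for u \<omega> k
    by (induction k) (use that top_shift Omega_funpow_shift in auto)
  have top_step: "packing_premeasure u (F \<omega>) = top"
    if \<omega>: "\<omega> \<in> Omega N" and top: "packing_premeasure u (F (shift \<omega>)) = top" for u \<omega>
  proof -
    note \<omega>0 = Omega_apply[OF \<omega>, of 0]
    obtain j where j: "j \<in> J (\<omega> 0)" using J[OF \<omega>0] by blast
    have "packing_premeasure u (S (\<omega> 0) j ` F (shift \<omega>)) = ennreal (r (\<omega> 0) j powr u) * top"
      unfolding top[symmetric]
      by (rule packing_premeasure_similarity[OF ratio_pos[OF \<omega>0 j] sim_F[OF Omega_shift[OF \<omega>] \<omega>0 j]])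
    also have "\<dots> = top" using ratio_pos[OF \<omega>0 j] by (simp add: ennreal_mult_top)
    finally have "top \<le> packing_premeasure u (F \<omega>)"
      using packing_premeasure_mono[of "S (\<omega> 0) j ` F (shift \<omega>)" "F \<omega>" u] F_unfold[OF \<omega>] j by auto
    then show ?thesis by (simp add: top_unique)
  qed
  have top_packing: "packing_measure u (F \<omega>) = top"
    if \<omega>: "\<omega> \<in> Omega N" and top: "packing_premeasure u (F \<omega>) = top" for u \<omega>
  proof (rule packing_measure_eq_top[OF F_compact[OF \<omega>] F_nonempty[OF \<omega>]])
    fix x e assume x: "x \<in> F \<omega>" and e: "0 < (e::real)"
    \<comment> \<open>A copy of generation \<open>k\<close> through \<open>x\<close> has diameter at
      most \<open>q ^ k * D\<close>, so it fits into the ball and carries its infinite premeasure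
      there.\<close>
    obtain k where k: "q ^ k * D < e" using q_power_D_small[OF e] .
    let ?G = "F ((shift ^^ k) \<omega>)"
    obtain g c where g: "0 < c" "c \<le> q ^ k" "g ` ?G \<subseteq> F \<omega>" "x \<in> g ` ?G"
      "\<forall>y\<in>?G. \<forall>z\<in>?G. dist (g y) (g z) = c * dist y z"
      using local_copy[OF \<omega> x, of k] by (elim exE conjE) (rule that)
    have GK: "?G \<subseteq> K" by (rule F_subset[OF Omega_funpow_shift[OF \<omega>]])
    have "g ` ?G \<subseteq> ball x e"
    proof
      fix y assume "y \<in> g ` ?G"
      then obtain u v where uv: "u \<in> ?G" "v \<in> ?G" "y = g u" "x = g v" using g(4) by blast
      then have "dist x y = c * dist v u" using g(5) by blast
      also have "\<dots> \<le> q ^ k * D"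
        using g(1,2) uv GK dist_less_D[of v u] q by (intro mult_mono) (auto intro: less_imp_le)
      finally show "y \<in> ball x e" using k by simp
    qed
    then have "packing_premeasure u (g ` ?G) \<le> packing_premeasure u (F \<omega> \<inter> ball x e)"
      using g(3) by (intro packing_premeasure_mono) blast
    moreover have "packing_premeasure u (g ` ?G) = ennreal (c powr u) * packing_premeasure u ?G"
      by (rule packing_premeasure_similarity[OF g(1)]) (use g(5) in blast)
    moreover have "\<dots> = top" using top_funpow[OF \<omega> top] g(1) by (simp add: ennreal_mult_top)
    ultimately show "packing_premeasure u (F \<omega> \<inter> ball x e) = top" by (simp add: top_unique)
  qed
  \<comment> \<open>Values 0 and 1 of \<open>b\<close> make \<open>i1\<close> and \<open>i2\<close>
    recur, 2 asks for small Hausdorff sums, all larger ones for large packing sums. In the last two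
    cases \<open>n\<close> governs both gauge and threshold, so letting \<open>n\<close> grow yields
    0 and infinity.\<close>
  define P :: "nat \<times> nat \<times> nat \<Rightarrow> (nat \<Rightarrow> nat) \<Rightarrow> bool" where "P = (\<lambda>(b, m, n) \<omega>.
    if b = 0 then \<exists>l\<ge>m. \<omega> l = i1
    else if b = 1 then \<exists>l\<ge>m. \<omega> l = i2
    else if b = 2 then hausdorff_delta (s1 + 1 / Suc m) (1 / Suc n) (F \<omega>) < ennreal (1 / Suc n)
    else of_nat n < packing_delta (t m) (1 / Suc n) (F \<omega>))"
  show ?thesis
  proof (rule residual_in_OmegaI[where P = P])
    fix \<omega> assume \<omega>: "\<omega> \<in> Omega N" and P: "\<And>i. P i \<omega>"
    have inf1: "\<exists>l\<ge>m. \<omega> l = i1" for m using P[of "(0, m, 0)"] by (simp add: P_def)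
    have inf2: "\<exists>l\<ge>m. \<omega> l = i2" for m using P[of "(1, m, 0)"] by (simp add: P_def)
    have H_above: "hausdorff_measure (s1 + 1 / Suc m) (F \<omega>) = 0" for m
    proof -
      have "(\<lambda>n. ennreal (1 / real (Suc n))) \<longlonglongrightarrow> ennreal 0"
        by (intro tendsto_ennrealI LIMSEQ_Suc[OF lim_1_over_n])
      moreover have "hausdorff_delta (s1 + 1 / Suc m) (1 / Suc n) (F \<omega>) \<le> ennreal (1 / Suc n)" for n
        using P[of "(2, m, n)"] by (simp add: P_def less_imp_le)
      ultimately have "hausdorff_measure (s1 + 1 / Suc m) (F \<omega>) \<le> ennreal 0"
        by (intro LIMSEQ_le[OF LIMSEQ_hausdorff_delta]) blast+
      then show ?thesis by simp
    qed
    have P_below: "packing_measure (t m) (F \<omega>) = top" for m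
    proof (rule top_packing[OF \<omega>])
      have "(of_nat n :: ennreal) \<le> packing_delta (t m) (1 / Suc n) (F \<omega>)" for n
        using P[of "(3, m, n)"] by (simp add: P_def less_imp_le)
      then have "top \<le> packing_premeasure (t m) (F \<omega>)"
        by (intro LIMSEQ_le[OF of_nat_tendsto_top_ennreal LIMSEQ_packing_delta]) blast
      then show "packing_premeasure (t m) (F \<omega>) = top" by (simp add: top_unique)
    qed
    have H_top: "hausdorff_measure s1 (F \<omega>) = top"
    proof (rule ccontr)
      assume "hausdorff_measure s1 (F \<omega>) \<noteq> top"
      then obtain h where h: "hausdorff_measure s1 (F \<omega>) = ennreal h" "0 \<le> h"
        by (metis ennreal_cases)
      obtain n where n: "h / c < gsum s1 i2 ^ n" using real_arch_pow[OF g1(2)] by blast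
      have "\<exists>l. gsum s1 i2 ^ n \<le> (\<Prod>i<l. gsum s1 (\<omega> i))"
      proof (rule prod_infinitely_often_ge)
        show "1 \<le> gsum s1 (\<omega> i)" for i by (rule g1(3)[OF Omega_apply[OF \<omega>]])
        show "\<exists>l\<ge>m. gsum s1 i2 \<le> gsum s1 (\<omega> l)" for m using inf2[of m] by auto
      qed (use g1(2) in simp)
      then obtain l where "gsum s1 i2 ^ n \<le> (\<Prod>i<l. gsum s1 (\<omega> i))" by blast
      with n have "h / c < (\<Prod>i<l. gsum s1 (\<omega> i))" by linarith
      then have "h < c * (\<Prod>i<l. gsum s1 (\<omega> i))" using c(1) by (simp add: pos_divide_less_eq mult.commute)
      moreover have "c * (\<Prod>i<l. gsum s1 (\<omega> i)) \<le> h"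
        using c(2)[rule_format, OF \<omega>, of l] g1(3)[OF Omega_apply[OF \<omega>]] h by (simp add: ennreal_le_iff)
      ultimately show False by simp
    qed
    have P_zero: "packing_measure s2 (F \<omega>) = 0"
    proof -
      have g2pos: "0 < gsum s2 (\<omega> i)" for i by (rule gsum_pos[OF Omega_apply[OF \<omega>]])
      have le: "packing_measure s2 (F \<omega>) \<le> ennreal (\<Prod>i<l. gsum s2 (\<omega> i)) * packing_measure s2 (F ((shift ^^ l) \<omega>))" for l
      proof (induction l)
        case (Suc l)
        have w: "(shift ^^ l) \<omega> n = \<omega> (n + l)" for n
          by (induction l arbitrary: n) (auto simp: shift_apply)
        have "packing_measure s2 (F ((shift ^^ l) \<omega>)) \<le> ennreal (gsum s2 (\<omega> l)) * packing_measure s2 (F ((shift ^^ Suc l) \<omega>))"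
          using packing_measure_F_le[OF Omega_funpow_shift[OF \<omega>], of s2 l] by (simp add: w)
        then have "ennreal (\<Prod>i<l. gsum s2 (\<omega> i)) * packing_measure s2 (F ((shift ^^ l) \<omega>))
            \<le> ennreal (\<Prod>i<l. gsum s2 (\<omega> i)) * (ennreal (gsum s2 (\<omega> l)) * packing_measure s2 (F ((shift ^^ Suc l) \<omega>)))"
          by (rule mult_left_mono) simp
        also have "\<dots> = ennreal (\<Prod>i<Suc l. gsum s2 (\<omega> i)) * packing_measure s2 (F ((shift ^^ Suc l) \<omega>))"
          using g2pos by (simp add: ennreal_mult' mult.assoc less_imp_le prod_nonneg)
        finally show ?case using Suc.IH by (rule order_trans[rotated])
      qed simp
      \<comment> \<open>\<open>l\<close> is taken beyond enough occurrences of \<open>i1\<close>;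
        the tail attractor has packing measure at most \<open>C\<close> for every
        \<open>l\<close>.\<close>
      have "packing_measure s2 (F \<omega>) \<le> ennreal (gsum s2 i1 ^ n * C)" for n
      proof -
        have "\<exists>l. (\<Prod>i<l. gsum s2 (\<omega> i)) \<le> gsum s2 i1 ^ n"
        proof (rule prod_infinitely_often_le)
          show "0 < gsum s2 (\<omega> i) \<and> gsum s2 (\<omega> i) \<le> 1" for i
            using g2pos g2(3)[OF Omega_apply[OF \<omega>]] by blast
          show "\<exists>l\<ge>m. gsum s2 (\<omega> l) \<le> gsum s2 i1" for m using inf1[of m] by auto
        qed (use g2(2) gsum_pos[OF i1] in auto)
        then obtain l where l: "(\<Prod>i<l. gsum s2 (\<omega> i)) \<le> gsum s2 i1 ^ n" by blast
        have "packing_measure s2 (F \<omega>) \<le> ennreal (gsum s2 i1 ^ n) * ennreal C"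
          using l by (intro order_trans[OF le[of l]] mult_mono PC Omega_funpow_shift \<omega> ennreal_leI) auto
        also have "\<dots> = ennreal (gsum s2 i1 ^ n * C)"
          by (rule ennreal_mult[symmetric]) (use gsum_pos[OF i1, of s2] in \<open>auto simp: C_def less_imp_le\<close>)
        finally show ?thesis .
      qed
      moreover have "(\<lambda>n. ennreal (gsum s2 i1 ^ n * C)) \<longlonglongrightarrow> ennreal (0 * C)"
        using g2(2) gsum_pos[OF i1, of s2] by (intro tendsto_ennrealI tendsto_mult_right LIMSEQ_realpow_zero) auto
      ultimately have "packing_measure s2 (F \<omega>) \<le> ennreal (0 * C)"
        by (intro LIMSEQ_le_const) blast+
      then show ?thesis by simp
    qed
    have "hausdorff_dim (F \<omega>) = s1"
      unfolding hausdorff_dim_def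
    proof (rule dimension_eqI[OF s(1)])
      fix u assume u: "s1 < u"
      then obtain m where "1 / Suc m < u - s1" using nat_approx_posE[of "u - s1"] by auto
      then show "hausdorff_measure u (F \<omega>) = 0"
        using H_above[of m] s by (intro hausdorff_measure_zero_above[of "s1 + 1 / Suc m"]) auto
    next
      show "hausdorff_measure u (F \<omega>) \<noteq> 0" if "0 \<le> u" "u < s1" for u
        using hausdorff_measure_zero_above[of u "F \<omega>" s1] H_top that by auto
    qed
    moreover have "packing_dim (F \<omega>) = s2"
      unfolding packing_dim_def
    proof (rule dimension_eqI)
      show "packing_measure u (F \<omega>) = 0" if "s2 < u" for u
        by (rule packing_measure_zero_above[OF _ that]) (simp add: P_zero)
      fix u assume u: "0 \<le> u" "u < s2"
      then obtain m where m: "1 / Suc m < s2 - u" using nat_approx_posE[of "s2 - u"] by auto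
      then have "u < t m" by (simp add: t_def)
      then show "packing_measure u (F \<omega>) \<noteq> 0"
        using packing_measure_zero_above[of u "F \<omega>" "t m"] P_below[of m] by auto
    qed (use s2 in simp)
    ultimately show "\<omega> \<in> {\<omega> \<in> Omega N.
      hausdorff_dim (F \<omega>) = s1 \<and> s1 < s2 \<and> packing_dim (F \<omega>) = s2 \<and>
      hausdorff_measure s1 (F \<omega>) = \<infinity> \<and> packing_measure s2 (F \<omega>) = 0}"
      using \<omega> s(2) H_top P_zero by simp
  next
    fix i :: "nat \<times> nat \<times> nat" and \<omega>0 k assume \<omega>0: "\<omega>0 \<in> Omega N"
    obtain b m n where i: "i = (b, m, n)" using prod_cases3 by blast
    have n: "0 < 1 / real (Suc n)" by simp
    have const: "(\<lambda>_. i1) \<in> Omega N" "(\<lambda>_. i2) \<in> Omega N" using i1 i2 by (auto simp: Omega_def)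
    have w1: "prefixed k \<omega>0 (\<lambda>_. i1) \<in> Omega N" and w2: "prefixed k \<omega>0 (\<lambda>_. i2) \<in> Omega N"
      by (rule prefixed_Omega[OF \<omega>0 const(1)], rule prefixed_Omega[OF \<omega>0 const(2)])
    have agree: "\<forall>n<k. prefixed k \<omega>0 \<omega>1 n = \<omega>0 n" for \<omega>1 by (simp add: prefixed_def)
    \<comment> \<open>Fixing \<open>k + m + 1\<close> letters includes position
      \<open>k + m\<close>, which lies behind the prefix and is at least \<open>m\<close>.\<close>
    have hit: "\<exists>l\<ge>m. \<omega>' l = a" if "\<forall>n<Suc (k + m). \<omega>' n = prefixed k \<omega>0 (\<lambda>_. a) n" for \<omega>' a
      using that by (intro exI[of _ "k + m"]) (simp add: prefixed_def)
    consider "b = 0" | "b = 1" | "b = 2" | "b > 2" by linarith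
    then show "\<exists>\<omega>\<in>Omega N. \<exists>m. (\<forall>n<k. \<omega> n = \<omega>0 n) \<and> (\<forall>\<omega>'\<in>Omega N. (\<forall>n<m. \<omega>' n = \<omega> n) \<longrightarrow> P i \<omega>')"
    proof cases
      case 1
      have "P i \<omega>'" if "\<forall>n<Suc (k + m). \<omega>' n = prefixed k \<omega>0 (\<lambda>_. i1) n" for \<omega>'
        using hit[OF that] 1 by (simp add: i P_def)
      then show ?thesis using agree by (intro bexI[OF _ w1] exI[of _ "Suc (k + m)"] conjI) blast+
    next
      case 2
      have "P i \<omega>'" if "\<forall>n<Suc (k + m). \<omega>' n = prefixed k \<omega>0 (\<lambda>_. i2) n" for \<omega>'
        using hit[OF that] 2 by (simp add: i P_def)
      then show ?thesis using agree by (intro bexI[OF _ w2] exI[of _ "Suc (k + m)"] conjI) blast+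
    next
      case 3
      let ?u = "s1 + 1 / real (Suc m)"
      have u: "0 \<le> ?u" using s by simp
      \<comment> \<open>Since \<open>i1\<close> has Moran sum 1 at \<open>s1\<close>, its constant
        attractor has finite measure there and hence null Hausdorff measure at \<open>?u\<close>;
        null sets survive prepending letters.\<close>
      have "packing_premeasure s1 (F (\<lambda>_. i1)) \<le> ennreal ((2 * D / rm) powr s1)"
        by (rule packing_premeasure_bound[OF s(1) const(1)]) (use g1(1) in \<open>simp add: gsum_def\<close>)
      then have "hausdorff_measure s1 (F (\<lambda>_. i1)) < top"
        using hausdorff_measure_le_packing_premeasure[OF s(1), of "F (\<lambda>_. i1)"]
        by (meson ennreal_less_top order.strict_trans1)
      then have "hausdorff_measure ?u (F (\<lambda>_. i1)) = 0"
        by (rule hausdorff_measure_zero_above) (use s in auto)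
      then have "hausdorff_measure ?u (F (prefixed k \<omega>0 (\<lambda>_. i1))) = 0"
        proof (rule prefixed_induct[where \<Phi> = "\<lambda>\<omega>. hausdorff_measure ?u (F \<omega>) = 0", OF \<omega>0 const(1)])
        fix \<omega> assume "\<omega> \<in> Omega N" "hausdorff_measure ?u (F (shift \<omega>)) = 0"
        then show "hausdorff_measure ?u (F \<omega>) = 0" using hausdorff_measure_F_le[OF _ u, of \<omega>] by simp
      qed
      then have "hausdorff_measure ?u (F (prefixed k \<omega>0 (\<lambda>_. i1))) < ennreal (1 / Suc n)" by simp
      from hausdorff_delta_stable[OF w1 u n this] obtain l where
        l: "\<forall>\<omega>'\<in>Omega N. (\<forall>n<l. \<omega>' n = prefixed k \<omega>0 (\<lambda>_. i1) n) \<longrightarrow>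
          hausdorff_delta ?u (1 / Suc n) (F \<omega>') < ennreal (1 / Suc n)"
        by blast
      then have "\<forall>\<omega>'\<in>Omega N. (\<forall>n<l. \<omega>' n = prefixed k \<omega>0 (\<lambda>_. i1) n) \<longrightarrow> P i \<omega>'"
        using 3 by (simp add: i P_def)
      then show ?thesis using agree by (intro bexI[OF _ w1] exI[of _ l] conjI)
    next
      case 4
      \<comment> \<open>\<open>i2\<close> has Moran sum 1 at \<open>s2\<close>, and
        \<open>t m < s2\<close>.\<close>
      have "packing_premeasure (t m) (F (\<lambda>_. i2)) = top"
        by (rule constant_attractor_premeasure_eq_top[OF t i2 g2(1)])
      then have "packing_premeasure (t m) (F (prefixed k \<omega>0 (\<lambda>_. i2))) = top"
        by (rule prefixed_induct[where \<Phi> = "\<lambda>\<omega>. packing_premeasure (t m) (F \<omega>) = top", OF \<omega>0 const(2)])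
          (rule top_step)
      then have "of_nat n < packing_premeasure (t m) (F (prefixed k \<omega>0 (\<lambda>_. i2)))"
        by (simp add: ennreal_of_nat_eq_real_of_nat)
      from packing_delta_stable[OF w2 n this] obtain l where
        l: "\<forall>\<omega>'\<in>Omega N. (\<forall>n<l. \<omega>' n = prefixed k \<omega>0 (\<lambda>_. i2) n) \<longrightarrow>
          of_nat n < packing_delta (t m) (1 / Suc n) (F \<omega>')"
        by blast
      then have "\<forall>\<omega>'\<in>Omega N. (\<forall>n<l. \<omega>' n = prefixed k \<omega>0 (\<lambda>_. i2) n) \<longrightarrow> P i \<omega>'"
        using 4 by (simp add: i P_def)
      then show ?thesis using agree by (intro bexI[OF _ w2] exI[of _ l] conjI)
    qed
  qed blast
qed

end

section \<open>Passage from the given system to the locales\<close>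

theorem theorem2p5:
  fixes K :: "'a::euclidean_space set"
    and N :: nat
    and J :: "nat \<Rightarrow> nat set"
    and S :: "nat \<Rightarrow> nat \<Rightarrow> 'a \<Rightarrow> 'a"
    and r :: "nat \<Rightarrow> nat \<Rightarrow> real"
    and s :: "nat \<Rightarrow> real"
  defines "smin \<equiv> Min (s ` {1..N})"
    and "smax \<equiv> Max (s ` {1..N})"
    and "Hmin \<equiv> (INF \<omega>\<in>Omega N. hausdorff_measure (Min (s ` {1..N})) (attractor K S J \<omega>))"
    and "Pmax \<equiv> (SUP \<omega>\<in>Omega N. packing_measure (Max (s ` {1..N})) (attractor K S J \<omega>))"
  assumes K: "compact K"
    and N: "1 \<le> N"
    and J: "\<And>i. i \<in> {1..N} \<Longrightarrow> finite (J i) \<and> J i \<noteq> {}"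
    and maps: "\<And>i j. i \<in> {1..N} \<Longrightarrow> j \<in> J i \<Longrightarrow> S i j ` K \<subseteq> K"
    and sim: "\<And>i j x y. i \<in> {1..N} \<Longrightarrow> j \<in> J i \<Longrightarrow> x \<in> K \<Longrightarrow> y \<in> K \<Longrightarrow>
               dist (S i j x) (S i j y) = r i j * dist x y"
    and ratio: "\<And>i j. i \<in> {1..N} \<Longrightarrow> j \<in> J i \<Longrightarrow> 0 < r i j \<and> r i j < 1"
    and s_eq: "\<And>i. i \<in> {1..N} \<Longrightarrow> (\<Sum>j\<in>J i. r i j powr s i) = 1"
    and UOSC: "\<exists>U. open U \<and> U \<noteq> {} \<and> U \<subseteq> K \<and>
               (\<forall>i\<in>{1..N}. (\<Union>j\<in>J i. S i j ` U) \<subseteq> U \<and>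
                  (\<forall>j\<in>J i. \<forall>j'\<in>J i. j \<noteq> j' \<longrightarrow> S i j ` U \<inter> S i j' ` U = {}))"
    and sep: "\<And>\<omega> l i j. \<omega> \<in> Omega N \<Longrightarrow> l \<in> {1..N} \<Longrightarrow> i \<in> J l \<Longrightarrow> j \<in> J l \<Longrightarrow> i \<noteq> j \<Longrightarrow>
               packing_measure smin (S l i ` attractor K S J \<omega> \<inter> S l j ` attractor K S J \<omega>) = 0"
  shows "(smin = smax \<longrightarrow>
            residual_in (Omega_top N) {\<omega> \<in> Omega N.
               hausdorff_dim (attractor K S J \<omega>) = smin \<and>
               packing_dim (attractor K S J \<omega>) = smin \<and>
               0 < hausdorff_measure smin (attractor K S J \<omega>) \<and>
               hausdorff_measure smin (attractor K S J \<omega>) = Hmin \<and>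
               Hmin \<le> Pmax \<and>
               Pmax = packing_measure smin (attractor K S J \<omega>) \<and>
               packing_measure smin (attractor K S J \<omega>) < \<infinity>})
       \<and> (smin < smax \<longrightarrow>
            residual_in (Omega_top N) {\<omega> \<in> Omega N.
               hausdorff_dim (attractor K S J \<omega>) = smin \<and>
               smin < smax \<and>
               packing_dim (attractor K S J \<omega>) = smax \<and>
               hausdorff_measure smin (attractor K S J \<omega>) = \<infinity> \<and>
               packing_measure smax (attractor K S J \<omega>) = 0})"
proof -
  define R where "R = (\<Union>i\<in>{1..N}. r i ` J i)"
  have finR: "finite R" and R01: "\<And>x. x \<in> R \<Longrightarrow> 0 < x \<and> x < 1" using J ratio by (auto simp: R_def)
  \<comment> \<open>The inserted \<open>1/2\<close> keeps both extrema strictly between 0 and 1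
    without inspecting \<open>R\<close>.\<close>
  define rm where "rm = Min (insert (1/2) R)"
  define q where "q = Max (insert (1/2) R)"
  have rm: "0 < rm" "rm < 1" using finR R01 by (auto simp: rm_def Min_less_iff)
  have q: "0 < q" "q < 1" using finR R01 by (auto simp: q_def Max_gr_iff)
  have rq: "rm \<le> r i j \<and> r i j \<le> q" if "i \<in> {1..N}" "j \<in> J i" for i j
  proof -
    have "r i j \<in> R" using that by (auto simp: R_def)
    then show ?thesis using finR by (simp add: rm_def q_def)
  qed
  obtain U where U: "open U" "U \<noteq> {}" "U \<subseteq> K" "\<forall>i\<in>{1..N}. (\<Union>j\<in>J i. S i j ` U) \<subseteq> U \<and>
      (\<forall>j\<in>J i. \<forall>j'\<in>J i. j \<noteq> j' \<longrightarrow> S i j ` U \<inter> S i j' ` U = {})"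
    using UOSC by (elim exE conjE) (rule that)
  have SU: "S i j ` U \<subseteq> U" if "i \<in> {1..N}" "j \<in> J i" for i j
    using U(4) that by blast
  have SUd: "S i j ` U \<inter> S i j' ` U = {}" if "i \<in> {1..N}" "j \<in> J i" "j' \<in> J i" "j \<noteq> j'" for i j j'
    using conjunct2[OF bspec[OF U(4) that(1)]] that(2-) by blast
  have "K \<noteq> {}" using U by blast
  note ratio01 = ratio
  interpret random_ifs_osc K N J S r rm q U
    by unfold_locales (fact K \<open>K \<noteq> {}\<close> J maps sim rq rm q U(1-3) SU SUd | simp add: J maps sim rq SU SUd)+
  have gs: "gsum (s i) i = 1" if "i \<in> {1..N}" for i
    using s_eq[OF that] by (simp add: gsum_def)
  have mono: "gsum u i < gsum t i" if i: "i \<in> {1..N}" and "t < u" for t u i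
    unfolding gsum_def
  proof (rule sum_strict_mono)
    show "finite (J i)" "J i \<noteq> {}" using J[OF i] by auto
    show "r i j powr u < r i j powr t" if "j \<in> J i" for j
      using ratio01[OF i that] \<open>t < u\<close> by (simp add: powr_less_mono')
  qed
  \<comment> \<open>At exponent 0 the Moran sum counts the maps and is at least 1; a negative
    solution would make it less than 1 by strict monotonicity.\<close>
  have s_nonneg: "0 \<le> s i" if i: "i \<in> {1..N}" for i
  proof (rule ccontr)
    assume "\<not> 0 \<le> s i"
    then have "gsum 0 i < 1" using mono[OF i, of "s i" 0] gs[OF i] by simp
    moreover have "gsum 0 i = (\<Sum>j\<in>J i. 1)"
      unfolding gsum_def using ratio01[OF i] by (intro sum.cong) fastforce+
    moreover have "card (J i) \<noteq> 0" using J[OF i] by simp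
    ultimately show False by simp
  qed
  have ne: "finite (s ` {1..N})" "s ` {1..N} \<noteq> {}" using N by auto
  obtain i1 where i1: "i1 \<in> {1..N}" "smin = s i1" using Min_in[OF ne] by (auto simp: smin_def)
  obtain i2 where i2: "i2 \<in> {1..N}" "smax = s i2" using Max_in[OF ne] by (auto simp: smax_def)
  have bounds: "smin \<le> s i" "s i \<le> smax" if "i \<in> {1..N}" for i
    using that ne by (auto simp: smin_def smax_def)
  have smin0: "0 \<le> smin" using i1 s_nonneg by simp
  show ?thesis
  proof (intro conjI impI)
    assume eq: "smin = smax"
    have "gsum smin i = 1" if "i \<in> {1..N}" for i
      using gs[OF that] bounds[OF that] eq by simp
    from typical_equal_dimensions[OF smin0 N this sep]
    show "residual_in (Omega_top N) {\<omega> \<in> Omega N.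
               hausdorff_dim (attractor K S J \<omega>) = smin \<and>
               packing_dim (attractor K S J \<omega>) = smin \<and>
               0 < hausdorff_measure smin (attractor K S J \<omega>) \<and>
               hausdorff_measure smin (attractor K S J \<omega>) = Hmin \<and>
               Hmin \<le> Pmax \<and>
               Pmax = packing_measure smin (attractor K S J \<omega>) \<and>
               packing_measure smin (attractor K S J \<omega>) < \<infinity>}"
      unfolding Hmin_def Pmax_def smin_def[symmetric] smax_def[symmetric] eq[symmetric] by simp
  next
    assume less: "smin < smax"
    \<comment> \<open>Moran sums decrease in the exponent and equal 1 at \<open>s i\<close>, which
      lies between \<open>smin\<close> and \<open>smax\<close>.\<close>
    have 1: "1 \<le> gsum smin i" "gsum smax i \<le> 1" if "i \<in> {1..N}" for i
      using mono[OF that, of smin "s i"] mono[OF that, of "s i" smax] gs[OF that] bounds[OF that]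
      by (auto simp: order_le_less)
    show "residual_in (Omega_top N) {\<omega> \<in> Omega N.
               hausdorff_dim (attractor K S J \<omega>) = smin \<and>
               smin < smax \<and>
               packing_dim (attractor K S J \<omega>) = smax \<and>
               hausdorff_measure smin (attractor K S J \<omega>) = \<infinity> \<and>
               packing_measure smax (attractor K S J \<omega>) = 0}"
    proof (rule typical_distinct_dimensions[OF smin0 less i1(1) i2(1)])
      show "gsum smin i1 = 1" "gsum smax i2 = 1" using gs i1 i2 by auto
      show "1 < gsum smin i2" using mono[OF i2(1) less] gs[OF i2(1)] i2(2) by simp
      show "gsum smax i1 < 1" using mono[OF i1(1) less] gs[OF i1(1)] i1(2) by simp
    qed (use 1 in auto)
  qed
qed

end
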